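(* Let $H$ be a directed graph with a cyclic ample framing. Then $\mathrm{vol}\,\widehat{\mathcal{F}}(H)=\#\mathcal{F}^{\circlearrowleft}_{\mathbf{0}}(H)$.
   Context: $H=(V,E)$ is a finite directed graph (possibly with directed cycles), sources (indegree 0) and sinks (outdegree 0) of degree one, no idle edges, full (internal vertices have indegree and outdegree 2). A minimal cycle is a directed cycle no proper subset of which is a directed cycle; $\mathsf{Cycles}(H)$ is their set. A cyclic ample framing is a colouring of $E$ in red/blue giving distinct colours to the two incoming and two outgoing edges of each internal vertex, with every minimal cycle monochromatic. Netflow of $f\in\mathbb{R}^E$ at $v$: $\mathrm{nf}_f(v)=\sum_{e\in\mathrm{out}(v)}f(e)-\sum_{e\in\mathrm{in}(v)}f(e)$. $\mathcal{F}^+(H)$ is the cone of nonnegative $f$ with netflow 0 at all internal vertices. The flow complex is $\widehat{\mathcal{F}}(H)=\{f\in\mathcal{F}^+(H):\sum_{s\text{ source}}\sum_{e\in\mathrm{out}(s)}f(e)+\sum_{C\in\mathsf{Cycles}(H)}\min_{e\in C}f(e)=1\}$; its normalized volume is measured with respect to the lattice $\mathbb{Z}^E$, each unimodular simplex having normalized volume 1. A cyclic integer flow is $f:E\to\mathbb{Z}_{\ge0}$ such that (i) every minimal cycle $C$ has exactly one edge $e_C$ with $f(e_C)=0$, and (ii) the netflow at every internal vertex is $1$ except at the tails of the edges $e_C$, where it is $0$. $\mathcal{F}^{\circlearrowleft}_{\mathbf{0}}(H)$ is the set of cyclic integer flows with netflow $0$ at every source (cyclic volume integer flows).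
   Formalization: Adds the hypothesis that no vertex carrying a loop lies on a minimal cycle of length at least 2; without it the claim fails (two vertices joined by red edges both ways, each with a blue loop: volume 1, no cyclic integer flows). The graph is assumed to have an edge. *)

theory Defs
  imports "HOL-Analysis.Analysis" "Graph_Theory.Arc_Walk"
begin

section \<open>Normalized volume with respect to the integer lattice\<close>

definition integer_lattice :: "(real ^ 'n) set" where
  "integer_lattice = {x. \<forall>i. x $ i \<in> \<int>}"

definition direction :: "'a::real_vector set \<Rightarrow> 'a set" where
  "direction A = {x - y | x y. x \<in> A \<and> y \<in> A}"

text \<open>\<open>b 0, \<dots>, b (dim U - 1)\<close> is a basis of the subspace \<open>U\<close> and also a basis over the
  integers of the lattice of integer points of \<open>U\<close>.\<close>

definition lattice_basis :: "(real ^ 'n) set \<Rightarrow> (nat \<Rightarrow> real ^ 'n) \<Rightarrow> bool" where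
  "lattice_basis U b \<longleftrightarrow>
     inj_on b {..<dim U} \<and> independent (b ` {..<dim U}) \<and> span (b ` {..<dim U}) = U \<and>
     U \<inter> integer_lattice = {\<Sum>i<dim U. of_int (c i) *\<^sub>R b i | c :: nat \<Rightarrow> int. True}"

text \<open>Normalized volume of \<open>S \<inter> A\<close> inside a rational affine subspace \<open>A\<close> of dimension \<open>k\<close>: Lebesgue
  measure in lattice coordinates, times \<open>k!\<close>, so that a unimodular simplex has volume 1. The value
  does not depend on which point of \<open>A\<close> and which lattice basis are chosen.\<close>

definition normalized_volume_in :: "(real ^ 'n) set \<Rightarrow> (real ^ 'n) set \<Rightarrow> real" where
  "normalized_volume_in A S =
     (let k = dim (direction A);
          p = (SOME p. p \<in> A);
          b = (SOME b. lattice_basis (direction A) b)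
      in fact k * measure (\<Pi>\<^sub>M i\<in>{..<k}. lborel)
                   {y \<in> {..<k} \<rightarrow>\<^sub>E UNIV. p + (\<Sum>i<k. y i *\<^sub>R b i) \<in> S})"

text \<open>For a finite union \<open>S\<close> of polytopes, \<open>polyhedral_dim S\<close> is the largest dimension of one of
  them, and \<open>top_hulls S\<close> is the finite set of affine hulls of the polytopes of that dimension. The
  normalized volume of \<open>S\<close> adds up the contributions of these affine spaces; two different ones meet
  in smaller dimension.\<close>

definition polyhedral_dim :: "'a::euclidean_space set \<Rightarrow> int" where
  "polyhedral_dim S = Max {aff_dim C | C. convex C \<and> C \<subseteq> S}"

definition top_hulls :: "'a::euclidean_space set \<Rightarrow> 'a set set" where
  "top_hulls S = {affine hull C | C. convex C \<and> C \<subseteq> S \<and> aff_dim C = polyhedral_dim S}"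

definition normalized_volume :: "(real ^ 'n) set \<Rightarrow> real" where
  "normalized_volume S = (\<Sum>A\<in>top_hulls S. normalized_volume_in A S)"


section \<open>Full directed graphs and cyclic ample framings\<close>

definition sources :: "('v, 'e) pre_digraph \<Rightarrow> 'v set" where
  "sources H = {v \<in> verts H. in_degree H v = 0}"

definition sinks :: "('v, 'e) pre_digraph \<Rightarrow> 'v set" where
  "sinks H = {v \<in> verts H. out_degree H v = 0}"

definition internal_verts :: "('v, 'e) pre_digraph \<Rightarrow> 'v set" where
  "internal_verts H = verts H - sources H - sinks H"

text \<open>An edge is idle if it is the only edge leaving, or the only edge entering, an internal vertex.\<close>

definition idle_edge :: "('v, 'e) pre_digraph \<Rightarrow> 'e \<Rightarrow> bool" where
  "idle_edge H e \<longleftrightarrow> e \<in> arcs H \<and>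
     (tail H e \<in> internal_verts H \<and> out_arcs H (tail H e) = {e} \<or>
      head H e \<in> internal_verts H \<and> in_arcs H (head H e) = {e})"

text \<open>Parallel edges and loops are allowed; a loop counts both for the indegree and for the
  outdegree of its vertex.\<close>

definition full_digraph :: "('v, 'e) pre_digraph \<Rightarrow> bool" where
  "full_digraph H \<longleftrightarrow>
     fin_digraph H \<and>
     (\<forall>v\<in>sources H. out_degree H v = 1) \<and>
     (\<forall>v\<in>sinks H. in_degree H v = 1) \<and>
     (\<forall>e\<in>arcs H. \<not> idle_edge H e) \<and>
     (\<forall>v\<in>internal_verts H. in_degree H v = 2 \<and> out_degree H v = 2)"

text \<open>Directed cycles are the edge sets of nonempty closed walks.\<close>

definition directed_cycles :: "('v, 'e) pre_digraph \<Rightarrow> 'e set set" where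
  "directed_cycles H = {set p | p. p \<noteq> [] \<and> (\<exists>u. pre_digraph.awalk H u p u)}"

definition minimal_cycles :: "('v, 'e) pre_digraph \<Rightarrow> 'e set set" where
  "minimal_cycles H = {C \<in> directed_cycles H. \<forall>D \<in> directed_cycles H. \<not> D \<subset> C}"

datatype colour = Red | Blue

definition cyclic_ample_framing :: "('v, 'e) pre_digraph \<Rightarrow> ('e \<Rightarrow> colour) \<Rightarrow> bool" where
  "cyclic_ample_framing H col \<longleftrightarrow>
     (\<forall>v\<in>internal_verts H. inj_on col (in_arcs H v) \<and> inj_on col (out_arcs H v)) \<and>
     (\<forall>C\<in>minimal_cycles H. \<forall>e\<in>C. \<forall>e'\<in>C. col e = col e')"

text \<open>No loop sits at a vertex of a minimal cycle that is not itself a loop. This holds in every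
  loopfree digraph. Without it, condition (ii) on cyclic integer flows counts too little: with red
  edges from \<open>a\<close> to \<open>b\<close> and back, and a blue loop at each of \<open>a\<close> and \<open>b\<close>, there is no cyclic integer
  flow, whereas the flow complex is a unimodular triangle.\<close>

definition loops_avoid_longer_cycles :: "('v, 'e) pre_digraph \<Rightarrow> bool" where
  "loops_avoid_longer_cycles H \<longleftrightarrow>
     (\<forall>e\<in>arcs H. \<forall>C\<in>minimal_cycles H.
        tail H e = head H e \<and> tail H e \<in> tail H ` C \<longrightarrow> card C = 1)"


section \<open>Flows\<close>

definition netflow :: "('v, 'e) pre_digraph \<Rightarrow> ('e \<Rightarrow> 'a::ab_group_add) \<Rightarrow> 'v \<Rightarrow> 'a" where
  "netflow H f v = (\<Sum>e\<in>out_arcs H v. f e) - (\<Sum>e\<in>in_arcs H v. f e)"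

text \<open>The edge set is the whole index type \<open>'e\<close>, so that \<open>real ^ 'e\<close> is the space of real functions
  on the edges and \<open>integer_lattice\<close> is the lattice of integer functions.\<close>

definition flow_cone :: "('v, 'e::finite) pre_digraph \<Rightarrow> (real ^ 'e) set" where
  "flow_cone H = {f. (\<forall>e. 0 \<le> f $ e) \<and> (\<forall>v\<in>internal_verts H. netflow H (($) f) v = 0)}"

definition flow_complex :: "('v, 'e::finite) pre_digraph \<Rightarrow> (real ^ 'e) set" where
  "flow_complex H = {f \<in> flow_cone H.
     (\<Sum>s\<in>sources H. \<Sum>e\<in>out_arcs H s. f $ e) + (\<Sum>C\<in>minimal_cycles H. Min (($) f ` C)) = 1}"

definition cyclic_integer_flow :: "('v, 'e) pre_digraph \<Rightarrow> ('e \<Rightarrow> nat) \<Rightarrow> bool" where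
  "cyclic_integer_flow H f \<longleftrightarrow>
     (\<forall>C\<in>minimal_cycles H. \<exists>!e. e \<in> C \<and> f e = 0) \<and>
     (\<forall>v\<in>internal_verts H. netflow H (\<lambda>e. int (f e)) v =
        (if \<exists>C\<in>minimal_cycles H. \<exists>e\<in>C. f e = 0 \<and> tail H e = v then 0 else 1))"

definition cyclic_volume_integer_flows :: "('v, 'e) pre_digraph \<Rightarrow> ('e \<Rightarrow> nat) set" where
  "cyclic_volume_integer_flows H =
     {f. cyclic_integer_flow H f \<and> (\<forall>s\<in>sources H. netflow H (\<lambda>e. int (f e)) s = 0)}"

end

theory Submission
  imports Defs
begin

text \<open>On each minimal cycle choose an edge \<open>z\<close> of minimal flow; subtracting that minimum along every
  cycle turns a flow on \<open>H\<close> into a flow on the acyclic graph in which the chosen edges have been cut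
  into edges from a source to a sink. This change of coordinates is unimodular, and it turns the
  defining function of the flow complex into the total flow out of the sources.

  The cone of flows on an acyclic graph is triangulated by unimodular cones, by induction: at a
  vertex \<open>v\<close> all of whose incoming edges start at sources, let \<open>a\<close> enter and \<open>b\<close> leave \<open>v\<close>. Where
  \<open>f a \<ge> f b\<close>, replace \<open>f a\<close> by \<open>f a - f b\<close> and let \<open>b\<close> start at a source; where \<open>f a \<le> f b\<close>,
  replace \<open>f b\<close> by \<open>f b - f a\<close> and let \<open>a\<close> end at the head of \<open>b\<close>. The integer flows whose netflow at
  every inner vertex is the indegree minus one satisfy the same recursion (\<open>g b = 0\<close> or \<open>g b > 0\<close>),
  so they index the maximal cones. Adding one on the uncut edges of the cycles identifies them with
  the cyclic volume integer flows whose zeros on the cycles are the chosen edges.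

  Cutting may leave a vertex with incoming but no outgoing edges, or conversely. Such a choice admits
  no integer flow, and its part of the complex has smaller dimension, because two consecutive edges of
  a minimal cycle are separated by some flow.\<close>

text \<open>\<open>flow_value\<close> is only piecewise linear, so the complex may span several
  affine spaces of top dimension, and its volume is a sum over them. The choices of cut edges name
  pieces on which \<open>flow_value\<close> is linear. Each cell is the image of a coordinate cone
  under an automorphism of the whole lattice, so its slice of value 1 is a simplex of measure 1 / k!
  in every lattice basis, whichever one the definition of the volume picks.

  Cutting destroys the degrees 2 and 2, and the recursion changes degrees again; hence it runs on
  acyclic graphs with arbitrary positive degrees. Netflow indegree minus one is the condition that
  it preserves: moving the head of \<open>a\<close> along \<open>b\<close> lowers the indegree of
  \<open>v\<close> by one and costs one unit of \<open>g b\<close>.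

  At least one cell must exist, as otherwise the dimension of the complex would be unknown; this
  follows because a space of flows is no finite union of proper subspaces. That degenerate choices
  yield proper subspaces rests on the hypothesis on loops.\<close>

section \<open>Unimodular changes of coordinates and product measures\<close>

text \<open>The library proves the change of variables formula for linear maps only over well-ordered
  index types.\<close>

typedef 'a ordered_copy = "UNIV :: 'a set"
  by simp

instance ordered_copy :: (finite) finite
proof
  have "(UNIV :: 'a ordered_copy set) = range Abs_ordered_copy"
    by (metis Rep_ordered_copy_inverse surjI)
  then show "finite (UNIV :: 'a ordered_copy set)"
    by (metis finite finite_imageI)
qed

lemma card_ordered_copy: "CARD('a ordered_copy) = CARD('a)"
  using type_definition.card[OF type_definition_ordered_copy] .

instantiation ordered_copy :: (finite) wellorder
begin

definition enum_ordered_copy :: "'a ordered_copy \<Rightarrow> nat" where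
  "enum_ordered_copy = (SOME f. inj f)"

definition less_eq_ordered_copy :: "'a ordered_copy \<Rightarrow> 'a ordered_copy \<Rightarrow> bool" where
  "x \<le> y \<longleftrightarrow> enum_ordered_copy x \<le> enum_ordered_copy y"

definition less_ordered_copy :: "'a ordered_copy \<Rightarrow> 'a ordered_copy \<Rightarrow> bool" where
  "x < y \<longleftrightarrow> enum_ordered_copy x < enum_ordered_copy y"

lemma inj_enum_ordered_copy: "inj (enum_ordered_copy :: 'a ordered_copy \<Rightarrow> nat)"
proof -
  have "\<exists>f :: 'a ordered_copy \<Rightarrow> nat. inj f"
    using finite_imp_inj_to_nat_seg[OF finite[of UNIV]] by blast
  then show ?thesis
    unfolding enum_ordered_copy_def by (rule someI_ex[of inj])
qed

instance
proof
  fix x y z :: "'a ordered_copy"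
  show "x < y \<longleftrightarrow> x \<le> y \<and> \<not> y \<le> x" "x \<le> x" "x \<le> y \<or> y \<le> x"
    by (auto simp: less_eq_ordered_copy_def less_ordered_copy_def)
  show "x \<le> z" if "x \<le> y" "y \<le> z"
    using that by (auto simp: less_eq_ordered_copy_def)
  show "x = y" if "x \<le> y" "y \<le> x"
    using that inj_enum_ordered_copy by (auto simp: less_eq_ordered_copy_def inj_eq)
  fix P :: "'a ordered_copy \<Rightarrow> bool"
  assume step: "\<And>x. (\<And>y. y < x \<Longrightarrow> P y) \<Longrightarrow> P x"
  show "P x"
    by (induction x rule: measure_induct_rule[where f = enum_ordered_copy])
      (rule step, simp add: less_ordered_copy_def)
qed

end

text \<open>Both determinants are integers and their product is 1.\<close>

lemma abs_det_integer_matrix: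
  fixes A B :: "real ^ 'n ^ 'n"
  assumes "A ** B = mat 1" "\<And>i j. A $ i $ j \<in> \<int>" "\<And>i j. B $ i $ j \<in> \<int>"
  shows "\<bar>det A\<bar> = 1"
proof -
  have Ints_det: "det C \<in> \<int>" if "\<And>i j. C $ i $ j \<in> \<int>" for C :: "real ^ 'n ^ 'n"
    unfolding det_def using that by (auto intro!: Ints_sum Ints_mult Ints_prod)
  obtain a b where "det A = of_int a" "det B = of_int b"
    using assms(2,3) Ints_det by (meson Ints_cases)
  moreover have "det A * det B = 1"
    using assms(1) by (metis det_I det_mul)
  ultimately have "a * b = 1"
    by (metis of_int_1 of_int_eq_iff of_int_mult)
  then have "\<bar>a\<bar> = 1"
    by (metis zmult_eq_1_iff abs_1 abs_minus_cancel)
  then show ?thesis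
    using \<open>det A = of_int a\<close> by simp
qed


text \<open>Padding by the unit cube turns the measure on functions on an index set into Lebesgue measure
  on a vector space.\<close>

lemma emeasure_PiM_eq_padded:
  fixes idx :: "nat \<Rightarrow> 'm::finite"
  assumes inj: "inj_on idx {..<k}" and X: "X \<in> sets (\<Pi>\<^sub>M i\<in>{..<k}. lborel :: real measure)"
  defines "pr \<equiv> \<lambda>x :: real ^ 'm. \<lambda>i\<in>{..<k}. x $ idx i"
  defines "Q \<equiv> {x :: real ^ 'm. \<forall>r\<in>- idx ` {..<k}. 0 \<le> x $ r \<and> x $ r \<le> 1}"
  shows "emeasure lborel (pr -` X \<inter> Q) = emeasure (\<Pi>\<^sub>M i\<in>{..<k}. lborel) X"
    and "pr -` X \<inter> Q \<in> sets lborel"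
proof -
  let ?P = "\<Pi>\<^sub>M i\<in>{..<k}. lborel :: real measure"
  have pr: "pr \<in> borel \<rightarrow>\<^sub>M ?P"
    unfolding pr_def by (intro measurable_restrict) (simp add: borel_measurable_continuous_onI continuous_on_component)
  have "closed Q"
    unfolding Q_def Ball_def
    by (intro closed_Collect_all closed_Collect_imp closed_Collect_conj closed_Collect_le)
       (auto intro!: continuous_intros)
  then have Q: "Q \<in> sets borel" by simp
  show "pr -` X \<inter> Q \<in> sets lborel"
    using measurable_sets[OF pr X] Q by auto
  \<comment> \<open>The image of Lebesgue measure on the slab \<open>Q\<close>. A product measure is
    determined by its values on boxes, so only boxes have to be computed.\<close>
  define \<mu> where "\<mu> = distr (density lborel (indicator Q)) ?P pr"
  have pr': "pr \<in> density lborel (indicator Q) \<rightarrow>\<^sub>M ?P" using pr by simp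
  have em: "emeasure \<mu> Y = emeasure lborel (pr -` Y \<inter> Q)" if "Y \<in> sets ?P" for Y
  proof -
    have "emeasure \<mu> Y = emeasure (density lborel (indicator Q)) (pr -` Y)"
      unfolding \<mu>_def using that pr' by (subst emeasure_distr) auto
    also have "\<dots> = emeasure lborel (Q \<inter> pr -` Y)"
      using that Q measurable_sets[OF pr that]
        by (subst emeasure_density) (auto simp: nn_integral_indicator[symmetric] indicator_inter_arith simp del: nn_integral_indicator)
    finally show ?thesis by (simp add: Int_commute)
  qed
  have "?P = \<mu>"
  proof (rule product_sigma_finite.PiM_eqI[symmetric])
    show "product_sigma_finite (\<lambda>_ :: nat. lborel :: real measure)" by standard
    show "sets \<mu> = sets ?P" by (simp add: \<mu>_def)
    fix A :: "nat \<Rightarrow> real set" assume A: "\<And>i. i \<in> {..<k} \<Longrightarrow> A i \<in> sets lborel"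
    define B where "B = (\<lambda>b :: real ^ 'm. \<Pi>\<^sub>E i\<in>{b}. (UNIV :: real set))"
    \<comment> \<open>The sides of the padded box: unit intervals in the padding directions
      contribute the factor 1.\<close>
    define D where "D = (\<lambda>r. if r \<in> idx ` {..<k} then A (the_inv_into {..<k} idx r) else {0..1})"
    have D: "D r \<in> sets lborel" for r
    proof (cases "r \<in> idx ` {..<k}")
      case True
      then have "the_inv_into {..<k} idx r \<in> {..<k}"
        by (rule the_inv_into_into[OF inj _ order_refl])
      then show ?thesis
        using A True by (simp add: D_def)
    qed (simp add: D_def)
    have "pr -` Pi\<^sub>E {..<k} A \<inter> Q = {x. \<forall>r. x $ r \<in> D r}"
    proof -
      have "x \<in> pr -` Pi\<^sub>E {..<k} A \<inter> Q \<longleftrightarrow> (\<forall>r. x $ r \<in> D r)"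
        for x
      proof -
        have "(\<forall>r. x $ r \<in> D r) \<longleftrightarrow> (\<forall>r\<in>idx ` {..<k}. x $ r \<in> D r) \<and> (\<forall>r\<in>- idx ` {..<k}. x $ r \<in> D r)"
          by blast
        moreover have "(\<forall>r\<in>idx ` {..<k}. x $ r \<in> D r) \<longleftrightarrow> pr x \<in> Pi\<^sub>E {..<k} A"
          by (auto simp: D_def pr_def the_inv_into_f_f[OF inj] PiE_def Pi_def)
        moreover have "(\<forall>r\<in>- idx ` {..<k}. x $ r \<in> D r) \<longleftrightarrow> x \<in> Q"
          by (simp add: D_def Q_def)
        ultimately show ?thesis by simp
      qed
      then show ?thesis by blast
    qed
    also have "emeasure lborel \<dots> = (\<Prod>r\<in>UNIV. emeasure lborel (D r))"
    proof -
      interpret product_sigma_finite "\<lambda>_ :: real ^ 'm. lborel :: real measure" by standard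
      \<comment> \<open>\<open>lborel\<close> is the image of a product indexed by basis vectors, so
        the sides are relabelled; \<open>SOME\<close> recovers \<open>r\<close> from
        \<open>axis r 1\<close>.\<close>
      let ?D = "\<lambda>b :: real ^ 'm. D (SOME r. b = axis r 1)"
      have some: "(SOME r. axis r' (1::real) = (axis r 1 :: real ^ 'm)) = r'" for r'
        by (rule some_equality) (auto simp: axis_eq_axis)
      have meas: "{x. \<forall>r. x $ r \<in> D r} \<in> sets (borel :: (real ^ 'm) measure)"
        using D by measurable
      have coord: "(\<Sum>b\<in>Basis. f b *\<^sub>R b :: real ^ 'm) $ r = f (axis r 1)" for f r
        unfolding cart_eq_inner_axis by (rule inner_sum_left_Basis) simp
      have set_eq: "(\<lambda>f. \<Sum>b\<in>Basis. f b *\<^sub>R b) -` {x. \<forall>r. x $ r \<in> D r} \<inter> space (Pi\<^sub>M (Basis :: (real ^ 'm) set) (\<lambda>b. lborel)) = Pi\<^sub>E Basis ?D"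
      proof (rule set_eqI)
        fix f :: "real ^ 'm \<Rightarrow> real"
        have "(\<forall>r. f (axis r 1) \<in> D r) \<longleftrightarrow> (\<forall>b\<in>Basis. f b \<in> ?D b)"
          by (auto simp: Basis_vec_def some)
        then show "f \<in> (\<lambda>f. \<Sum>b\<in>Basis. f b *\<^sub>R b) -` {x. \<forall>r. x $ r \<in> D r} \<inter>
            space (Pi\<^sub>M (Basis :: (real ^ 'm) set) (\<lambda>b. lborel)) \<longleftrightarrow> f \<in> Pi\<^sub>E Basis ?D"
          unfolding Int_iff vimage_eq mem_Collect_eq coord space_PiM PiE_iff by simp
      qed
      have "emeasure lborel {x. \<forall>r. x $ r \<in> D r} = 
        emeasure (Pi\<^sub>M (Basis :: (real ^ 'm) set) (\<lambda>b. lborel)) (Pi\<^sub>E Basis ?D)"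
      proof -
        have "(\<lambda>f. \<Sum>b\<in>Basis. f b *\<^sub>R b) \<in> Pi\<^sub>M (Basis :: (real ^ 'm) set) (\<lambda>b. lborel) \<rightarrow>\<^sub>M borel"
          by measurable
        from emeasure_distr[OF this meas] show ?thesis
          by (subst lborel_eq) (simp only: set_eq)
      qed
      also have "\<dots> = (\<Prod>b\<in>Basis. emeasure lborel (?D b))"
        by (rule emeasure_PiM) (use D in auto)
      also have "\<dots> = (\<Prod>r\<in>UNIV. emeasure lborel (D r))"
        by (rule prod.reindex_bij_witness[where i = "\<lambda>r. axis r 1" and j = "\<lambda>b. SOME r. b = axis r 1"])
          (auto simp: Basis_vec_def some)
      finally show ?thesis .
    qed
    also have "\<dots> = (\<Prod>r\<in>idx ` {..<k}. emeasure lborel (D r))"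
      by (rule prod.mono_neutral_right) (auto simp: D_def)
    also have "\<dots> = (\<Prod>i<k. emeasure lborel (A i))"
      by (subst prod.reindex[OF inj]) (auto simp: D_def the_inv_into_f_f[OF inj])
    finally show "emeasure \<mu> (Pi\<^sub>E {..<k} A) = (\<Prod>i<k. emeasure lborel (A i))"
      using A by (subst em) auto
  qed auto
  then show "emeasure lborel (pr -` X \<inter> Q) = emeasure ?P X"
    using em[OF X] by simp
qed


text \<open>An integer matrix with integer inverse has determinant 1 or -1. This makes the volume
  independent of the lattice basis. The type \<open>'e\<close> provides room for the
  \<open>k\<close> coordinates.\<close>

lemma measure_PiM_unimodular:
  fixes c :: "nat \<Rightarrow> real" and U U' :: "nat \<Rightarrow> nat \<Rightarrow> real"
  assumes k: "k \<le> CARD('e::finite)"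
    and U: "\<And>i j. U i j \<in> \<int>" and U': "\<And>i j. U' i j \<in> \<int>"
    and inv: "\<And>i j. i < k \<Longrightarrow> j < k \<Longrightarrow> (\<Sum>l<k. U i l * U' l j) = (if i = j then 1 else 0)"
    and X: "X \<in> sets (Pi\<^sub>M {..<k} (\<lambda>_. lborel))" "emeasure (Pi\<^sub>M {..<k} (\<lambda>_. lborel)) X < \<infinity>"
  shows "measure (Pi\<^sub>M {..<k} (\<lambda>_. lborel))
      {y \<in> {..<k} \<rightarrow>\<^sub>E UNIV. (\<lambda>i\<in>{..<k}. c i + (\<Sum>j<k. U i j * y j)) \<in> X} =
    measure (Pi\<^sub>M {..<k} (\<lambda>_. lborel)) X"
proof -
  let ?P = "Pi\<^sub>M {..<k} (\<lambda>_. lborel :: real measure)"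
  have "card {..<k} \<le> CARD('e ordered_copy)"
    using k by (simp add: card_ordered_copy)
  then obtain idx :: "nat \<Rightarrow> 'e ordered_copy" where inj: "inj_on idx {..<k}"
    using card_le_inj[OF finite_lessThan finite[of UNIV]] by blast
  define pr where "pr = (\<lambda>x :: real ^ 'e ordered_copy. \<lambda>i\<in>{..<k}. x $ idx i)"
  define Q where "Q = {x :: real ^ 'e ordered_copy. \<forall>r\<in>- idx ` {..<k}. 0 \<le> x $ r \<and> x $ r \<le> 1}"
  define ix where "ix = the_inv_into {..<k} idx"
  have ix [simp]: "ix (idx i) = i" if "i < k" for i
    using that by (simp add: ix_def the_inv_into_f_f[OF inj])
  \<comment> \<open>\<open>V\<close> on the embedded coordinates and the identity on the padding, so
    that \<open>Q\<close> is preserved.\<close>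
  define mtx where "mtx = (\<lambda>V :: nat \<Rightarrow> nat \<Rightarrow> real. \<chi> r s. if r \<in> idx ` {..<k} \<and> s \<in> idx ` {..<k}
      then V (ix r) (ix s) else if r = s then 1 else (0 :: real))"
  have mtx_int: "mtx V $ r $ s \<in> \<int>" if "\<And>i j. V i j \<in> \<int>" for V r s
    using that by (auto simp: mtx_def)
  have mtx_in: "(mtx V *v x) $ idx i = (\<Sum>j<k. V i j * x $ idx j)" if "i < k" for V x i
  proof -
    have "(mtx V *v x) $ idx i = (\<Sum>s\<in>UNIV. (if s \<in> idx ` {..<k} then V i (ix s) * x $ s else 0))"
      using that by (auto simp: matrix_vector_mult_def mtx_def intro!: sum.cong)
    also have "\<dots> = (\<Sum>s\<in>idx ` {..<k}. V i (ix s) * x $ s)"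
      by (simp add: sum.If_cases)
    also have "\<dots> = (\<Sum>j<k. V i j * x $ idx j)"
      by (subst sum.reindex[OF inj]) simp
    finally show ?thesis .
  qed
  have mtx_out: "(mtx V *v x) $ r = x $ r" if "r \<notin> idx ` {..<k}" for V x r
  proof -
    have "(mtx V *v x) $ r = (\<Sum>s\<in>UNIV. (if r = s then 1 else 0) * x $ s)"
      using that by (auto simp: matrix_vector_mult_def mtx_def)
    then show ?thesis by (simp add: if_distrib[of "\<lambda>z. z * _"] cong: if_cong)
  qed
  have UU': "mtx U ** mtx U' = mat 1"
  proof -
    have "mtx U *v (mtx U' *v x) = x" for x
    proof (rule iffD2[OF vec_eq_iff], rule allI)
      fix r
      show "(mtx U *v (mtx U' *v x)) $ r = x $ r"
      proof (cases "r \<in> idx ` {..<k}")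
        case True
        then obtain i where i: "r = idx i" "i < k" by auto
        have "(mtx U *v (mtx U' *v x)) $ idx i = (\<Sum>l<k. U i l * (\<Sum>j<k. U' l j * x $ idx j))"
          using i by (simp add: mtx_in)
        also have "\<dots> = (\<Sum>l<k. \<Sum>j<k. U i l * U' l j * x $ idx j)"
          by (simp add: sum_distrib_left mult.assoc)
        also have "\<dots> = (\<Sum>j<k. (\<Sum>l<k. U i l * U' l j) * x $ idx j)"
          by (subst sum.swap) (simp add: sum_distrib_right)
        also have "\<dots> = (\<Sum>j<k. if i = j then x $ idx j else 0)"
          using i inv by (intro sum.cong) auto
        also have "\<dots> = x $ idx i" using i by simp
        finally show ?thesis using i by simp
      qed (simp add: mtx_out)
    qed
    then show ?thesis
      by (metis matrix_eq matrix_vector_mul_assoc matrix_vector_mul_lid)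
  qed
  then have U'U: "mtx U' ** mtx U = mat 1"
    using matrix_left_right_inverse by blast
  define d where "d = (\<chi> r. if r \<in> idx ` {..<k} then c (ix r) else 0)"
  define aff where "aff = (\<lambda>y :: nat \<Rightarrow> real. \<lambda>i\<in>{..<k}. c i + (\<Sum>j<k. U i j * y j))"
  let ?Y = "{y \<in> {..<k} \<rightarrow>\<^sub>E UNIV. aff y \<in> X}"
  have pr_aff: "pr (d + mtx U *v x) = aff (pr x)" for x
    by (auto simp: pr_def aff_def d_def mtx_in intro!: restrict_ext sum.cong)
  have Q_aff: "d + mtx U *v x \<in> Q \<longleftrightarrow> x \<in> Q" for x
    by (simp add: Q_def d_def mtx_out)
  have "aff \<in> ?P \<rightarrow>\<^sub>M ?P"
    unfolding aff_def by (intro measurable_restrict) (measurable)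
  then have Y: "?Y \<in> sets ?P"
  proof -
    have "?Y = aff -` X \<inter> space ?P"
      by (auto simp: space_PiM)
    then show ?thesis
      using measurable_sets[OF \<open>aff \<in> ?P \<rightarrow>\<^sub>M ?P\<close> X(1)] by simp
  qed
  \<comment> \<open>The preimage is rewritten as an image under the inverse matrix, the form that
    the change of variables formula takes.\<close>
  have eq: "pr -` ?Y \<inter> Q = (\<lambda>x. mtx U' *v x) ` ((\<lambda>x. x - d) ` (pr -` X \<inter> Q))" (is "?L = ?R")
  proof (intro equalityI subsetI)
    fix x assume x: "x \<in> ?L"
    have "mtx U' *v ((d + mtx U *v x) - d) = x"
      by (simp add: matrix_vector_mul_assoc U'U)
    moreover have "d + mtx U *v x \<in> pr -` X \<inter> Q"
      using x by (simp add: pr_aff Q_aff)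
    ultimately show "x \<in> ?R"
      by (metis imageI)
  next
    fix x assume "x \<in> ?R"
    then obtain z where z: "z \<in> pr -` X \<inter> Q" "x = mtx U' *v (z - d)" by auto
    then have "d + mtx U *v x = z"
      by (simp add: matrix_vector_mul_assoc UU')
    then have "pr z = aff (pr x)" "x \<in> Q"
      using z pr_aff[of x] Q_aff[of x] by auto
    moreover have "pr x \<in> {..<k} \<rightarrow>\<^sub>E UNIV"
      by (simp add: pr_def)
    ultimately show "x \<in> ?L"
      using z by simp
  qed
  have S: "pr -` X \<inter> Q \<in> lmeasurable"
    using emeasure_PiM_eq_padded[OF inj X(1)] X(2) unfolding pr_def Q_def
    by (intro fmeasurableI) (auto simp: emeasure_completion)
  have meas: "measure lebesgue (pr -` A \<inter> Q) = measure ?P A" if "A \<in> sets ?P" for A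
    using emeasure_PiM_eq_padded[OF inj that] unfolding pr_def Q_def measure_def
    by (simp add: emeasure_completion)
  have "measure ?P ?Y = measure lebesgue ?R"
    using meas[OF Y] eq by simp
  also have "\<dots> = \<bar>det (mtx U')\<bar> * measure lebesgue ((\<lambda>x. x - d) ` (pr -` X \<inter> Q))"
    using S by (subst measure_linear_image) (auto simp: measurable_translation_subtract)
  also have "\<dots> = measure lebesgue (pr -` X \<inter> Q)"
    using abs_det_integer_matrix[OF U'U] mtx_int U U' by (simp add: measure_translation_subtract)
  also have "\<dots> = measure ?P X"
    using meas[OF X(1)] by simp
  finally show ?thesis by (simp add: aff_def)
qed


section \<open>Unimodular fans\<close>

text \<open>Automorphisms of the lattice of the whole space, not of a subspace: the image of a
  coordinate subspace then inherits a lattice basis from the axes.\<close>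

definition unimodular :: "(real ^ 'e \<Rightarrow> real ^ 'e) \<Rightarrow> bool" where
  "unimodular M \<longleftrightarrow> linear M \<and> bij M \<and> M ` integer_lattice = integer_lattice"

definition coord_space :: "'e set \<Rightarrow> (real ^ 'e) set" where
  "coord_space J = {x. \<forall>e. e \<notin> J \<longrightarrow> x $ e = 0}"

definition coord_cone :: "'e set \<Rightarrow> (real ^ 'e) set" where
  "coord_cone J = {x \<in> coord_space J. \<forall>e. 0 \<le> x $ e}"

definition open_coord_cone :: "'e set \<Rightarrow> (real ^ 'e) set" where
  "open_coord_cone J = {x \<in> coord_space J. \<forall>e\<in>J. 0 < x $ e}"

text \<open>The closed cones lie in \<open>R\<close> and cover it. The open cones lie in \<open>R'\<close>; this keeps them pairwise
  disjoint when fans of different regions are united.\<close>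

definition unimodular_fan where
  "unimodular_fan W N R R' K M J \<longleftrightarrow> finite K \<and>
     (\<forall>\<kappa>\<in>K. unimodular (M \<kappa>) \<and> M \<kappa> ` coord_space (J \<kappa>) = W \<and>
        (\<forall>x\<in>coord_cone (J \<kappa>). M \<kappa> x \<in> R \<and> N (M \<kappa> x) = (\<Sum>e\<in>UNIV. x $ e)) \<and>
        (\<forall>x\<in>open_coord_cone (J \<kappa>). M \<kappa> x \<in> R')) \<and>
     R \<subseteq> (\<Union>\<kappa>\<in>K. M \<kappa> ` coord_cone (J \<kappa>)) \<and>
     (\<forall>\<kappa>\<in>K. \<forall>\<kappa>'\<in>K. \<kappa> \<noteq> \<kappa>' \<longrightarrow>
        M \<kappa> ` open_coord_cone (J \<kappa>) \<inter> M \<kappa>' ` open_coord_cone (J \<kappa>') = {})"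

text \<open>Of the cells only the index set is kept, since the volume will be their number.\<close>

definition has_unimodular_fan :: "(real ^ 'e::finite) set \<Rightarrow> (real ^ 'e \<Rightarrow> real) \<Rightarrow>
    (real ^ 'e) set \<Rightarrow> (real ^ 'e) set \<Rightarrow> 'k set \<Rightarrow> bool" where
  "has_unimodular_fan W N R R' K \<longleftrightarrow> (\<exists>M J. unimodular_fan W N R R' K M J)"

lemma open_coord_cone_subset: "open_coord_cone J \<subseteq> coord_cone J"
proof
  fix x assume x: "x \<in> open_coord_cone J"
  have "0 \<le> x $ e" for e
    using x by (cases "e \<in> J") (auto simp: open_coord_cone_def coord_space_def less_imp_le)
  then show "x \<in> coord_cone J"
    using x by (simp add: coord_cone_def open_coord_cone_def)
qed

lemma unimodular_comp:
  assumes "unimodular L" "unimodular M"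
  shows "unimodular (L \<circ> M)"
  using assms unfolding unimodular_def
  by (metis bij_comp image_comp linear_compose)

lemma unimodularI:
  assumes "linear L" "\<And>f. L (L' f) = f" "\<And>f. L' (L f) = f"
    "\<And>f e. f \<in> integer_lattice \<Longrightarrow> L f $ e \<in> \<int>" "\<And>f e. f \<in> integer_lattice \<Longrightarrow> L' f $ e \<in> \<int>"
  shows "unimodular L"
proof -
  have "bij L"
    using assms(2,3) by (intro o_bij[of L']) auto
  moreover have "L ` integer_lattice = integer_lattice"
  proof (intro equalityI subsetI)
    show "f \<in> integer_lattice" if "f \<in> L ` integer_lattice" for f
      using that assms(4) by (auto simp: integer_lattice_def)
    fix f :: "real ^ 'a" assume "f \<in> integer_lattice"
    then have "L' f \<in> integer_lattice"
      using assms(5) by (auto simp: integer_lattice_def)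
    then show "f \<in> L ` integer_lattice"
      using assms(2) by (metis imageI)
  qed
  ultimately show ?thesis
    using assms(1) by (simp add: unimodular_def)
qed

text \<open>For \<open>R'\<close> one implication suffices, and only on \<open>R\<close>:
  \<open>R'\<close> merely has to contain the open cones, which lie in \<open>R\<close> as
  well.\<close>

lemma has_unimodular_fan_image:
  assumes fan: "has_unimodular_fan W N R R' K" and L: "unimodular L"
    and W: "\<And>f. L f \<in> W2 \<longleftrightarrow> f \<in> W" and R: "\<And>f. L f \<in> R2 \<longleftrightarrow> f \<in> R"
    and N: "\<And>f. f \<in> R \<Longrightarrow> N2 (L f) = N f" and R': "\<And>f. f \<in> R \<Longrightarrow> f \<in> R' \<Longrightarrow> L f \<in> R2'"
  shows "has_unimodular_fan W2 N2 R2 R2' K"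
proof -
  obtain M J where MJ: "unimodular_fan W N R R' K M J"
    using fan by (auto simp: has_unimodular_fan_def)
  have "bij L" using L by (simp add: unimodular_def)
  then have im: "L ` W = W2" "L ` R = R2"
    using W R by (auto intro: surjD[OF bij_is_surj]) (metis bij_pointE imageI)+
  have "unimodular_fan W2 N2 R2 R2' K (\<lambda>\<kappa>. L \<circ> M \<kappa>) J"
    unfolding unimodular_fan_def
  proof (intro conjI ballI impI)
    show "finite K"
      using MJ by (simp add: unimodular_fan_def)
    fix \<kappa> assume \<kappa>: "\<kappa> \<in> K"
    show "unimodular (L \<circ> M \<kappa>)" "(L \<circ> M \<kappa>) ` coord_space (J \<kappa>) = W2"
      using MJ \<kappa> L im by (auto simp: unimodular_fan_def unimodular_comp image_comp[symmetric])
    fix x assume x: "x \<in> coord_cone (J \<kappa>)"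
    then have "M \<kappa> x \<in> R" "N (M \<kappa> x) = (\<Sum>e\<in>UNIV. x $ e)"
      using MJ \<kappa> by (auto simp: unimodular_fan_def)
    then show "(L \<circ> M \<kappa>) x \<in> R2" "N2 ((L \<circ> M \<kappa>) x) = (\<Sum>e\<in>UNIV. x $ e)"
      using N R by auto
  next
    fix \<kappa> x assume \<kappa>: "\<kappa> \<in> K" and x: "x \<in> open_coord_cone (J \<kappa>)"
    then have "M \<kappa> x \<in> R" "M \<kappa> x \<in> R'"
      using MJ open_coord_cone_subset by (auto simp: unimodular_fan_def)
    then show "(L \<circ> M \<kappa>) x \<in> R2'"
      using R' by simp
  next
    have "R \<subseteq> (\<Union>\<kappa>\<in>K. M \<kappa> ` coord_cone (J \<kappa>))"
      using MJ by (simp add: unimodular_fan_def)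
    then show "R2 \<subseteq> (\<Union>\<kappa>\<in>K. (L \<circ> M \<kappa>) ` coord_cone (J \<kappa>))"
      unfolding im(2)[symmetric] by (auto simp: image_iff) blast
  next
    fix \<kappa> \<kappa>' assume "\<kappa> \<in> K" "\<kappa>' \<in> K" "\<kappa> \<noteq> \<kappa>'"
    then have "M \<kappa> ` open_coord_cone (J \<kappa>) \<inter> M \<kappa>' ` open_coord_cone (J \<kappa>') = {}"
      using MJ by (simp add: unimodular_fan_def)
    then show "(L \<circ> M \<kappa>) ` open_coord_cone (J \<kappa>) \<inter> (L \<circ> M \<kappa>') ` open_coord_cone (J \<kappa>') = {}"
      using bij_is_inj[OF \<open>bij L\<close>] by (metis image_Int image_comp image_empty)
  qed
  then show ?thesis
    by (auto simp: has_unimodular_fan_def)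
qed

lemma has_unimodular_fan_mono:
  assumes fan: "has_unimodular_fan W N R R' K" and "R' \<subseteq> R''"
  shows "has_unimodular_fan W N R R'' K"
proof -
  obtain M J where MJ: "unimodular_fan W N R R' K M J"
    using fan by (auto simp: has_unimodular_fan_def)
  then have "unimodular_fan W N R R'' K M J"
    using \<open>R' \<subseteq> R''\<close> by (auto simp: unimodular_fan_def)
  then show ?thesis
    by (auto simp: has_unimodular_fan_def)
qed

lemma has_unimodular_fan_reindex:
  assumes fan: "has_unimodular_fan W N R R' K" and \<phi>: "bij_betw \<phi> K2 K"
  shows "has_unimodular_fan W N R R' K2"
proof -
  obtain M J where MJ: "unimodular_fan W N R R' K M J"
    using fan by (auto simp: has_unimodular_fan_def)
  have K: "K = \<phi> ` K2" "inj_on \<phi> K2"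
    using \<phi> by (auto simp: bij_betw_def)
  have "finite K2"
    using MJ \<phi> bij_betw_finite by (auto simp: unimodular_fan_def)
  then have "unimodular_fan W N R R' K2 (M \<circ> \<phi>) (J \<circ> \<phi>)"
    using MJ K(2) unfolding unimodular_fan_def K(1) by (simp add: inj_on_eq_iff)
  then show ?thesis
    by (auto simp: has_unimodular_fan_def)
qed

text \<open>Open cones of one piece are disjoint by assumption, those of different pieces because
  the sets \<open>R' i\<close> are. The closed pieces may overlap.\<close>

lemma has_unimodular_fan_UNION:
  assumes "finite I" and fan: "\<And>i. i \<in> I \<Longrightarrow> has_unimodular_fan W N (R i) (R' i) (K i)"
    and K: "\<And>i j. i \<in> I \<Longrightarrow> j \<in> I \<Longrightarrow> i \<noteq> j \<Longrightarrow> K i \<inter> K j = {}"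
    and R': "\<And>i j. i \<in> I \<Longrightarrow> j \<in> I \<Longrightarrow> i \<noteq> j \<Longrightarrow> R' i \<inter> R' j = {}"
  shows "has_unimodular_fan W N (\<Union>i\<in>I. R i) (\<Union>i\<in>I. R' i) (\<Union>i\<in>I. K i)"
proof -
  obtain M J where MJ: "\<And>i. i \<in> I \<Longrightarrow> unimodular_fan W N (R i) (R' i) (K i) (M i) (J i)"
    using fan unfolding has_unimodular_fan_def by metis
  define ix where "ix \<kappa> = (THE i. i \<in> I \<and> \<kappa> \<in> K i)" for \<kappa>
  have ix [simp]: "ix \<kappa> = i" if "i \<in> I" "\<kappa> \<in> K i" for i \<kappa>
    unfolding ix_def using that K by blast
  have "unimodular_fan W N (\<Union>i\<in>I. R i) (\<Union>i\<in>I. R' i) (\<Union>i\<in>I. K i) (\<lambda>\<kappa>. M (ix \<kappa>) \<kappa>) (\<lambda>\<kappa>. J (ix \<kappa>) \<kappa>)"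
    unfolding unimodular_fan_def
  proof (intro conjI ballI impI)
    show "finite (\<Union>i\<in>I. K i)"
      using MJ \<open>finite I\<close> by (auto simp: unimodular_fan_def)
    fix \<kappa> assume "\<kappa> \<in> (\<Union>i\<in>I. K i)"
    then obtain i where i: "i \<in> I" "\<kappa> \<in> K i" by auto
    note MJ' = MJ[OF i(1), unfolded unimodular_fan_def]
    show "unimodular (M (ix \<kappa>) \<kappa>)" "M (ix \<kappa>) \<kappa> ` coord_space (J (ix \<kappa>) \<kappa>) = W"
      using MJ' i by auto
    show "M (ix \<kappa>) \<kappa> x \<in> (\<Union>i\<in>I. R i)" "N (M (ix \<kappa>) \<kappa> x) = (\<Sum>e\<in>UNIV. x $ e)"
      if "x \<in> coord_cone (J (ix \<kappa>) \<kappa>)" for x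
      using MJ' i that by auto
    show "M (ix \<kappa>) \<kappa> x \<in> (\<Union>i\<in>I. R' i)"
      if "x \<in> open_coord_cone (J (ix \<kappa>) \<kappa>)" for x
      using MJ' i that by auto
    fix \<kappa>' assume "\<kappa>' \<in> (\<Union>i\<in>I. K i)" and neq: "\<kappa> \<noteq> \<kappa>'"
    then obtain j where j: "j \<in> I" "\<kappa>' \<in> K j" by auto
    show "M (ix \<kappa>) \<kappa> ` open_coord_cone (J (ix \<kappa>) \<kappa>) \<inter> M (ix \<kappa>') \<kappa>' ` open_coord_cone (J (ix \<kappa>') \<kappa>') = {}"
    proof (cases "i = j")
      case True
      then show ?thesis
        using MJ' i j neq by auto
    next
      case False
      have "M (ix \<kappa>) \<kappa> ` open_coord_cone (J (ix \<kappa>) \<kappa>) \<subseteq> R' i"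
        "M (ix \<kappa>') \<kappa>' ` open_coord_cone (J (ix \<kappa>') \<kappa>') \<subseteq> R' j"
        using MJ' MJ[OF j(1), unfolded unimodular_fan_def] i j by auto
      then show ?thesis
        using R'[OF i(1) j(1) False] by blast
    qed
  next
    have "R i \<subseteq> (\<Union>\<kappa>\<in>K i. M (ix \<kappa>) \<kappa> ` coord_cone (J (ix \<kappa>) \<kappa>))" if "i \<in> I" for i
      using MJ[OF that] that by (simp add: unimodular_fan_def)
    then show "(\<Union>i\<in>I. R i) \<subseteq> (\<Union>\<kappa>\<in>(\<Union>i\<in>I. K i). M (ix \<kappa>) \<kappa> ` coord_cone (J (ix \<kappa>) \<kappa>))"
      using UN_mono[of "K _" "\<Union>i\<in>I. K i" "\<lambda>\<kappa>. M (ix \<kappa>) \<kappa> ` coord_cone (J (ix \<kappa>) \<kappa>)", OF UN_upper order_refl]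
      by (meson UN_least order_trans)
  qed
  then show ?thesis
    by (auto simp: has_unimodular_fan_def)
qed

lemma has_unimodular_fan_Un:
  assumes "has_unimodular_fan W N R1 R1' K1" "has_unimodular_fan W N R2 R2' K2"
    "K1 \<inter> K2 = {}" "R1' \<inter> R2' = {}"
  shows "has_unimodular_fan W N (R1 \<union> R2) (R1' \<union> R2') (K1 \<union> K2)"
proof -
  have "has_unimodular_fan W N (\<Union>i. if i then R1 else R2) (\<Union>i. if i then R1' else R2')
      (\<Union>i. if i then K1 else K2)"
    by (rule has_unimodular_fan_UNION[where I = UNIV and R = "\<lambda>i. if i then R1 else R2" and
          R' = "\<lambda>i. if i then R1' else R2'" and K = "\<lambda>i. if i then K1 else K2"])
      (use assms in \<open>auto split: if_splits\<close>)
  then show ?thesis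
    by (simp add: UNIV_bool Un_commute)
qed

text \<open>An elementary matrix. In each reduction it carries the flows of the simpler graph back
  to the original graph.\<close>

definition shear :: "'e \<Rightarrow> 'e \<Rightarrow> real ^ 'e \<Rightarrow> real ^ 'e" where
  "shear a b f = (\<chi> e. if e = a then f $ a + f $ b else f $ e)"

lemma shear_nth [simp]: "shear a b f $ e = (if e = a then f $ a + f $ b else f $ e)"
  by (simp add: shear_def)

lemma unimodular_shear:
  assumes "a \<noteq> b"
  shows "unimodular (shear a b :: real ^ 'e::finite \<Rightarrow> _)"
proof (rule unimodularI)
  show "linear (shear a b :: real ^ 'e \<Rightarrow> _)"
    by (rule linearI) (auto simp: vec_eq_iff algebra_simps)
  let ?L = "\<lambda>f :: real ^ 'e. \<chi> e. if e = a then f $ a - f $ b else f $ e"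
  show "shear a b (?L f) = f" "?L (shear a b f) = f" for f
    using assms by (auto simp: vec_eq_iff)
qed (auto simp: integer_lattice_def)

lemma sum_shear:
  "finite A \<Longrightarrow> (\<Sum>e\<in>A. shear a b f $ e) = (\<Sum>e\<in>A. f $ e) + (if a \<in> A then f $ b else 0)"
  by (cases "a \<in> A") (auto simp add: sum.remove[of A a] intro!: sum.cong)


section \<open>Flows on acyclic graphs\<close>

text \<open>\<open>t e\<close> and \<open>h e\<close> are the tail and the head of the edge \<open>e\<close>; \<open>None\<close> stands for a source or a
  sink. Edges outside \<open>E\<close> have been deleted.\<close>

definition dag :: "'e set \<Rightarrow> 'v set \<Rightarrow> ('e \<Rightarrow> 'v option) \<Rightarrow> ('e \<Rightarrow> 'v option) \<Rightarrow> bool" where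
  "dag E V t h \<longleftrightarrow> finite V \<and>
     (\<forall>e v. t e = Some v \<or> h e = Some v \<longrightarrow> v \<in> V \<and> e \<in> E) \<and>
     (\<forall>v\<in>V. (\<exists>e. t e = Some v) \<and> (\<exists>e. h e = Some v)) \<and>
     (\<exists>r :: 'v \<Rightarrow> nat. \<forall>e u w. t e = Some u \<and> h e = Some w \<longrightarrow> r u < r w)"

definition dag_space :: "'e set \<Rightarrow> 'v set \<Rightarrow> ('e \<Rightarrow> 'v option) \<Rightarrow> ('e \<Rightarrow> 'v option) \<Rightarrow> (real ^ 'e::finite) set" where
  "dag_space E V t h = {f. (\<forall>e. e \<notin> E \<longrightarrow> f $ e = 0) \<and>
     (\<forall>v\<in>V. (\<Sum>e | t e = Some v. f $ e) = (\<Sum>e | h e = Some v. f $ e))}"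

definition dag_cone :: "'e set \<Rightarrow> 'v set \<Rightarrow> ('e \<Rightarrow> 'v option) \<Rightarrow> ('e \<Rightarrow> 'v option) \<Rightarrow> (real ^ 'e::finite) set" where
  "dag_cone E V t h = {f \<in> dag_space E V t h. \<forall>e. 0 \<le> f $ e}"

definition source_value :: "('e \<Rightarrow> 'v option) \<Rightarrow> real ^ 'e::finite \<Rightarrow> real" where
  "source_value t f = (\<Sum>e | t e = None. f $ e)"

text \<open>The condition that the netflow is the indegree minus one, in additive form to avoid
  subtracting natural numbers.\<close>

definition dag_flows :: "'v set \<Rightarrow> ('e::finite \<Rightarrow> 'v option) \<Rightarrow> ('e \<Rightarrow> 'v option) \<Rightarrow> ('e \<Rightarrow> nat) set" where
  "dag_flows V t h = {g. (\<forall>e. t e = None \<longrightarrow> g e = 0) \<and>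
     (\<forall>v\<in>V. (\<Sum>e | t e = Some v. g e) + 1 = (\<Sum>e | h e = Some v. g e) + card {e. h e = Some v})}"

abbreviation dag_has_fan :: "'e::finite set \<Rightarrow> 'v set \<Rightarrow> ('e \<Rightarrow> 'v option) \<Rightarrow> ('e \<Rightarrow> 'v option) \<Rightarrow> bool" where
  "dag_has_fan E V t h \<equiv> has_unimodular_fan (dag_space E V t h) (source_value t) (dag_cone E V t h)
     {f. \<forall>e\<in>E. 0 < f $ e} (dag_flows V t h)"

text \<open>A vertex of least rank has this property.\<close>

lemma exists_dag_root:
  assumes "dag E V t h" "V \<noteq> {}"
  obtains v where "v \<in> V" "\<And>e. h e = Some v \<Longrightarrow> t e = None"
proof -
  obtain r :: "'b \<Rightarrow> nat" where r: "\<And>e u w. t e = Some u \<Longrightarrow> h e = Some w \<Longrightarrow> r u < r w"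
    using assms(1) unfolding dag_def by blast
  obtain v where v: "v \<in> V" "\<And>u. u \<in> V \<Longrightarrow> r v \<le> r u"
    using assms(2) ex_has_least_nat[of "\<lambda>u. u \<in> V" _ r] by blast
  have "t e = None" if "h e = Some v" for e
  proof (rule ccontr)
    assume "t e \<noteq> None"
    then obtain u where u: "t e = Some u" by blast
    then have "u \<in> V" "r u < r v"
      using assms(1) r that by (auto simp: dag_def)
    then show False
      using v(2) by fastforce
  qed
  then show ?thesis
    using that v(1) by blast
qed

text \<open>The data of one reduction step. As \<open>a\<close> starts at a source, moving its head
  beyond \<open>v\<close> cannot close a cycle.\<close>

locale dag_reduction =
  fixes E :: "'e::finite set" and V :: "'v set" and t h v a b
  assumes dag: "dag E V t h" and v: "v \<in> V" and root: "\<And>e. h e = Some v \<Longrightarrow> t e = None"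
    and a: "h a = Some v" and b: "t b = Some v"
begin

text \<open>\<open>b\<close> starts at \<open>v\<close>, while every edge into the root
  \<open>v\<close> starts at a source; hence \<open>b\<close> does not enter \<open>v\<close> and is
  not \<open>a\<close>.\<close>

lemma ab [simp]: "a \<noteq> b" "b \<noteq> a" "t a = None" "h b \<noteq> Some v" "a \<in> E" "b \<in> E"
  using dag a b root[of a] root[of b] by (auto simp: dag_def)

lemma out_eq: "{e. t e = Some v} = insert b {e. (t(b := None)) e = Some v}"
  using b by auto

lemma out_eq': "u \<noteq> v \<Longrightarrow> {e. (t(b := None)) e = Some u} = {e. t e = Some u}"
  using b by auto

lemma in_eq: "h b = Some u \<Longrightarrow> {e. (h(a := h b)) e = Some u} = insert a {e. h e = Some u}"
  using a ab(4) by auto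

lemma in_eq': "h b \<noteq> Some u \<Longrightarrow> u \<noteq> v \<Longrightarrow> {e. (h(a := h b)) e = Some u} = {e. h e = Some u}"
  using a by auto

lemma in_eq_v: "{e. h e = Some v} = insert a {e. (h(a := h b)) e = Some v}"
  using a ab(4) by auto

lemma in_eq_v': "a \<notin> {e. (h(a := h b)) e = Some v}"
  using ab(4) by auto

text \<open>The shear raises the inflow of \<open>v\<close> by \<open>f $ b\<close> through
  \<open>a\<close>. This balances \<open>b\<close>, which counts as outflow of \<open>v\<close> only
  in the original graph.\<close>

lemma shear_tail_space:
  "shear a b f \<in> dag_space E V t h \<longleftrightarrow> f \<in> dag_space E V (t(b := None)) h"
proof -
  have "(\<Sum>e | t e = Some u. shear a b f $ e) = (\<Sum>e | h e = Some u. shear a b f $ e) \<longleftrightarrow>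
    (\<Sum>e | (t(b := None)) e = Some u. f $ e) = (\<Sum>e | h e = Some u. f $ e)" for u
  proof (cases "u = v")
    case True
    have "(\<Sum>e | t e = Some v. shear a b f $ e) = f $ b + (\<Sum>e | (t(b := None)) e = Some v. f $ e)"
      by (simp only: sum_shear[OF finite]) (simp add: out_eq)
    then show ?thesis
      using True a by (simp only: sum_shear[OF finite]) simp
  next
    case False
    then show ?thesis
      using a by (simp only: sum_shear[OF finite] out_eq'[OF False]) simp
  qed
  moreover have "(\<forall>e. e \<notin> E \<longrightarrow> shear a b f $ e = 0) \<longleftrightarrow> (\<forall>e. e \<notin> E \<longrightarrow> f $ e = 0)"
    using ab by (metis shear_nth)
  ultimately show ?thesis
    unfolding dag_space_def by blast
qed

text \<open>The shear sends the flow of \<open>a\<close> through \<open>v\<close> and on along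
  \<open>b\<close>; in the reduced graph \<open>a\<close> bypasses \<open>v\<close> and ends at the
  head of \<open>b\<close> directly.\<close>

lemma shear_head_space:
  "shear b a f \<in> dag_space E V t h \<longleftrightarrow> f \<in> dag_space E V t (h(a := h b))"
proof -
  have "(\<Sum>e | t e = Some u. shear b a f $ e) = (\<Sum>e | h e = Some u. shear b a f $ e) \<longleftrightarrow>
    (\<Sum>e | t e = Some u. f $ e) = (\<Sum>e | (h(a := h b)) e = Some u. f $ e)" for u
  proof -
    consider "u = v" | "h b = Some u" | "u \<noteq> v" "h b \<noteq> Some u" by blast
    then show ?thesis
    proof cases
      case 1
      have "(\<Sum>e | h e = Some v. shear b a f $ e) = f $ a + (\<Sum>e | (h(a := h b)) e = Some v. f $ e)"
        by (simp only: sum_shear[OF finite] mem_Collect_eq ab(4) if_False add_0_right)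
          (subst in_eq_v, rule sum.insert[OF finite in_eq_v'])
      then show ?thesis
        using 1 b by (simp only: sum_shear[OF finite]) simp
    next
      case 2
      then have "(\<Sum>e | (h(a := h b)) e = Some u. f $ e) = f $ a + (\<Sum>e | h e = Some u. f $ e)"
        using a ab(4) by (subst in_eq) auto
      moreover have "u \<noteq> v" using 2 ab(4) by blast
      ultimately show ?thesis
        using 2 b by (simp only: sum_shear[OF finite]) (simp add: add.commute)
    next
      case 3
      then show ?thesis
        using b by (simp only: sum_shear[OF finite] in_eq'[OF 3(2) 3(1)]) simp
    qed
  qed
  moreover have "(\<forall>e. e \<notin> E \<longrightarrow> shear b a f $ e = 0) \<longleftrightarrow> (\<forall>e. e \<notin> E \<longrightarrow> f $ e = 0)"
    using ab by (metis shear_nth)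
  ultimately show ?thesis
    unfolding dag_space_def by blast
qed

text \<open>What the shear adds to the source edge \<open>a\<close> is what \<open>b\<close> carries
  as a new source edge.\<close>

lemma source_value_tail: "source_value t (shear a b f) = source_value (t(b := None)) f"
proof -
  have "{e. (t(b := None)) e = None} = insert b {e. t e = None}" by auto
  moreover have "b \<notin> {e. t e = None}" using b by simp
  ultimately show ?thesis
    unfolding source_value_def by (simp only: sum_shear[OF finite]) simp
qed

lemma source_value_head: "source_value t (shear b a f) = source_value t f"
  unfolding source_value_def using b by (simp only: sum_shear[OF finite]) simp

text \<open>Edges into a root start at sources and hence carry 0.\<close>

lemma flow_root:
  assumes "g \<in> dag_flows V t h"
  shows "(\<Sum>e | t e = Some v. g e) + 1 = card {e. h e = Some v}"
proof -
  have "(\<Sum>e | h e = Some v. g e) = 0"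
    using assms root by (simp add: dag_flows_def)
  then show ?thesis
    using assms v by (auto simp: dag_flows_def)
qed

text \<open>Making \<open>b\<close> a source edge forces \<open>g b = 0\<close>, and dropping a zero
  summand changes no outflow.\<close>

lemma dag_flows_tail: "dag_flows V (t(b := None)) h = {g \<in> dag_flows V t h. g b = 0}"
proof -
  have "(\<Sum>e | t e = Some u. g e) = (\<Sum>e | (t(b := None)) e = Some u. g e)" if "g b = 0"
    for g :: "'e \<Rightarrow> nat" and u
    using that by (intro sum.mono_neutral_right) auto
  moreover have "(\<forall>e. (t(b := None)) e = None \<longrightarrow> g e = 0) \<longleftrightarrow> (\<forall>e. t e = None \<longrightarrow> g e = 0) \<and> g b = 0"
    for g :: "'e \<Rightarrow> nat"
    by auto
  ultimately show ?thesis
    unfolding dag_flows_def by (auto simp del: fun_upd_apply)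
qed

text \<open>Moving the head of \<open>a\<close> lowers the indegree of \<open>v\<close> by one and
  raises that of the head of \<open>b\<close>, if it is a vertex. Lowering \<open>g b\<close> by one
  compensates at both ends; \<open>a\<close> itself carries 0.\<close>

lemma dag_flows_head:
  "bij_betw (\<lambda>g. g(b := g b - 1)) {g \<in> dag_flows V t h. g b \<noteq> 0} (dag_flows V t (h(a := h b)))"
proof -
  have eqs: "g(b := Suc (g b)) \<in> dag_flows V t h \<longleftrightarrow> g \<in> dag_flows V t (h(a := h b))" for g
  proof -
    let ?g = "g(b := Suc (g b))"
    have sum_g: "(\<Sum>e\<in>A. ?g e) = (\<Sum>e\<in>A. g e) + (if b \<in> A then 1 else 0)" for A
      by (cases "b \<in> A") (auto simp: sum.remove[of A b] intro!: sum.cong)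
    have "(\<Sum>e | t e = Some u. ?g e) + 1 = (\<Sum>e | h e = Some u. ?g e) + card {e. h e = Some u} \<longleftrightarrow>
      (\<Sum>e | t e = Some u. g e) + 1 = (\<Sum>e | (h(a := h b)) e = Some u. g e) + card {e. (h(a := h b)) e = Some u}"
      if "g a = 0" for u
    proof -
      consider "u = v" | "h b = Some u" | "u \<noteq> v" "h b \<noteq> Some u" by blast
      then show ?thesis
      proof cases
        case 1
        have "sum g {e. h e = Some v} = g a + (\<Sum>e | (h(a := h b)) e = Some v. g e)"
          by (subst in_eq_v, rule sum.insert[OF finite in_eq_v'])
        moreover have "card {e. h e = Some v} = Suc (card {e. (h(a := h b)) e = Some v})"
          by (subst in_eq_v, rule card_insert_disjoint[OF finite in_eq_v'])
        ultimately show ?thesis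
          using 1 b that ab(4) unfolding sum_g by (simp del: fun_upd_apply)
      next
        case 2
        then have "u \<noteq> v" using ab(4) by blast
        then have "a \<notin> {e. h e = Some u}" using a by auto
        then show ?thesis
          using b that 2 \<open>u \<noteq> v\<close> unfolding sum_g in_eq[OF 2] by simp
      next
        case 3
        then show ?thesis
          using b unfolding sum_g in_eq'[OF 3(2) 3(1)] by simp
      qed
    qed
    moreover have "(\<forall>e. t e = None \<longrightarrow> ?g e = 0) \<longleftrightarrow> (\<forall>e. t e = None \<longrightarrow> g e = 0)"
      using b by (metis fun_upd_other option.distinct(1))
    ultimately show ?thesis
      unfolding dag_flows_def mem_Collect_eq using ab(3) by blast
  qed
  show ?thesis
  proof (rule bij_betw_byWitness[where f' = "\<lambda>g. g(b := Suc (g b))"])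
    show "(\<lambda>g. g(b := g b - 1)) ` {g \<in> dag_flows V t h. g b \<noteq> 0} \<subseteq> dag_flows V t (h(a := h b))"
      by (auto simp: eqs[symmetric])
    show "(\<lambda>g. g(b := Suc (g b))) ` dag_flows V t (h(a := h b)) \<subseteq> {g \<in> dag_flows V t h. g b \<noteq> 0}"
      using eqs by auto
  qed auto
qed

lemma root_balance: "f \<in> dag_space E V t h \<Longrightarrow> (\<Sum>e | t e = Some v. f $ e) = (\<Sum>e | h e = Some v. f $ e)"
  using v by (auto simp: dag_space_def)

text \<open>\<open>b'\<close> leaves \<open>v\<close> with an outgoing edge, as \<open>dag\<close>
  demands.\<close>

lemma dag_tail:
  assumes "t b' = Some v" "b' \<noteq> b"
  shows "dag E V (t(b := None)) h"
  unfolding dag_def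
proof (intro conjI)
  show "\<forall>u\<in>V. (\<exists>e. (t(b := None)) e = Some u) \<and> (\<exists>e. h e = Some u)"
    using dag assms b unfolding dag_def by (metis fun_upd_apply option.inject)
  show "\<exists>r :: 'v \<Rightarrow> nat. \<forall>e u w. (t(b := None)) e = Some u \<and> h e = Some w \<longrightarrow> r u < r w"
    using dag unfolding dag_def by (metis fun_upd_apply option.distinct(1))
qed (use dag in \<open>auto simp: dag_def\<close>)

lemma dag_head:
  assumes "h a' = Some v" "a' \<noteq> a"
  shows "dag E V t (h(a := h b))"
  unfolding dag_def
proof (intro conjI)
  show "\<forall>u\<in>V. (\<exists>e. t e = Some u) \<and> (\<exists>e. (h(a := h b)) e = Some u)"
    using dag assms a unfolding dag_def by (metis fun_upd_apply option.inject)
  show "\<exists>r :: 'v \<Rightarrow> nat. \<forall>e u w. t e = Some u \<and> (h(a := h b)) e = Some w \<longrightarrow> r u < r w"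
    using dag ab(3) unfolding dag_def by (metis fun_upd_apply option.distinct(1))
qed (use dag in \<open>auto simp: dag_def\<close>)

text \<open>After the shear, \<open>f $ b \<le> f $ a\<close> says that coordinate \<open>a\<close>
  was nonnegative before. Positive coordinates make the inequality strict.\<close>

lemma fan_tail:
  assumes "dag_has_fan E V (t(b := None)) h"
  shows "has_unimodular_fan (dag_space E V t h) (source_value t)
      {f \<in> dag_cone E V t h. f $ b \<le> f $ a} {f. (\<forall>e\<in>E. 0 < f $ e) \<and> f $ b < f $ a}
      {g \<in> dag_flows V t h. g b = 0}"
proof -
  have "shear a b f \<in> {f \<in> dag_cone E V t h. f $ b \<le> f $ a} \<longleftrightarrow> f \<in> dag_cone E V (t(b := None)) h" for f
  proof -
    have "(\<forall>e. 0 \<le> shear a b f $ e) \<and> shear a b f $ b \<le> shear a b f $ a \<longleftrightarrow> (\<forall>e. 0 \<le> f $ e)"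
      by (auto split: if_splits)
    then show ?thesis
      unfolding dag_cone_def using shear_tail_space by blast
  qed
  moreover have "shear a b f \<in> {f. (\<forall>e\<in>E. 0 < f $ e) \<and> f $ b < f $ a}"
    if "f \<in> {f. \<forall>e\<in>E. 0 < f $ e}" for f
    using that by (auto simp: add_pos_pos)
  ultimately show ?thesis
    unfolding dag_flows_tail[symmetric]
    by (intro has_unimodular_fan_image[OF assms unimodular_shear[OF ab(1)]] shear_tail_space source_value_tail)
qed

text \<open>The opposite half of the cone, with the roles of \<open>a\<close> and \<open>b\<close>
  in the shear exchanged; its cells are relabelled by lowering \<open>g b\<close>.\<close>

lemma fan_head:
  assumes "dag_has_fan E V t (h(a := h b))"
  shows "has_unimodular_fan (dag_space E V t h) (source_value t)
      {f \<in> dag_cone E V t h. f $ a \<le> f $ b} {f. (\<forall>e\<in>E. 0 < f $ e) \<and> f $ a < f $ b}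
      {g \<in> dag_flows V t h. g b \<noteq> 0}"
proof -
  have "shear b a f \<in> {f \<in> dag_cone E V t h. f $ a \<le> f $ b} \<longleftrightarrow> f \<in> dag_cone E V t (h(a := h b))" for f
  proof -
    have "(\<forall>e. 0 \<le> shear b a f $ e) \<and> shear b a f $ a \<le> shear b a f $ b \<longleftrightarrow> (\<forall>e. 0 \<le> f $ e)"
      by (auto split: if_splits)
    then show ?thesis
      unfolding dag_cone_def using shear_head_space by blast
  qed
  moreover have "shear b a f \<in> {f. (\<forall>e\<in>E. 0 < f $ e) \<and> f $ a < f $ b}"
    if "f \<in> {f. \<forall>e\<in>E. 0 < f $ e}" for f
    using that by (auto simp: add_pos_pos)
  ultimately show ?thesis
    by (intro has_unimodular_fan_reindex[OF _ dag_flows_head] shear_head_space source_value_head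
        has_unimodular_fan_image[OF assms unimodular_shear[OF ab(2)]])
qed

text \<open>With one edge in and one out, balance says \<open>f $ a = f $ b\<close>. So
  \<open>v\<close> and \<open>a\<close> are dropped and \<open>b\<close> starts at a source; a
  deleted edge has coordinate 0, from which the shear restores \<open>f $ a\<close>. Such deletions
  are why \<open>dag\<close> carries the edge set \<open>E\<close>.\<close>

lemma fan_contract:
  assumes p1: "\<And>e. h e = Some v \<longleftrightarrow> e = a" and q1: "\<And>e. t e = Some v \<longleftrightarrow> e = b"
    and fan: "\<And>(E :: 'e set) t h. dag E (V - {v}) t h \<Longrightarrow> dag_has_fan E (V - {v}) t h"
  shows "dag_has_fan E V t h"
proof -
  let ?E = "E - {a}" and ?V = "V - {v}" and ?t = "t(b := None)" and ?h = "h(a := None)"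
  have at_v: "{e. h e = Some v} = {a}" "{e. t e = Some v} = {b}"
    using p1 q1 by auto
  have h_other: "{e. ?h e = Some u} = {e. h e = Some u}" if "u \<noteq> v" for u
    using that a by auto
  have dag': "dag ?E ?V ?t ?h"
    unfolding dag_def
  proof (intro conjI)
    show "\<forall>u\<in>?V. (\<exists>e. ?t e = Some u) \<and> (\<exists>e. ?h e = Some u)"
    proof
      fix u assume u: "u \<in> ?V"
      then have "\<exists>e. t e = Some u" "\<exists>e. h e = Some u"
        using dag by (simp_all add: dag_def)
      then obtain e e' where "t e = Some u" "h e' = Some u"
        by auto
      moreover have "e \<noteq> b" "e' \<noteq> a"
        using calculation u a b by auto
      ultimately show "(\<exists>e. ?t e = Some u) \<and> (\<exists>e. ?h e = Some u)"
        by (metis fun_upd_other)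
    qed
    show "\<exists>r :: 'v \<Rightarrow> nat. \<forall>e u w. ?t e = Some u \<and> ?h e = Some w \<longrightarrow> r u < r w"
      using dag unfolding dag_def by (metis fun_upd_apply option.distinct(1))
    show "\<forall>e u. ?t e = Some u \<or> ?h e = Some u \<longrightarrow> u \<in> ?V \<and> e \<in> ?E"
    proof (intro allI impI)
      fix e u assume *: "?t e = Some u \<or> ?h e = Some u"
      then have "t e = Some u \<and> e \<noteq> b \<or> h e = Some u \<and> e \<noteq> a"
        by (auto split: if_splits)
      then have "u \<in> V \<and> e \<in> E \<and> u \<noteq> v \<and> e \<noteq> a"
        using dag p1 q1 ab(3) by (auto simp: dag_def)
      then show "u \<in> ?V \<and> e \<in> ?E" by simp
    qed
  qed (use dag in \<open>simp add: dag_def\<close>)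
  have space: "shear a b f \<in> dag_space E V t h \<longleftrightarrow> f \<in> dag_space ?E ?V ?t ?h" for f
  proof -
    have "f \<in> dag_space E V ?t h \<longleftrightarrow> f \<in> dag_space ?E ?V ?t ?h"
    proof -
      have "(\<forall>e. e \<notin> ?E \<longrightarrow> f $ e = 0) \<longleftrightarrow> (\<forall>e. e \<notin> E \<longrightarrow> f $ e = 0) \<and> f $ a = 0"
        by auto
      moreover have "(\<Sum>e | ?t e = Some v. f $ e) = (\<Sum>e | h e = Some v. f $ e) \<longleftrightarrow> f $ a = 0"
      proof -
        have "{e. ?t e = Some v} = {}" using q1 by auto
        then show ?thesis by (simp only: at_v) auto
      qed
      ultimately show ?thesis
        unfolding dag_space_def using v h_other
        by (auto simp del: fun_upd_apply)
    qed
    then show ?thesis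
      by (simp add: shear_tail_space)
  qed
  have cone: "shear a b f \<in> dag_cone E V t h \<longleftrightarrow> f \<in> dag_cone ?E ?V ?t ?h" for f
  proof -
    have "(\<forall>e. 0 \<le> shear a b f $ e) \<longleftrightarrow> (\<forall>e. 0 \<le> f $ e)"
      if "f \<in> dag_space ?E ?V ?t ?h"
    proof -
      have "f $ a = 0" using that by (simp add: dag_space_def)
      then have "0 \<le> f $ e" if "\<forall>e. 0 \<le> shear a b f $ e" for e
        using that[THEN spec, of e] by (cases "e = a") simp_all
      moreover have "0 \<le> shear a b f $ e" if "\<forall>e. 0 \<le> f $ e" for e
        using that by simp
      ultimately show ?thesis by blast
    qed
    then show ?thesis
      unfolding dag_cone_def using space by blast
  qed
  have flows: "dag_flows V t h = dag_flows ?V ?t ?h"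
  proof -
    \<comment> \<open>The root has indegree 1, so by \<open>flow_root\<close> its outflow
      \<open>g b\<close> is 0.\<close>
    have "dag_flows V t h = {g \<in> dag_flows V t h. g b = 0}"
      using flow_root by (auto simp: at_v)
    also have "\<dots> = dag_flows V ?t h"
      by (rule dag_flows_tail[symmetric])
    also have "\<dots> = dag_flows ?V ?t ?h"
    proof -
      have "(\<Sum>e | ?t e = Some v. g e) + 1 = (\<Sum>e | h e = Some v. g e) + card {e. h e = Some v}"
        if "\<forall>e. ?t e = None \<longrightarrow> g e = 0" for g :: "'e \<Rightarrow> nat"
      proof -
        have "{e. ?t e = Some v} = {}" using q1 by auto
        moreover have "g a = 0" using that by simp
        ultimately show ?thesis by (simp only: at_v) simp
      qed
      then show ?thesis
        unfolding dag_flows_def using v h_other by (auto simp del: fun_upd_apply)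
    qed
    finally show ?thesis .
  qed
  have source: "source_value t (shear a b f) = source_value ?t f" for f
    by (rule source_value_tail)
  \<comment> \<open>The coordinate at \<open>a\<close> is 0 before the shear and equals the positive
    \<open>f $ b\<close> after it.\<close>
  have pos: "shear a b f \<in> {f. \<forall>e\<in>E. 0 < f $ e}"
    if "f \<in> dag_cone ?E ?V ?t ?h" "f \<in> {f. \<forall>e\<in>?E. 0 < f $ e}" for f
    using that by (auto simp: dag_cone_def dag_space_def)
  show ?thesis
    unfolding flows
    by (intro has_unimodular_fan_image[OF fan[OF dag'] unimodular_shear[OF ab(1)]] space cone source pos)
qed

end

text \<open>Induction on the degree of \<open>v\<close>: each reduction takes one edge away from
  \<open>v\<close>, until one edge in and one edge out are left for
  \<open>fan_contract\<close>.\<close>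

lemma dag_fan_root:
  fixes E :: "'e::finite set" and V :: "'v set"
  assumes fan: "\<And>(E :: 'e set) t h. dag E (V - {v}) t h \<Longrightarrow> dag_has_fan E (V - {v}) t h"
    and "dag E V t h" "v \<in> V" "\<And>e. h e = Some v \<Longrightarrow> t e = None"
  shows "dag_has_fan E V t h"
  using assms(2-)
proof (induction "card {e. t e = Some v} + card {e. h e = Some v}" arbitrary: t h rule: less_induct)
  case less
  have "\<exists>e. t e = Some v" "\<exists>e. h e = Some v"
    using less.prems(1,2) by (simp_all add: dag_def)
  then obtain a b where ab: "h a = Some v" "t b = Some v"
    by auto
  interpret dag_reduction E V t h v a b
    using less.prems ab by unfold_locales auto
  have tail: "has_unimodular_fan (dag_space E V t h) (source_value t)
      {f \<in> dag_cone E V t h. f $ b \<le> f $ a} {f. (\<forall>e\<in>E. 0 < f $ e) \<and> f $ b < f $ a}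
      {g \<in> dag_flows V t h. g b = 0}" if b': "t b' = Some v" "b' \<noteq> b" for b'
  proof (rule fan_tail, rule less.hyps)
    have "{e. (t(b := None)) e = Some v} \<subset> {e. t e = Some v}"
      using b by auto
    then show "card {e. (t(b := None)) e = Some v} + card {e. h e = Some v} < card {e. t e = Some v} + card {e. h e = Some v}"
      by (simp add: psubset_card_mono)
  qed (use dag_tail[OF b'] v root in auto)
  have head: "has_unimodular_fan (dag_space E V t h) (source_value t)
      {f \<in> dag_cone E V t h. f $ a \<le> f $ b} {f. (\<forall>e\<in>E. 0 < f $ e) \<and> f $ a < f $ b}
      {g \<in> dag_flows V t h. g b \<noteq> 0}" if a': "h a' = Some v" "a' \<noteq> a" for a'
  proof (rule fan_head, rule less.hyps)
    have "{e. (h(a := h b)) e = Some v} \<subset> {e. h e = Some v}"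
      using a ab(4) by auto
    then show "card {e. t e = Some v} + card {e. (h(a := h b)) e = Some v} < card {e. t e = Some v} + card {e. h e = Some v}"
      by (simp add: psubset_card_mono)
    show "t e = None" if "(h(a := h b)) e = Some v" for e
      using that root ab(4) by (auto split: if_splits)
  qed (use dag_head[OF a'] v in auto)
  consider (both) a' b' where "t b' = Some v" "b' \<noteq> b" "h a' = Some v" "a' \<noteq> a"
    | (tail) b' where "t b' = Some v" "b' \<noteq> b" "\<And>e. h e = Some v \<Longrightarrow> e = a"
    | (head) a' where "h a' = Some v" "a' \<noteq> a" "\<And>e. t e = Some v \<Longrightarrow> e = b"
    | (contract) "\<And>e. h e = Some v \<Longrightarrow> e = a" "\<And>e. t e = Some v \<Longrightarrow> e = b"
    by blast
  then show ?case
  proof cases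
    \<comment> \<open>The two halves share the wall \<open>f $ a = f $ b\<close>; the strict
      inequalities keep their open parts apart.\<close>
    case both
    have "has_unimodular_fan (dag_space E V t h) (source_value t)
      ({f \<in> dag_cone E V t h. f $ b \<le> f $ a} \<union> {f \<in> dag_cone E V t h. f $ a \<le> f $ b})
      ({f. (\<forall>e\<in>E. 0 < f $ e) \<and> f $ b < f $ a} \<union> {f. (\<forall>e\<in>E. 0 < f $ e) \<and> f $ a < f $ b})
      ({g \<in> dag_flows V t h. g b = 0} \<union> {g \<in> dag_flows V t h. g b \<noteq> 0})"
      by (rule has_unimodular_fan_Un[OF tail[OF both(1,2)] head[OF both(3,4)]]) auto
    moreover have "{f \<in> dag_cone E V t h. f $ b \<le> f $ a} \<union> {f \<in> dag_cone E V t h. f $ a \<le> f $ b} = dag_cone E V t h"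
      "{g \<in> dag_flows V t h. g b = 0} \<union> {g \<in> dag_flows V t h. g b \<noteq> 0} = dag_flows V t h"
      by auto
    ultimately show ?thesis
      using has_unimodular_fan_mono[of "dag_space E V t h" "source_value t" "dag_cone E V t h"
        "{f. (\<forall>e\<in>E. 0 < f $ e) \<and> f $ b < f $ a} \<union> {f. (\<forall>e\<in>E. 0 < f $ e) \<and> f $ a < f $ b}"
        "dag_flows V t h" "{f. \<forall>e\<in>E. 0 < f $ e}"] by auto
  next
    case tail': tail
    \<comment> \<open>A single incoming edge carries the whole outflow of \<open>v\<close>, so the
      half treated by \<open>tail\<close> is the whole cone; likewise all integer flows have
      \<open>g b = 0\<close>.\<close>
    have eq: "{e. h e = Some v} = {a}" using a tail'(3) by blast
    have "f $ b \<le> f $ a" if "f \<in> dag_cone E V t h" for f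
    proof -
      have "f $ b \<le> (\<Sum>e | t e = Some v. f $ e)"
        using b that by (intro member_le_sum) (auto simp: dag_cone_def)
      also have "\<dots> = f $ a"
        using root_balance[of f] that unfolding eq by (simp add: dag_cone_def)
      finally show ?thesis .
    qed
    then have "{f \<in> dag_cone E V t h. f $ b \<le> f $ a} = dag_cone E V t h" by blast
    moreover have "{g \<in> dag_flows V t h. g b = 0} = dag_flows V t h"
      using flow_root b unfolding eq by auto
    ultimately show ?thesis
      using tail[OF tail'(1,2)] has_unimodular_fan_mono[of "dag_space E V t h" "source_value t" "dag_cone E V t h"
        "{f. (\<forall>e\<in>E. 0 < f $ e) \<and> f $ b < f $ a}" "dag_flows V t h" "{f. \<forall>e\<in>E. 0 < f $ e}"] by auto
  next
    case head': head
    \<comment> \<open>Dually, a single outgoing edge carries the whole inflow, and only the half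
      treated by \<open>head\<close> occurs.\<close>
    have eq: "{e. t e = Some v} = {b}" using b head'(3) by blast
    have "f $ a \<le> f $ b" if "f \<in> dag_cone E V t h" for f
    proof -
      have "f $ a \<le> (\<Sum>e | h e = Some v. f $ e)"
        using a that by (intro member_le_sum) (auto simp: dag_cone_def)
      also have "\<dots> = f $ b"
        using root_balance[of f] that unfolding eq by (simp add: dag_cone_def)
      finally show ?thesis .
    qed
    then have "{f \<in> dag_cone E V t h. f $ a \<le> f $ b} = dag_cone E V t h" by blast
    moreover have "{g \<in> dag_flows V t h. g b \<noteq> 0} = dag_flows V t h"
    proof -
      \<comment> \<open>Here \<open>flow_root\<close> equates \<open>g b + 1\<close> with the
        indegree, which is at least 2.\<close>
      have "card {a, a'} \<le> card {e. h e = Some v}"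
        by (rule card_mono) (use a head' in auto)
      then show ?thesis
        using flow_root head'(2) unfolding eq by fastforce
    qed
    ultimately show ?thesis
      using head[OF head'(1,2)] has_unimodular_fan_mono[of "dag_space E V t h" "source_value t" "dag_cone E V t h"
        "{f. (\<forall>e\<in>E. 0 < f $ e) \<and> f $ a < f $ b}" "dag_flows V t h" "{f. \<forall>e\<in>E. 0 < f $ e}"] by auto
  next
    case contract
    then have "\<And>e. h e = Some v \<longleftrightarrow> e = a" "\<And>e. t e = Some v \<longleftrightarrow> e = b"
      using a b by blast+
    then show ?thesis
      using fan by (rule fan_contract)
  qed
qed

text \<open>Vertices are removed one at a time at a root. Without vertices the cone is the
  coordinate cone on \<open>E\<close>: one cell, indexed by the zero flow.\<close>

theorem dag_fan:
  fixes E :: "'e::finite set" and V :: "'v set"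
  assumes "dag E V t h"
  shows "dag_has_fan E V t h"
  using assms
proof (induction "card V" arbitrary: E V t h)
  case 0
  then have V: "V = {}" by (simp add: dag_def)
  have t: "t e = None" for e
    using 0 V unfolding dag_def by (metis empty_iff option.exhaust)
  have "dag_flows V t h = {\<lambda>_. 0}"
    using V t by (auto simp: dag_flows_def)
  moreover have "unimodular (\<lambda>f :: real ^ 'e. f)"
    by (rule unimodularI[where L' = "\<lambda>f. f"]) (auto simp: integer_lattice_def linear_iff)
  ultimately have "unimodular_fan (dag_space E V t h) (source_value t)
      (dag_cone E V t h) {f. \<forall>e\<in>E. 0 < f $ e} (dag_flows V t h) (\<lambda>_ f. f) (\<lambda>_. E)"
    using V t unfolding unimodular_fan_def
    by (auto simp: dag_space_def dag_cone_def coord_space_def coord_cone_def open_coord_cone_def source_value_def)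
  then show ?case
    by (auto simp: has_unimodular_fan_def)
next
  case (Suc n)
  have "V \<noteq> {}"
    using Suc.hyps(2) by auto
  then obtain v where v: "v \<in> V" "\<And>e. h e = Some v \<Longrightarrow> t e = None"
    using exists_dag_root[OF Suc.prems] by metis
  have "n = card (V - {v})"
    using Suc.hyps(2) v(1) by simp
  from dag_fan_root[OF Suc.hyps(1)[OF this] Suc.prems v] show ?case .
qed


section \<open>The volume of a unimodular cell\<close>

text \<open>Pulled back to a vector space with enough coordinates, \<open>T\<close> becomes an
  affine subspace, proper because of \<open>y0\<close>; it has empty interior and is therefore
  negligible.\<close>

lemma null_sets_PiM_affine_preimage:
  fixes p :: "real ^ 'e::finite" and b :: "nat \<Rightarrow> real ^ 'e"
  assumes k: "k \<le> CARD('e)" and T: "affine T"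
    and y0: "p + (\<Sum>i<k. y0 i *\<^sub>R b i) \<notin> T"
  shows "{y \<in> {..<k} \<rightarrow>\<^sub>E UNIV. p + (\<Sum>i<k. y i *\<^sub>R b i) \<in> T} \<in> null_sets (Pi\<^sub>M {..<k} (\<lambda>_. lborel))"
    (is "?Y \<in> null_sets ?P")
proof -
  have phi: "(\<lambda>y. p + (\<Sum>i<k. y i *\<^sub>R b i)) \<in> ?P \<rightarrow>\<^sub>M borel"
    by measurable
  have "T \<in> sets borel"
    by (rule borel_closed[OF affine_closed[OF T]])
  from measurable_sets[OF phi this] have Y: "?Y \<in> sets ?P"
    by (simp add: vimage_def Int_def space_PiM conj_commute)
  obtain idx :: "nat \<Rightarrow> 'e" where inj: "inj_on idx {..<k}"
    using card_le_inj[OF finite_lessThan finite[of UNIV], of k] k by auto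
  define \<psi> where "\<psi> = (\<lambda>x :: real ^ 'e. p + (\<Sum>i<k. x $ idx i *\<^sub>R b i))"
  have "affine (\<psi> -` T)"
    unfolding affine_def
  proof (intro ballI allI impI)
    fix x y and u v :: real assume *: "x \<in> \<psi> -` T" "y \<in> \<psi> -` T" "u + v = 1"
    have "\<psi> (u *\<^sub>R x + v *\<^sub>R y) = (u + v) *\<^sub>R p + (\<Sum>i<k. (u * x $ idx i + v * y $ idx i) *\<^sub>R b i)"
      using * by (simp add: \<psi>_def)
    also have "\<dots> = u *\<^sub>R \<psi> x + v *\<^sub>R \<psi> y"
      by (simp add: \<psi>_def algebra_simps sum.distrib scaleR_sum_right)
    finally show "u *\<^sub>R x + v *\<^sub>R y \<in> \<psi> -` T"
      using T * by (simp add: affine_def)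
  qed
  moreover have "\<psi> -` T \<noteq> UNIV"
  proof -
    have "\<psi> (\<chi> r. y0 (the_inv_into {..<k} idx r)) = p + (\<Sum>i<k. y0 i *\<^sub>R b i)"
      by (simp add: \<psi>_def the_inv_into_f_f[OF inj])
    then show ?thesis
      using y0 by (metis UNIV_I vimage_eq)
  qed
  ultimately have "interior (\<psi> -` T) = {}"
    using affine_hull_nonempty_interior affine_hull_eq by blast
  then have "negligible (\<psi> -` T)"
    using \<open>affine (\<psi> -` T)\<close> by (simp add: negligible_convex_interior affine_imp_convex)
  then have neg: "emeasure lborel A = 0" if "A \<subseteq> \<psi> -` T" "A \<in> sets lborel" for A
    using that negligible_subset[of "\<psi> -` T" A]
    by (auto simp: negligible_iff_null_sets null_sets_completion_iff)
  define pr where "pr = (\<lambda>x :: real ^ 'e. \<lambda>i\<in>{..<k}. x $ idx i)"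
  have "pr -` ?Y \<subseteq> \<psi> -` T"
    by (auto simp: pr_def \<psi>_def)
  then have "emeasure ?P ?Y = 0"
    using emeasure_PiM_eq_padded[OF inj Y] neg unfolding pr_def
      by (metis (no_types, lifting) Int_lower1 subset_trans)
  then show ?thesis
    using Y by (simp add: null_sets_def)
qed

text \<open>Otherwise some segment in \<open>C\<close> ends in a point that only \<open>T\<close>
  contains, while its other points avoid \<open>T\<close>. By pigeonhole another member contains two
  of these, hence the whole line and its endpoint.\<close>

lemma convex_subset_Union_affine:
  fixes C :: "'a::real_vector set"
  assumes "finite F" "convex C" "C \<subseteq> \<Union>F" "C \<noteq> {}" "\<And>T. T \<in> F \<Longrightarrow> affine T"
  shows "\<exists>T\<in>F. C \<subseteq> T"
  using assms
proof (induction F rule: finite_induct)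
  case empty
  then show ?case by simp
next
  case (insert T F)
  have line: "z + c *\<^sub>R (w - z) \<in> B" if "affine B" "z \<in> B" "w \<in> B" for B z w and c :: real
  proof -
    have "z + c *\<^sub>R (w - z) = (1 - c) *\<^sub>R z + c *\<^sub>R w"
      by (simp add: algebra_simps)
    then show ?thesis
      using that by (simp add: affine_def)
  qed
  show ?case
  proof (cases "C \<subseteq> \<Union>F")
    case True
    then show ?thesis using insert by auto
  next
    case False
    then obtain y where y: "y \<in> C" "y \<notin> \<Union>F" "y \<in> T"
      using insert.prems by auto
    have "C \<subseteq> T"
    proof (rule ccontr)
      assume "\<not> C \<subseteq> T"
      then obtain x where x: "x \<in> C" "x \<notin> T" by auto
      \<comment> \<open>The line from \<open>x\<close> (parameter 0) to \<open>y\<close> (parameter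
        1); it meets \<open>T\<close> only in \<open>y\<close>.\<close>
      define z where "z c = x + c *\<^sub>R (y - x)" for c :: real
      have "z c \<in> \<Union>F" if c: "c \<in> {0..<1}" for c
      proof -
        have "z c = (1 - c) *\<^sub>R x + c *\<^sub>R y"
          by (simp add: z_def algebra_simps)
        then have "z c \<in> C"
          using c x(1) y(1) \<open>convex C\<close> by (simp add: convex_alt)
        moreover have "z c \<notin> T"
        proof
          assume "z c \<in> T"
          then have "y + (1 / (1 - c)) *\<^sub>R (z c - y) \<in> T"
            using line[OF insert.prems(4)[OF insertI1] y(3)] by blast
          moreover have "z c - y = (1 - c) *\<^sub>R (x - y)"
            by (simp add: z_def algebra_simps)
          ultimately show False
            using c x(2) by simp
        qed
        ultimately show ?thesis
          using insert.prems(2) by auto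
      qed
      then have "\<forall>c\<in>{0..<1}. \<exists>B\<in>F. z c \<in> B" by blast
      then obtain B where B: "B \<in> F" "infinite {c \<in> {0..<1}. z c \<in> B}"
        using pigeonhole_infinite_rel[of "{0..<1::real}" F "\<lambda>c B. z c \<in> B"] insert.hyps(1)
          infinite_Ico[of 0 "1::real"] by auto
      then obtain c where c: "z c \<in> B"
        by (metis (mono_tags, lifting) infinite_imp_nonempty empty_Collect_eq)
      have "infinite ({c \<in> {0..<1}. z c \<in> B} - {c})"
        using B(2) by simp
      then obtain d where d: "z d \<in> B" "d \<noteq> c"
        by (metis (mono_tags, lifting) Diff_iff all_not_in_conv finite.emptyI mem_Collect_eq singletonI)
      \<comment> \<open>The factor leads from parameter \<open>c\<close> to parameter 1, that is, to
        \<open>y\<close>.\<close>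
      have "z c + ((1 - c) / (d - c)) *\<^sub>R (z d - z c) \<in> B"
        using line[OF insert.prems(4)[OF insertI2[OF B(1)]] c d(1)] by blast
      moreover have "z d - z c = (d - c) *\<^sub>R (y - x)"
        by (simp add: z_def algebra_simps)
      ultimately have "z c + (1 - c) *\<^sub>R (y - x) \<in> B"
        using d(2) by simp
      then have "y \<in> B"
        by (simp add: z_def algebra_simps)
      then show False
        using B(1) y(2) by blast
    qed
    then show ?thesis by blast
  qed
qed

locale unimodular_cell =
  fixes M :: "real ^ 'e::finite \<Rightarrow> real ^ 'e" and J :: "'e set"
  assumes unimod: "unimodular M"
begin

section \<open>The simplex spanned by the generators of a cell\<close>

abbreviation gen :: "'e \<Rightarrow> real ^ 'e" where "gen e \<equiv> M (axis e 1)"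

lemma linear_M: "linear M" and bij_M: "bij M" and lattice_M: "M ` integer_lattice = integer_lattice"
  using unimod by (auto simp: unimodular_def)

lemma coord_space_expand: "x \<in> coord_space J \<Longrightarrow> x = (\<Sum>e\<in>J. x $ e *\<^sub>R axis e 1)"
  by (auto simp: vec_eq_iff coord_space_def axis_def if_distrib[of "\<lambda>c. _ * c"] cong: if_cong)

lemma M_expand: "x \<in> coord_space J \<Longrightarrow> M x = (\<Sum>e\<in>J. x $ e *\<^sub>R gen e)"
  by (subst coord_space_expand) (simp_all add: linear_sum[OF linear_M] linear_scale[OF linear_M])

lemma sum_coord_space: "x \<in> coord_space J \<Longrightarrow> (\<Sum>e\<in>UNIV. x $ e) = (\<Sum>e\<in>J. x $ e)"
  by (intro sum.mono_neutral_right) (auto simp: coord_space_def)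

lemma inj_gen: "inj_on gen J"
  by (auto simp: inj_on_def axis_eq_axis dest!: injD[OF bij_is_inj[OF bij_M]])

lemma independent_gen: "independent (gen ` J)"
proof -
  have "independent ((\<lambda>e. axis e (1::real)) ` J)"
    by (rule independent_mono[OF independent_Basis]) (auto simp: Basis_vec_def)
  then have "independent (M ` (\<lambda>e. axis e 1) ` J)"
    by (rule linear_independent_injective_image[OF linear_M])
      (rule inj_on_subset[OF bij_is_inj[OF bij_M] subset_UNIV])
  then show ?thesis
    by (simp add: image_image)
qed

lemma coord_combination:
  "\<exists>x\<in>coord_space J. (\<forall>e\<in>J. x $ e = c e) \<and> (\<Sum>e\<in>J. c e *\<^sub>R gen e) = M x"
proof -
  let ?x = "\<chi> e. if e \<in> J then c e else 0"
  have x: "?x \<in> coord_space J" by (simp add: coord_space_def)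
  show ?thesis
    by (rule bexI[OF _ x]) (simp add: M_expand[OF x])
qed

lemma dim_cell: "dim (M ` coord_space J) = card J"
proof (rule dim_unique[OF _ _ independent_gen card_image[OF inj_gen]])
  show "gen ` J \<subseteq> M ` coord_space J"
    by (auto simp: coord_space_def axis_def)
  show "M ` coord_space J \<subseteq> span (gen ` J)"
  proof
    fix f assume "f \<in> M ` coord_space J"
    then obtain x where "f = (\<Sum>e\<in>J. x $ e *\<^sub>R gen e)"
      using M_expand by auto
    then show "f \<in> span (gen ` J)"
      by (simp add: span_sum span_scale span_base)
  qed
qed

lemma affine_hull_gen: "affine hull (gen ` J) = M ` {x \<in> coord_space J. (\<Sum>e\<in>UNIV. x $ e) = 1}"
proof (intro equalityI subsetI)
  fix f assume "f \<in> affine hull (gen ` J)"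
  then obtain u where u: "sum u (gen ` J) = 1" "f = (\<Sum>g\<in>gen ` J. u g *\<^sub>R g)"
    by (auto simp: affine_hull_finite)
  then have "(\<Sum>e\<in>J. u (gen e)) = 1" "f = (\<Sum>e\<in>J. u (gen e) *\<^sub>R gen e)"
    by (simp_all add: sum.reindex[OF inj_gen])
  then show "f \<in> M ` {x \<in> coord_space J. (\<Sum>e\<in>UNIV. x $ e) = 1}"
    using coord_combination[of "\<lambda>e. u (gen e)"] by (auto simp: sum_coord_space)
next
  fix f assume "f \<in> M ` {x \<in> coord_space J. (\<Sum>e\<in>UNIV. x $ e) = 1}"
  then obtain x where x: "x \<in> coord_space J" "(\<Sum>e\<in>J. x $ e) = 1" "f = M x"
    by (auto simp: sum_coord_space)
  let ?u = "\<lambda>g. x $ the_inv_into J gen g"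
  have "sum ?u (gen ` J) = 1" "(\<Sum>g\<in>gen ` J. ?u g *\<^sub>R g) = f"
    using x by (simp_all add: sum.reindex[OF inj_gen] the_inv_into_f_f[OF inj_gen] M_expand)
  then show "f \<in> affine hull (gen ` J)"
    unfolding affine_hull_finite[OF finite_imageI[OF finite]] mem_Collect_eq
    by (intro exI[of _ ?u] conjI)
qed

lemma convex_hull_gen: "convex hull (gen ` J) = M ` {x \<in> coord_cone J. (\<Sum>e\<in>UNIV. x $ e) = 1}"
proof (intro equalityI subsetI)
  fix f assume "f \<in> convex hull (gen ` J)"
  then obtain u where u: "\<forall>g\<in>gen ` J. 0 \<le> u g" "sum u (gen ` J) = 1" "f = (\<Sum>g\<in>gen ` J. u g *\<^sub>R g)"
    by (auto simp: convex_hull_finite)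
  then have u': "(\<Sum>e\<in>J. u (gen e)) = 1" "f = (\<Sum>e\<in>J. u (gen e) *\<^sub>R gen e)"
    by (simp_all add: sum.reindex[OF inj_gen])
  obtain x where x: "x \<in> coord_space J" "\<And>e. e \<in> J \<Longrightarrow> x $ e = u (gen e)" "f = M x"
    using coord_combination[of "\<lambda>e. u (gen e)"] u' by auto
  have "0 \<le> x $ e" for e
    using x u(1) by (cases "e \<in> J") (auto simp: coord_space_def)
  then show "f \<in> M ` {x \<in> coord_cone J. (\<Sum>e\<in>UNIV. x $ e) = 1}"
    using x u' by (auto simp: coord_cone_def sum_coord_space)
next
  fix f assume "f \<in> M ` {x \<in> coord_cone J. (\<Sum>e\<in>UNIV. x $ e) = 1}"
  then obtain x where x: "x \<in> coord_space J" "(\<Sum>e\<in>J. x $ e) = 1" "f = M x" "\<And>e. 0 \<le> x $ e"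
    by (auto simp: sum_coord_space coord_cone_def)
  let ?u = "\<lambda>g. x $ the_inv_into J gen g"
  have "sum ?u (gen ` J) = 1" "(\<Sum>g\<in>gen ` J. ?u g *\<^sub>R g) = f" "\<forall>g\<in>gen ` J. 0 \<le> ?u g"
    using x by (simp_all add: sum.reindex[OF inj_gen] the_inv_into_f_f[OF inj_gen] M_expand)
  then show "f \<in> convex hull (gen ` J)"
    unfolding convex_hull_finite[OF finite_imageI[OF finite]] mem_Collect_eq
    by (intro exI[of _ ?u] conjI)
qed

lemma aff_dim_gen: "aff_dim (gen ` J) + 1 = int (card J)"
proof -
  have "\<not> affine_dependent (gen ` J)"
    using affine_dependent_imp_dependent independent_gen by blast
  then show ?thesis
    using aff_dim_affine_independent[of "gen ` J"] by (simp add: card_image[OF inj_gen])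
qed

end


context unimodular_cell
begin

text \<open>The direction of the affine hull of the generators, in coordinates of the cell:
  differences of points with coordinate sum 1.\<close>

definition zero_sum :: "(real ^ 'e) set" where
  "zero_sum = {x \<in> coord_space J. (\<Sum>e\<in>UNIV. x $ e) = 0}"

lemma sum_axis: "(\<Sum>e\<in>UNIV. axis a (1::real) $ e) = 1"
  by (simp add: axis_def)

lemma direction_hull:
  assumes "J \<noteq> {}"
  shows "direction (affine hull (gen ` J)) = M ` zero_sum"
proof (intro equalityI subsetI)
  fix f assume "f \<in> direction (affine hull (gen ` J))"
  then obtain x y where xy: "x \<in> coord_space J" "(\<Sum>e\<in>UNIV. x $ e) = 1" "y \<in> coord_space J" "(\<Sum>e\<in>UNIV. y $ e) = 1"
    "f = M x - M y"
    unfolding direction_def affine_hull_gen by blast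
  then have "x - y \<in> zero_sum" "f = M (x - y)"
    by (auto simp: zero_sum_def coord_space_def sum_subtractf linear_diff[OF linear_M])
  then show "f \<in> M ` zero_sum" by blast
next
  fix f assume "f \<in> M ` zero_sum"
  then obtain x where x: "x \<in> zero_sum" "f = M x" by blast
  obtain a where a: "a \<in> J" using assms by blast
  have "x + axis a 1 \<in> {x \<in> coord_space J. (\<Sum>e\<in>UNIV. x $ e) = 1}"
    "axis a 1 \<in> {x \<in> coord_space J. (\<Sum>e\<in>UNIV. x $ e) = 1}"
    using x(1) a by (auto simp: zero_sum_def coord_space_def sum.distrib sum_axis) (auto simp: axis_def)
  moreover have "f = M (x + axis a 1) - M (axis a 1)"
    by (simp add: x(2) linear_add[OF linear_M])
  ultimately show "f \<in> direction (affine hull (gen ` J))"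
    unfolding direction_def affine_hull_gen by blast
qed

end

text \<open>A base vertex \<open>a\<close> of the simplex and a numbering of the other vertices;
  their differences from \<open>a\<close> will form a lattice basis.\<close>

locale enumerated_cell = unimodular_cell +
  fixes a k and idx :: "nat \<Rightarrow> 'a"
  assumes a: "a \<in> J" and idx: "bij_betw idx {..<k} (J - {a})"
begin

definition diff :: "nat \<Rightarrow> real ^ 'a" where
  "diff i = axis (idx i) 1 - axis a 1"

lemma idx_J: "i < k \<Longrightarrow> idx i \<in> J" and idx_a: "i < k \<Longrightarrow> idx i \<noteq> a"
  using idx by (auto simp: bij_betw_def)

lemma idx_eq: "i < k \<Longrightarrow> j < k \<Longrightarrow> idx i = idx j \<longleftrightarrow> i = j"
  using idx by (auto simp: bij_betw_def inj_on_def)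

lemma k: "card J = Suc k" "k \<le> CARD('a)"
proof -
  have "card (J - {a}) = k"
    using bij_betw_same_card[OF idx] by simp
  then show "card J = Suc k"
    using a by (metis card.remove finite)
  then show "k \<le> CARD('a)"
    using card_mono[of UNIV J] by simp
qed

lemma J_eq: "J = insert a (idx ` {..<k})"
  using idx a by (auto simp: bij_betw_def)

lemma sum_J: "(\<Sum>e\<in>J. g e) = g a + (\<Sum>i<k. g (idx i))"
proof -
  have "(\<Sum>e\<in>J. g e) = g a + (\<Sum>e\<in>J - {a}. g e)"
    by (rule sum.remove[OF finite a])
  also have "(\<Sum>e\<in>J - {a}. g e) = (\<Sum>i<k. g (idx i))"
    by (rule sum.reindex_bij_betw[OF idx, symmetric])
  finally show ?thesis .
qed

lemma diff_nth: "i < k \<Longrightarrow> j < k \<Longrightarrow> diff i $ idx j = (if i = j then 1 else 0)"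
  using idx_a[of j] idx_eq by (auto simp: diff_def axis_def)

lemma diff_zero_sum: "i < k \<Longrightarrow> diff i \<in> zero_sum"
  using idx_J a by (auto simp: zero_sum_def coord_space_def diff_def sum_subtractf sum_axis) (auto simp: axis_def)

lemma subspace_zero_sum: "subspace zero_sum"
  by (auto simp: subspace_def zero_sum_def coord_space_def sum.distrib sum_distrib_left[symmetric])

text \<open>The coordinate at \<open>a\<close> is minus the sum of the others.\<close>

lemma zero_sum_eqI:
  assumes "x \<in> zero_sum" "y \<in> zero_sum" "\<And>i. i < k \<Longrightarrow> x $ idx i = y $ idx i"
  shows "x = y"
proof -
  have z: "x - y \<in> zero_sum"
    using assms subspace_zero_sum subspace_diff by blast
  then have "(\<Sum>e\<in>J. (x - y) $ e) = 0"
    using sum_coord_space[of "x - y"] unfolding zero_sum_def mem_Collect_eq by (simp only:)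
  then have "(x - y) $ a = 0"
    using assms(3) by (simp add: sum_J)
  moreover have "x - y \<in> coord_space J"
    using z by (simp add: zero_sum_def)
  ultimately have "(x - y) $ e = 0" for e
    using assms(3) unfolding J_eq coord_space_def
    by (cases "e \<in> insert a (idx ` {..<k})") auto
  then show ?thesis
    by (simp add: vec_eq_iff)
qed

lemma combination_nth: "j < k \<Longrightarrow> (\<Sum>i<k. c i *\<^sub>R diff i) $ idx j = c j"
  by (simp add: diff_nth if_distrib[of "\<lambda>z. _ * z"] cong: if_cong)

lemma combination_zero_sum: "(\<Sum>i<k. c i *\<^sub>R diff i) \<in> zero_sum"
  by (intro subspace_sum subspace_scale subspace_zero_sum diff_zero_sum) simp

lemma zero_sum_expand: "x \<in> zero_sum \<Longrightarrow> x = (\<Sum>i<k. x $ idx i *\<^sub>R diff i)"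
  by (rule zero_sum_eqI) (simp_all only: combination_zero_sum combination_nth)

lemma M_combination: "M (\<Sum>i<k. c i *\<^sub>R diff i) = (\<Sum>i<k. c i *\<^sub>R M (diff i))"
  by (simp add: linear_sum[OF linear_M] linear_scale[OF linear_M])

lemma M_zero_sum_expand: "x \<in> zero_sum \<Longrightarrow> M x = (\<Sum>i<k. x $ idx i *\<^sub>R M (diff i))"
  by (rule trans[OF arg_cong[where f = M, OF zero_sum_expand] M_combination])

lemma inj_M_diff: "inj_on (\<lambda>i. M (diff i)) {..<k}"
proof (rule inj_onI)
  fix i j assume ij: "i \<in> {..<k}" "j \<in> {..<k}" "M (diff i) = M (diff j)"
  then have "diff i = diff j"
    using injD[OF bij_is_inj[OF bij_M]] by blast
  then have "diff i $ idx j = diff j $ idx j"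
    by simp
  then show "i = j"
    using ij diff_nth by (auto split: if_splits)
qed

lemma independent_M_diff: "independent ((\<lambda>i. M (diff i)) ` {..<k})"
proof (rule independent_if_scalars_zero)
  fix u x assume 0: "(\<Sum>x\<in>(\<lambda>i. M (diff i)) ` {..<k}. u x *\<^sub>R x) = 0" and x: "x \<in> (\<lambda>i. M (diff i)) ` {..<k}"
  obtain j where j: "j < k" "x = M (diff j)" using x by auto
  have "M (\<Sum>i<k. u (M (diff i)) *\<^sub>R diff i) = M 0"
    using 0 by (simp add: sum.reindex[OF inj_M_diff] M_combination linear_0[OF linear_M])
  then have "(\<Sum>i<k. u (M (diff i)) *\<^sub>R diff i) = 0"
    using injD[OF bij_is_inj[OF bij_M]] by blast
  then have "(\<Sum>i<k. u (M (diff i)) *\<^sub>R diff i) $ idx j = 0"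
    by simp
  then show "u x = 0"
    unfolding combination_nth[OF j(1)] j(2) .
qed simp

lemma span_M_diff: "span ((\<lambda>i. M (diff i)) ` {..<k}) = M ` zero_sum"
proof
  show "span ((\<lambda>i. M (diff i)) ` {..<k}) \<subseteq> M ` zero_sum"
    by (rule span_minimal) (auto simp: diff_zero_sum linear_subspace_image[OF linear_M subspace_zero_sum])
  show "M ` zero_sum \<subseteq> span ((\<lambda>i. M (diff i)) ` {..<k})"
  proof
    fix f assume "f \<in> M ` zero_sum"
    then obtain x where "x \<in> zero_sum" "f = M x" by blast
    then have "f = (\<Sum>i<k. x $ idx i *\<^sub>R M (diff i))"
      using M_zero_sum_expand by blast
    then show "f \<in> span ((\<lambda>i. M (diff i)) ` {..<k})"
      by (simp only:) (intro span_sum span_scale span_base imageI)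
  qed
qed

lemma dim_zero_sum: "dim (M ` zero_sum) = k"
  unfolding span_M_diff[symmetric] dim_span
  using dim_eq_card_independent[OF independent_M_diff] card_image[OF inj_M_diff] by simp

lemma lattice_iff: "M x \<in> integer_lattice \<longleftrightarrow> x \<in> integer_lattice"
  using lattice_M bij_is_inj[OF bij_M] by (metis inj_image_mem_iff)

text \<open>The coefficients of a zero-sum vector in the \<open>diff i\<close> are its coordinates
  at the \<open>idx i\<close>, so integer vectors have integer coefficients; \<open>M\<close>
  respects integrality both ways.\<close>

lemma lattice_basis_diff: "lattice_basis (M ` zero_sum) (\<lambda>i. M (diff i))"
  unfolding lattice_basis_def dim_zero_sum
proof (intro conjI inj_M_diff independent_M_diff span_M_diff equalityI subsetI)
  fix f assume "f \<in> M ` zero_sum \<inter> integer_lattice"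
  then obtain x where x: "x \<in> zero_sum" "f = M x" "x \<in> integer_lattice"
    using lattice_iff by blast
  then have "\<forall>i. \<exists>c. x $ idx i = of_int c"
    by (auto simp: integer_lattice_def Ints_def)
  then obtain c where "\<And>i. x $ idx i = of_int (c i)" by metis
  then have "f = (\<Sum>i<k. of_int (c i) *\<^sub>R M (diff i))"
    using M_zero_sum_expand[OF x(1)] x(2) by simp
  then show "f \<in> {\<Sum>i<k. of_int (c i) *\<^sub>R M (diff i) | c. True}" by blast
next
  fix f assume "f \<in> {\<Sum>i<k. of_int (c i) *\<^sub>R M (diff i) | c. True}"
  then obtain c :: "nat \<Rightarrow> int" where "f = M (\<Sum>i<k. of_int (c i) *\<^sub>R diff i)"
    using M_combination by auto
  moreover have "(\<Sum>i<k. of_int (c i) *\<^sub>R diff i) \<in> integer_lattice"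
    by (auto simp: integer_lattice_def diff_def axis_def intro!: Ints_sum Ints_mult)
  ultimately show "f \<in> M ` zero_sum \<inter> integer_lattice"
    by (simp only: Int_iff lattice_iff simp_thms) (rule imageI, rule combination_zero_sum)
qed

text \<open>The given basis and the \<open>M (diff i)\<close> span the same lattice, so they are
  related by mutually inverse integer matrices. In the second basis the simplex is the standard one,
  up to an affine shift.\<close>

lemma measure_simplex:
  assumes p: "p \<in> affine hull (gen ` J)" and b: "lattice_basis (M ` zero_sum) b"
  shows "measure (Pi\<^sub>M {..<k} (\<lambda>_. lborel))
    {y \<in> {..<k} \<rightarrow>\<^sub>E UNIV. p + (\<Sum>i<k. y i *\<^sub>R b i) \<in> convex hull (gen ` J)} = 1 / fact k"
proof -
  let ?P = "Pi\<^sub>M {..<k} (\<lambda>_. lborel :: real measure)"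
  \<comment> \<open>The standard simplex, with the coordinate at the base vertex omitted.\<close>
  define X where "X = {z :: nat \<Rightarrow> real. (\<forall>i\<in>{..<k}. 0 \<le> z i) \<and> sum z {..<k} \<le> 1} \<inter> space ?P"
  have emX: "emeasure ?P X = ennreal (1 / fact k)"
    unfolding X_def using emeasure_std_simplex_aux[of "{..<k}" 1] by simp
  have X_eq: "X = Pi\<^sub>E {..<k} (\<lambda>_. {0..}) \<inter> (\<lambda>x. sum x {..<k}) -` {..1} \<inter> space ?P"
    by (auto simp: X_def space_PiM PiE_def Pi_def)
  have X: "X \<in> sets ?P"
    unfolding X_eq by measurable
  obtain q where q: "q \<in> coord_space J" "(\<Sum>e\<in>UNIV. q $ e) = 1" "p = M q"
    using p unfolding affine_hull_gen by blast
  have lattice: "M ` zero_sum \<inter> integer_lattice = {\<Sum>i<k. of_int (c i) *\<^sub>R b i | c. True}"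
    using b unfolding lattice_basis_def dim_zero_sum by (elim conjE)
  have b_in: "b j \<in> M ` zero_sum \<inter> integer_lattice" if "j < k" for j
  proof -
    have "(\<Sum>i<k. of_int (if i = j then 1 else 0) *\<^sub>R b i) = (\<Sum>i<k. if i = j then b i else 0)"
      by (rule sum.cong) auto
    then have "b j = (\<Sum>i<k. of_int (if i = j then 1 else 0) *\<^sub>R b i)"
      using that by simp
    then show ?thesis
      unfolding lattice by (intro CollectI exI[of _ "\<lambda>i. if i = j then 1 else 0"] conjI TrueI)
  qed
  have "\<exists>x. x \<in> zero_sum \<and> x \<in> integer_lattice \<and> b j = M x" if "j < k" for j
    using b_in[OF that] by (auto simp: lattice_iff)
  then obtain x where x: "\<And>j. j < k \<Longrightarrow> x j \<in> zero_sum" "\<And>j. j < k \<Longrightarrow> x j \<in> integer_lattice"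
    "\<And>j. j < k \<Longrightarrow> b j = M (x j)"
    by metis
  have "M (diff i) \<in> M ` zero_sum \<inter> integer_lattice" if "i < k" for i
    using that diff_zero_sum lattice_iff by (auto simp: integer_lattice_def diff_def axis_def)
  then have "\<forall>i. \<exists>c :: nat \<Rightarrow> int. i < k \<longrightarrow> M (diff i) = (\<Sum>l<k. of_int (c l) *\<^sub>R b l)"
    unfolding lattice by simp
  then obtain c :: "nat \<Rightarrow> nat \<Rightarrow> int" where c: "\<And>i. i < k \<Longrightarrow> M (diff i) = (\<Sum>l<k. of_int (c i l) *\<^sub>R b l)"
    by metis
  have diff_c: "diff i = (\<Sum>l<k. of_int (c i l) *\<^sub>R x l)" if "i < k" for i
  proof -
    have "M (diff i) = M (\<Sum>l<k. of_int (c i l) *\<^sub>R x l)"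
      using c[OF that] x(3) by (simp add: linear_sum[OF linear_M] linear_scale[OF linear_M])
    then show ?thesis
      using injD[OF bij_is_inj[OF bij_M]] by blast
  qed
  \<comment> \<open>Column \<open>j\<close> holds the coordinates of \<open>b j\<close> in the basis
    of the \<open>M (diff i)\<close>.\<close>
  define U where "U i j = (if i < k \<and> j < k then x j $ idx i else 0)" for i j
  have U: "U i j \<in> \<int>" for i j
    using x(2) by (simp add: U_def integer_lattice_def)
  have inv: "(\<Sum>l<k. U i l * of_int (c j l)) = (if i = j then 1 else 0)" if "i < k" "j < k" for i j
  proof -
    have "(\<Sum>l<k. U i l * of_int (c j l)) = (\<Sum>l<k. of_int (c j l) *\<^sub>R x l) $ idx i"
      using that by (simp add: U_def mult.commute)
    also have "\<dots> = (if i = j then 1 else 0)"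
      unfolding diff_c[OF that(2), symmetric] using that diff_nth by simp
    finally show ?thesis .
  qed
  have "p + (\<Sum>i<k. y i *\<^sub>R b i) \<in> convex hull (gen ` J) \<longleftrightarrow>
    (\<lambda>i\<in>{..<k}. q $ idx i + (\<Sum>j<k. U i j * y j)) \<in> X" for y
  proof -
    define w where "w = q + (\<Sum>j<k. y j *\<^sub>R x j)"
    have "(\<Sum>j<k. y j *\<^sub>R x j) \<in> zero_sum"
      by (intro subspace_sum subspace_scale subspace_zero_sum x(1)) simp
    then have w: "w \<in> coord_space J" "(\<Sum>e\<in>UNIV. w $ e) = 1"
      using q unfolding w_def zero_sum_def by (auto simp: coord_space_def sum.distrib simp del: sum_component)
    have eq: "p + (\<Sum>i<k. y i *\<^sub>R b i) = M w"
      using x(3) q(3) by (simp add: w_def linear_add[OF linear_M] linear_sum[OF linear_M] linear_scale[OF linear_M])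
    have "p + (\<Sum>i<k. y i *\<^sub>R b i) \<in> convex hull (gen ` J) \<longleftrightarrow> w \<in> coord_cone J"
      unfolding eq convex_hull_gen inj_image_mem_iff[OF bij_is_inj[OF bij_M]] using w(2) by simp
    also have "\<dots> \<longleftrightarrow> (\<forall>e\<in>J. 0 \<le> w $ e)"
      using w(1) by (auto simp: coord_cone_def coord_space_def)
    also have "\<dots> \<longleftrightarrow> (\<forall>i<k. 0 \<le> w $ idx i) \<and> (\<Sum>i<k. w $ idx i) \<le> 1"
    proof -
      \<comment> \<open>The coordinates sum to 1, so nonnegativity of the omitted one is the
        inequality that bounds the sum in \<open>X\<close>.\<close>
      have "w $ a + (\<Sum>i<k. w $ idx i) = 1"
        using w sum_J[of "($) w"] by (simp add: sum_coord_space)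
      then have "0 \<le> w $ a \<longleftrightarrow> (\<Sum>i<k. w $ idx i) \<le> 1" by linarith
      then show ?thesis
        by (subst J_eq) auto
    qed
    also have "\<dots> \<longleftrightarrow> (\<lambda>i\<in>{..<k}. w $ idx i) \<in> X"
      by (auto simp: X_def space_PiM)
    also have "(\<lambda>i\<in>{..<k}. w $ idx i) = (\<lambda>i\<in>{..<k}. q $ idx i + (\<Sum>j<k. U i j * y j))"
      by (auto simp: w_def U_def mult.commute intro!: restrict_ext sum.cong)
    finally show ?thesis .
  qed
  then have "{y \<in> {..<k} \<rightarrow>\<^sub>E UNIV. p + (\<Sum>i<k. y i *\<^sub>R b i) \<in> convex hull (gen ` J)} =
    {y \<in> {..<k} \<rightarrow>\<^sub>E UNIV. (\<lambda>i\<in>{..<k}. q $ idx i + (\<Sum>j<k. U i j * y j)) \<in> X}"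
    by blast
  also have "measure ?P \<dots> = measure ?P X"
  \<comment> \<open>\<open>c j\<close> lists the coordinates of \<open>M (diff j)\<close> in the
    basis \<open>b\<close>, hence the transposed indices.\<close>
  proof (rule measure_PiM_unimodular[where 'e = 'a and U' = "\<lambda>l j. of_int (c j l)"])
    show "emeasure ?P X < \<infinity>"
      unfolding emX by simp
  qed (use k(2) U X inv in auto)
  also have "\<dots> = 1 / fact k"
    unfolding measure_def emX by simp
  finally show ?thesis .
qed

end


section \<open>The normalized volume of a fan\<close>

text \<open>\<open>F\<close> contains flats that catch what the cells may miss of \<open>S\<close>.
  The simplices have dimension \<open>dim W - 1\<close>, and the last condition on \<open>F\<close>
  puts the flats strictly below that.\<close>

locale fan_complex =
  fixes W :: "(real ^ 'e::finite) set" and N and R R' :: "(real ^ 'e) set" and K :: "'k set" and M J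
    and S :: "(real ^ 'e) set" and F
  assumes fan: "unimodular_fan W N R R' K M J"
    and K: "K \<noteq> {}" and dim_W: "0 < dim W"
    and S_lower: "{f \<in> R. N f = 1} \<subseteq> S" and S_upper: "S \<subseteq> {f \<in> R. N f = 1} \<union> \<Union>F"
    and F: "finite F" "\<And>T. T \<in> F \<Longrightarrow> affine T" "\<And>T. T \<in> F \<Longrightarrow> aff_dim T + 1 < int (dim W)"
    and S_borel: "S \<in> sets borel"
begin

abbreviation gens :: "'k \<Rightarrow> (real ^ 'e) set" where "gens \<kappa> \<equiv> (\<lambda>e. M \<kappa> (axis e 1)) ` J \<kappa>"

abbreviation conv :: "'k \<Rightarrow> (real ^ 'e) set" where "conv \<kappa> \<equiv> convex hull (gens \<kappa>)"

lemma finite_K: "finite K"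
  using fan by (simp add: unimodular_fan_def)

lemma cell: "\<kappa> \<in> K \<Longrightarrow> unimodular_cell (M \<kappa>)"
  using fan by (simp add: unimodular_fan_def unimodular_cell_def)

lemma space: "\<kappa> \<in> K \<Longrightarrow> M \<kappa> ` coord_space (J \<kappa>) = W"
  using fan by (simp add: unimodular_fan_def)

lemma card_J: "\<kappa> \<in> K \<Longrightarrow> card (J \<kappa>) = dim W"
  using unimodular_cell.dim_cell[OF cell] space by metis

lemma J_nonempty: "\<kappa> \<in> K \<Longrightarrow> J \<kappa> \<noteq> {}"
  using card_J dim_W by (metis card.empty less_irrefl)

lemma aff_dim_gens: "\<kappa> \<in> K \<Longrightarrow> aff_dim (gens \<kappa>) = int (dim W) - 1"
  using unimodular_cell.aff_dim_gen[OF cell, of \<kappa> "J \<kappa>"] card_J by simp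

text \<open>On every cell \<open>N\<close> is the coordinate sum, so its level set 1 is the simplex
  on the generators.\<close>

lemma slice_eq: "{f \<in> R. N f = 1} = (\<Union>\<kappa>\<in>K. conv \<kappa>)"
proof (intro equalityI subsetI)
  fix f assume f: "f \<in> {f \<in> R. N f = 1}"
  then have "f \<in> (\<Union>\<kappa>\<in>K. M \<kappa> ` coord_cone (J \<kappa>))"
    using fan unfolding unimodular_fan_def by (elim conjE) (rule subsetD, assumption, simp)
  then obtain \<kappa> x where \<kappa>: "\<kappa> \<in> K" "x \<in> coord_cone (J \<kappa>)" "f = M \<kappa> x" by blast
  moreover have "(\<Sum>e\<in>UNIV. x $ e) = 1"
    using fan f \<kappa> by (simp add: unimodular_fan_def)
  ultimately have "f \<in> conv \<kappa>"
    unfolding unimodular_cell.convex_hull_gen[OF cell[OF \<kappa>(1)]] by blast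
  then show "f \<in> (\<Union>\<kappa>\<in>K. conv \<kappa>)"
    using \<kappa>(1) by blast
next
  fix f assume "f \<in> (\<Union>\<kappa>\<in>K. conv \<kappa>)"
  then obtain \<kappa> where \<kappa>: "\<kappa> \<in> K" "f \<in> conv \<kappa>" by blast
  then obtain x where "x \<in> coord_cone (J \<kappa>)" "(\<Sum>e\<in>UNIV. x $ e) = 1" "f = M \<kappa> x"
    unfolding unimodular_cell.convex_hull_gen[OF cell[OF \<kappa>(1)]] by blast
  then show "f \<in> {f \<in> R. N f = 1}"
    using fan \<kappa>(1) by (simp add: unimodular_fan_def)
qed

lemma simplex_subset: "\<kappa> \<in> K \<Longrightarrow> conv \<kappa> \<subseteq> S"
  using S_lower unfolding slice_eq by blast

lemma simplex_subset_hull: "conv \<kappa> \<subseteq> affine hull (gens \<kappa>)"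
  by (rule convex_hull_subset_affine_hull)

lemma convex_subset_cases:
  assumes C: "convex C" "C \<subseteq> S" "C \<noteq> {}"
  shows "(\<exists>\<kappa>\<in>K. C \<subseteq> affine hull (gens \<kappa>)) \<or> (\<exists>T\<in>F. C \<subseteq> T)"
proof -
  let ?F = "(\<lambda>\<kappa>. affine hull (gens \<kappa>)) ` K \<union> F"
  have "C \<subseteq> \<Union>?F"
  proof
    fix f assume "f \<in> C"
    then have "f \<in> (\<Union>\<kappa>\<in>K. conv \<kappa>) \<or> f \<in> \<Union>F"
      using C(2) S_upper unfolding slice_eq by blast
    then show "f \<in> \<Union>?F"
      using simplex_subset_hull by blast
  qed
  then have "\<exists>T\<in>?F. C \<subseteq> T"
    by (rule convex_subset_Union_affine[rotated 2]) (use C F finite_K in auto)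
  then show ?thesis by blast
qed

lemma aff_dim_convex_le:
  assumes C: "convex C" "C \<subseteq> S"
  shows "aff_dim C \<le> int (dim W) - 1"
proof (cases "C = {}")
  case True
  then show ?thesis using dim_W by simp
next
  case False
  from convex_subset_cases[OF C False] show ?thesis
  proof
    assume "\<exists>\<kappa>\<in>K. C \<subseteq> affine hull (gens \<kappa>)"
    then obtain \<kappa> where \<kappa>: "\<kappa> \<in> K" "C \<subseteq> affine hull (gens \<kappa>)" by blast
    then show ?thesis
      using aff_dim_subset[OF \<kappa>(2)] aff_dim_gens[OF \<kappa>(1)] by simp
  next
    assume "\<exists>T\<in>F. C \<subseteq> T"
    then obtain T where T: "T \<in> F" "C \<subseteq> T" by blast
    then show ?thesis
      using aff_dim_subset[OF T(2)] F(3)[OF T(1)] by simp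
  qed
qed

lemma polyhedral_dim_S: "polyhedral_dim S = int (dim W) - 1"
  unfolding polyhedral_dim_def
proof (rule Max_eqI)
  have "{aff_dim C | C. convex C \<and> C \<subseteq> S} \<subseteq> {-1..int DIM(real ^ 'e)}"
    by (auto simp only: atLeastAtMost_iff intro: aff_dim_geq aff_dim_le_DIM)
  then show "finite {aff_dim C | C. convex C \<and> C \<subseteq> S}"
    using finite_subset by blast
  show "x \<le> int (dim W) - 1" if "x \<in> {aff_dim C | C. convex C \<and> C \<subseteq> S}" for x
    using that aff_dim_convex_le by blast
  obtain \<kappa> where \<kappa>: "\<kappa> \<in> K" using K by blast
  have "int (dim W) - 1 = aff_dim (conv \<kappa>)"
    by (simp add: aff_dim_convex_hull aff_dim_gens[OF \<kappa>])
  then show "int (dim W) - 1 \<in> {aff_dim C | C. convex C \<and> C \<subseteq> S}"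
    using simplex_subset[OF \<kappa>] convex_convex_hull by blast
qed

text \<open>A convex set of top dimension fits into no flat of \<open>F\<close>, hence into the hull
  of one simplex, and equal dimensions make the hulls equal.\<close>

lemma top_hulls_S: "top_hulls S = (\<lambda>\<kappa>. affine hull (gens \<kappa>)) ` K"
proof (intro equalityI subsetI)
  fix A assume "A \<in> top_hulls S"
  then obtain C where C: "A = affine hull C" "convex C" "C \<subseteq> S" "aff_dim C = int (dim W) - 1"
    unfolding top_hulls_def polyhedral_dim_S by blast
  have "aff_dim C \<noteq> -1" using C(4) dim_W by linarith
  then have ne: "C \<noteq> {}" by auto
  have "\<not> C \<subseteq> T" if "T \<in> F" for T
    using aff_dim_subset[of C T] F(3)[OF that] C(4) by auto
  then obtain \<kappa> where \<kappa>: "\<kappa> \<in> K" "C \<subseteq> affine hull (gens \<kappa>)"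
    using convex_subset_cases[OF C(2,3) ne] by blast
  have "affine hull C \<subseteq> affine hull (gens \<kappa>)"
    using \<kappa>(2) by (simp add: hull_minimal affine_affine_hull)
  then have "affine hull C = affine hull (gens \<kappa>)"
    by (rule affine_dim_equal[rotated 3])
      (use ne C(4) aff_dim_gens[OF \<kappa>(1)] in \<open>simp_all add: affine_affine_hull\<close>)
  then show "A \<in> (\<lambda>\<kappa>. affine hull (gens \<kappa>)) ` K"
    using C(1) \<kappa>(1) by blast
next
  fix A assume "A \<in> (\<lambda>\<kappa>. affine hull (gens \<kappa>)) ` K"
  then obtain \<kappa> where \<kappa>: "\<kappa> \<in> K" "A = affine hull (gens \<kappa>)" by blast
  then have "A = affine hull (conv \<kappa>)" by simp
  moreover have "aff_dim (conv \<kappa>) = int (dim W) - 1"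
    by (simp add: aff_dim_convex_hull aff_dim_gens[OF \<kappa>(1)])
  ultimately show "A \<in> top_hulls S"
    unfolding top_hulls_def polyhedral_dim_S using simplex_subset[OF \<kappa>(1)] convex_convex_hull by blast
qed

text \<open>Outside the open cone some coordinate vanishes, which puts the point on the hull of a
  facet.\<close>

lemma boundary_covered:
  assumes \<kappa>: "\<kappa> \<in> K" and f: "f \<in> conv \<kappa>" "f \<notin> M \<kappa> ` open_coord_cone (J \<kappa>)"
  shows "\<exists>e\<in>J \<kappa>. f \<in> affine hull ((\<lambda>e. M \<kappa> (axis e 1)) ` (J \<kappa> - {e}))"
proof -
  obtain x where x: "x \<in> coord_cone (J \<kappa>)" "(\<Sum>e\<in>UNIV. x $ e) = 1" "f = M \<kappa> x"
    using f(1) unfolding unimodular_cell.convex_hull_gen[OF cell[OF \<kappa>]] by blast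
  then have "x \<notin> open_coord_cone (J \<kappa>)"
    using f(2) by blast
  then obtain e where e: "e \<in> J \<kappa>" "\<not> 0 < x $ e"
    using x(1) by (auto simp: open_coord_cone_def coord_cone_def)
  moreover have "0 \<le> x $ e"
    using x(1) by (simp add: coord_cone_def)
  ultimately have e: "e \<in> J \<kappa>" "x $ e = 0"
    by simp_all
  have "x \<in> coord_space (J \<kappa> - {e})"
    using x(1) e by (auto simp: coord_cone_def coord_space_def)
  then have "f \<in> M \<kappa> ` {x \<in> coord_space (J \<kappa> - {e}). (\<Sum>e\<in>UNIV. x $ e) = 1}"
    using x by blast
  then show ?thesis
    unfolding unimodular_cell.affine_hull_gen[OF cell[OF \<kappa>], symmetric] using e(1) by blast
qed

text \<open>Up to a null set, \<open>S\<close> meets \<open>A\<close> in the disjoint union of the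
  simplices with hull \<open>A\<close>, each of measure 1 / k!.\<close>

lemma volume_in_hull:
  assumes \<kappa>0: "\<kappa>0 \<in> K" and A: "A = affine hull (gens \<kappa>0)"
  shows "normalized_volume_in A S = card {\<kappa> \<in> K. affine hull (gens \<kappa>) = A}"
proof -
  let ?K = "{\<kappa> \<in> K. affine hull (gens \<kappa>) = A}"
  define k where "k = dim W - 1"
  have enum: "\<exists>a idx. enumerated_cell (M \<kappa>) (J \<kappa>) a k idx"
    if \<kappa>: "\<kappa> \<in> K" for \<kappa>
  proof -
    obtain a where a: "a \<in> J \<kappa>"
      using J_nonempty[OF \<kappa>] by blast
    have "card (J \<kappa> - {a}) = k"
      using a card_J[OF \<kappa>] by (simp add: k_def)
    then obtain idx where "bij_betw idx {..<k} (J \<kappa> - {a})"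
      using ex_bij_betw_nat_finite[of "J \<kappa> - {a}"] by (auto simp: atLeast0LessThan)
    then show ?thesis
      using a cell[OF \<kappa>] by (auto simp: enumerated_cell_def enumerated_cell_axioms_def)
  qed
  \<comment> \<open>All cells with hull \<open>A\<close> share its direction, so the one lattice
    basis \<open>b\<close> serves each of them.\<close>
  have dirs: "direction A = M \<kappa> ` unimodular_cell.zero_sum (J \<kappa>)" if "\<kappa> \<in> ?K"
    for \<kappa>
    using that unimodular_cell.direction_hull[OF cell, of \<kappa> "J \<kappa>"] J_nonempty[of \<kappa>] by auto
  obtain a0 idx0 where "enumerated_cell (M \<kappa>0) (J \<kappa>0) a0 k idx0"
    using enum[OF \<kappa>0] by blast
  then interpret c0: enumerated_cell "M \<kappa>0" "J \<kappa>0" a0 k idx0 .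
  have dir0: "direction A = M \<kappa>0 ` c0.zero_sum"
    using dirs[of \<kappa>0] \<kappa>0 A by blast
  have dim: "dim (direction A) = k"
    unfolding dir0 by (rule c0.dim_zero_sum)
  define p where "p = (SOME p. p \<in> A)"
  define b where "b = (SOME b. lattice_basis (direction A) b)"
  have "A \<noteq> {}"
    using J_nonempty[OF \<kappa>0] unfolding A by simp
  then have p: "p \<in> A"
    unfolding p_def by (simp add: some_in_eq)
  have b: "lattice_basis (direction A) b"
    unfolding b_def using c0.lattice_basis_diff unfolding dir0
    by (rule someI[where P = "lattice_basis (M \<kappa>0 ` c0.zero_sum)"])
  let ?P = "Pi\<^sub>M {..<k} (\<lambda>_. lborel :: real measure)"
  define \<phi> where "\<phi> y = p + (\<Sum>i<k. y i *\<^sub>R b i)" for y :: "nat \<Rightarrow> real"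
  define pre where "pre T = {y \<in> {..<k} \<rightarrow>\<^sub>E UNIV. \<phi> y \<in> T}" for T
  have \<phi>_A: "\<phi> y \<in> A" for y
  proof -
    have "(\<Sum>i<k. y i *\<^sub>R b i) \<in> span (b ` {..<k})"
      by (intro span_sum span_scale span_base) simp
    then have "(\<Sum>i<k. y i *\<^sub>R b i) \<in> direction A"
      using b by (simp add: lattice_basis_def dim)
    then obtain u v where uv: "(\<Sum>i<k. y i *\<^sub>R b i) = u - v" "u \<in> A" "v \<in> A"
      by (auto simp: direction_def)
    have "affine A" unfolding A by simp
    from mem_affine_3[OF this p uv(2,3), of 1 1 "-1"] show ?thesis
      by (simp add: \<phi>_def uv(1) algebra_simps)
  qed
  \<comment> \<open>Turns a point of \<open>A\<close> off a flat into the parameter value that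
    \<open>null_sets_PiM_affine_preimage\<close> asks for.\<close>
  have surj: "\<exists>y. f = \<phi> y" if "f \<in> A" for f
  proof -
    have "f - p \<in> direction A"
      using that p by (auto simp: direction_def)
    then have "f - p \<in> span (b ` {..<k})" and inj: "inj_on b {..<k}"
      using b by (simp_all add: lattice_basis_def dim)
    then obtain u where "f - p = (\<Sum>v\<in>b ` {..<k}. u v *\<^sub>R v)"
      by (auto simp: span_finite)
    then have "f = \<phi> (\<lambda>i. u (b i))"
      by (simp add: \<phi>_def sum.reindex[OF inj] algebra_simps)
    then show ?thesis by (rule exI[where P = "\<lambda>y. f = \<phi> y"])
  qed
  have \<phi>_meas: "\<phi> \<in> ?P \<rightarrow>\<^sub>M borel"
    unfolding \<phi>_def by measurable
  have pre_sets: "pre T \<in> sets ?P" if "T \<in> sets borel" for T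
    using measurable_sets[OF \<phi>_meas that] by (simp add: pre_def vimage_def Int_def space_PiM conj_commute)
  have null: "pre T \<in> null_sets ?P" if T: "affine T" "\<not> A \<subseteq> T" for T
  proof -
    obtain f where "f \<in> A" "f \<notin> T" using T(2) by blast
    then obtain y where "\<phi> y \<notin> T" using surj by blast
    then show ?thesis
      unfolding pre_def \<phi>_def using null_sets_PiM_affine_preimage[OF c0.k(2) T(1)] by blast
  qed
  \<comment> \<open>Everything that could spoil a disjoint decomposition: the flats
    \<open>F\<close>, the hulls other than \<open>A\<close> of cells, and the hulls of the facets of
    the cells with hull \<open>A\<close>. None of them contains \<open>A\<close>.\<close>
  define B where "B = F \<union> {affine hull (gens \<kappa>) | \<kappa>. \<kappa> \<in> K - ?K} \<union>
    (\<Union>\<kappa>\<in>?K. (\<lambda>e. affine hull ((\<lambda>e. M \<kappa> (axis e 1)) ` (J \<kappa> - {e}))) ` J \<kappa>)"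
  have aff_A: "aff_dim A = int (dim W) - 1"
    by (simp add: A aff_dim_gens[OF \<kappa>0])
  have B: "affine T" "\<not> A \<subseteq> T" if T: "T \<in> B" for T
  proof -
    show "affine T"
      using T F(2) by (auto simp: B_def)
    consider "T \<in> F" | \<kappa> where "\<kappa> \<in> K" "T = affine hull (gens \<kappa>)" "T \<noteq> A"
      | \<kappa> e where "\<kappa> \<in> K" "e \<in> J \<kappa>" "T = affine hull ((\<lambda>e. M \<kappa> (axis e 1)) ` (J \<kappa> - {e}))"
      using T unfolding B_def by blast
    then show "\<not> A \<subseteq> T"
    proof cases
      case 1
      then show ?thesis
        using aff_dim_subset[of A T] F(3)[OF 1] aff_A by auto
    next
      case 2
      have "A = T" if "A \<subseteq> T"
        using that by (rule affine_dim_equal[rotated 3])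
          (use 2 \<open>A \<noteq> {}\<close> aff_A aff_dim_gens[OF 2(1)] in \<open>simp_all add: A\<close>)
      then show ?thesis using 2 by blast
    next
      case 3
      have "card (J \<kappa> - {e}) = dim W - 1"
        using 3 card_J[OF 3(1)] by simp
      then have "aff_dim T = int (dim W) - 2"
        using unimodular_cell.aff_dim_gen[OF cell[OF 3(1)], of "J \<kappa> - {e}"] dim_W unfolding 3(3) by simp
      then show ?thesis
        using aff_dim_subset[of A T] aff_A by auto
    qed
  qed
  define Z where "Z = (\<Union>T\<in>B. pre T)"
  have "finite B"
    unfolding B_def using F(1) finite_K by auto
  then have Z: "Z \<in> null_sets ?P"
    unfolding Z_def using B null by (intro null_sets_UN' countable_finite) auto
  have interior: "f \<in> M \<kappa> ` open_coord_cone (J \<kappa>)"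
    if "\<kappa> \<in> ?K" "f \<in> conv \<kappa>" "f \<notin> \<Union>B" for \<kappa> f
    using boundary_covered[of \<kappa> f] that unfolding B_def by blast
  have split: "pre S - Z = (\<Union>\<kappa>\<in>?K. pre (conv \<kappa>) - Z)"
  proof (intro equalityI subsetI)
    fix y assume y: "y \<in> pre S - Z"
    then have *: "y \<in> {..<k} \<rightarrow>\<^sub>E UNIV" "\<phi> y \<in> S" "\<phi> y \<notin> \<Union>B"
      by (auto simp: pre_def Z_def)
    have "\<phi> y \<notin> \<Union>F"
      using *(3) by (simp add: B_def)
    then have "\<phi> y \<in> (\<Union>\<kappa>\<in>K. conv \<kappa>)"
      using subsetD[OF S_upper *(2)] unfolding slice_eq by simp
    then obtain \<kappa> where \<kappa>: "\<kappa> \<in> K" "\<phi> y \<in> conv \<kappa>" by blast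
    moreover have "affine hull (gens \<kappa>) = A"
    proof (rule ccontr)
      assume "affine hull (gens \<kappa>) \<noteq> A"
      then have "affine hull (gens \<kappa>) \<in> B"
        using \<kappa>(1) by (auto simp: B_def)
      moreover have "\<phi> y \<in> affine hull (gens \<kappa>)"
        by (rule subsetD[OF simplex_subset_hull \<kappa>(2)])
      ultimately show False
        using *(3) by blast
    qed
    ultimately show "y \<in> (\<Union>\<kappa>\<in>?K. pre (conv \<kappa>) - Z)"
      using y *(1) by (auto simp: pre_def)
  next
    fix y assume "y \<in> (\<Union>\<kappa>\<in>?K. pre (conv \<kappa>) - Z)"
    then show "y \<in> pre S - Z"
      using simplex_subset by (auto simp: pre_def)
  qed
  have meas: "pre (conv \<kappa>) \<in> sets ?P" for \<kappa>
    by (intro pre_sets borel_compact compact_convex_hull finite_imp_compact) simp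
  have cell_measure: "measure ?P (pre (conv \<kappa>)) = 1 / fact k" if \<kappa>: "\<kappa> \<in> ?K"
    for \<kappa>
  proof -
    obtain a idx where "enumerated_cell (M \<kappa>) (J \<kappa>) a k idx"
      using enum \<kappa> by blast
    moreover have "p \<in> affine hull (gens \<kappa>)"
      using \<kappa> p by simp
    moreover have "lattice_basis (M \<kappa> ` unimodular_cell.zero_sum (J \<kappa>)) b"
      using b dirs[OF \<kappa>] by simp
    ultimately show ?thesis
      unfolding pre_def \<phi>_def by (rule enumerated_cell.measure_simplex)
  qed
  have "measure ?P (pre S) = measure ?P (pre S - Z)"
    using pre_sets[OF S_borel] Z by (simp add: measure_Diff_null_set)
  also have "\<dots> = (\<Sum>\<kappa>\<in>?K. measure ?P (pre (conv \<kappa>) - Z))"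
    unfolding split
  proof (rule measure_finite_Union)
    show "finite ?K" using finite_K by simp
    show "(\<lambda>\<kappa>. pre (conv \<kappa>) - Z) ` ?K \<subseteq> sets ?P"
      using meas Z by auto
    show "disjoint_family_on (\<lambda>\<kappa>. pre (conv \<kappa>) - Z) ?K"
      unfolding disjoint_family_on_def
    proof (intro ballI impI, rule ccontr)
      fix \<kappa> \<kappa>' assume \<kappa>: "\<kappa> \<in> ?K" "\<kappa>' \<in> ?K" "\<kappa> \<noteq> \<kappa>'"
        and "(pre (conv \<kappa>) - Z) \<inter> (pre (conv \<kappa>') - Z) \<noteq> {}"
      then obtain y where "\<phi> y \<in> conv \<kappa>" "\<phi> y \<in> conv \<kappa>'" "\<phi> y \<notin> \<Union>B"
        by (auto simp: pre_def Z_def)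
      then have "\<phi> y \<in> M \<kappa> ` open_coord_cone (J \<kappa>)" "\<phi> y \<in> M \<kappa>' ` open_coord_cone (J \<kappa>')"
        using interior \<kappa> by blast+
      moreover have "M \<kappa> ` open_coord_cone (J \<kappa>) \<inter> M \<kappa>' ` open_coord_cone (J \<kappa>') = {}"
        using fan \<kappa> by (simp add: unimodular_fan_def)
      ultimately show False by blast
    qed
    fix \<kappa> assume "\<kappa> \<in> ?K"
    \<comment> \<open>\<open>measure\<close> is 0 where \<open>emeasure\<close> is infinite, so a
      nonzero value shows finiteness.\<close>
    then have "measure ?P (pre (conv \<kappa>)) \<noteq> 0"
      using cell_measure by simp
    then have "emeasure ?P (pre (conv \<kappa>)) \<noteq> \<infinity>"
      by (auto simp: measure_def)
    then show "emeasure ?P (pre (conv \<kappa>) - Z) \<noteq> \<infinity>"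
      using meas Z by (simp add: emeasure_Diff_null_set)
  qed
  also have "\<dots> = (\<Sum>\<kappa>\<in>?K. 1 / fact k)"
    using meas Z cell_measure by (intro sum.cong) (simp_all add: measure_Diff_null_set)
  finally have "fact k * measure ?P (pre S) = card ?K"
    by simp
  then show ?thesis
    unfolding normalized_volume_in_def dim Let_def p_def[symmetric] b_def[symmetric]
    by (simp add: pre_def \<phi>_def)
qed

theorem normalized_volume_S: "normalized_volume S = card K"
proof -
  let ?h = "\<lambda>\<kappa>. affine hull (gens \<kappa>)"
  have "normalized_volume S = (\<Sum>A\<in>?h ` K. real (card {\<kappa> \<in> K. ?h \<kappa> = A}))"
    unfolding normalized_volume_def top_hulls_S using volume_in_hull by (intro sum.cong) auto
  also have "\<dots> = real (\<Sum>A\<in>?h ` K. \<Sum>\<kappa>\<in>{\<kappa> \<in> K. ?h \<kappa> = A}. 1)"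
    by simp
  also have "\<dots> = real (card K)"
    using sum.image_gen[OF finite_K, of "\<lambda>_. 1 :: nat" ?h] by simp
  finally show ?thesis .
qed

end


section \<open>Simple paths to a sink\<close>

text \<open>The walk changes colour at every vertex unless that would enter a loop. A first repeated vertex
  would close a simple cycle, which is monochromatic and hence passes only through vertices with
  loops, against the hypothesis on cycles.\<close>

lemma exists_simple_path_out:
  fixes t h :: "'e::finite \<Rightarrow> 'v" and col :: "'e \<Rightarrow> 'c"
  assumes deg: "\<And>v. v \<in> I \<Longrightarrow> card {e. t e = v} = 2" "\<And>v. v \<in> I \<Longrightarrow> card {e. h e = v} = 2"
    and col: "\<And>v. v \<in> I \<Longrightarrow> inj_on col {e. t e = v}"
    and cyc: "\<And>X. X \<noteq> {} \<Longrightarrow> inj_on t X \<Longrightarrow> inj_on h X \<Longrightarrow> t ` X = h ` X \<Longrightarrow>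
      \<exists>C\<subseteq>X. C \<noteq> {} \<and> t ` C = h ` C \<and> (\<forall>e\<in>C. \<forall>e'\<in>C. col e = col e') \<and>
        (\<forall>l. t l = h l \<and> t l \<in> t ` C \<longrightarrow> card C = 1)"
    and start: "t e0 \<in> I" "t e0 \<noteq> h e0"
  shows "\<exists>P. e0 \<in> P \<and> (\<forall>e\<in>P. t e = t e0 \<longrightarrow> e = e0) \<and> (\<forall>e\<in>P. h e \<noteq> t e0) \<and>
    (\<forall>v\<in>I. v \<noteq> t e0 \<longrightarrow> card {e \<in> P. t e = v} = card {e \<in> P. h e = v})"
proof -
  \<comment> \<open>Of the two edges leaving the head of \<open>e\<close>, some \<open>u\<close> has
    a colour other than that of \<open>e\<close>. If \<open>u\<close> is a loop, the other edge
    \<open>w\<close> is taken; it is no loop, as \<open>e\<close>, \<open>u\<close>,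
    \<open>w\<close> would be three incoming edges.\<close>
  have next_edge: "\<exists>e'. t e' = h e \<and> h e' \<noteq> h e \<and> (col e' = col e \<longrightarrow> (\<exists>l. t l = h e \<and> h l = h e))"
    if e: "h e \<in> I" "t e \<noteq> h e" for e
  proof -
    obtain x y where xy: "{e'. t e' = h e} = {x, y}" "x \<noteq> y"
      using deg(1)[OF e(1)] by (meson card_2_iff)
    then have "col x \<noteq> col y"
      using col[OF e(1)] by (auto simp: inj_on_def)
    moreover have "x \<in> {e'. t e' = h e}" "y \<in> {e'. t e' = h e}"
      unfolding xy by simp_all
    ultimately have "\<exists>u w. t u = h e \<and> t w = h e \<and> u \<noteq> w \<and> col u \<noteq> col e"
      using xy(2) by (cases "col x = col e") (metis mem_Collect_eq)+
    then obtain u w where uw: "t u = h e" "t w = h e" "u \<noteq> w" "col u \<noteq> col e"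
      by blast
    show ?thesis
    proof (cases "h u = h e")
      case True
      have "h w \<noteq> h e"
      proof
        assume "h w = h e"
        then have "{e, u, w} \<subseteq> {e'. h e' = h e}"
          using True by blast
        moreover have "card {e, u, w} = 3"
          using uw e(2) by (auto simp: card_insert_if)
        ultimately show False
          using card_mono[of "{e'. h e' = h e}" "{e, u, w}"] deg(2)[OF e(1)] by simp
      qed
      then show ?thesis
        using uw True by blast
    next
      case False
      then show ?thesis
        using uw by blast
    qed
  qed
  define nx where "nx e = (SOME e'. t e' = h e \<and> h e' \<noteq> h e \<and> (col e' = col e \<longrightarrow> (\<exists>l. t l = h e \<and> h l = h e)))" for e
  have nx: "t (nx e) = h e" "h (nx e) \<noteq> h e" "col (nx e) = col e \<Longrightarrow> \<exists>l. t l = h e \<and> h l = h e"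
    if "h e \<in> I" "t e \<noteq> h e" for e
    using someI_ex[OF next_edge[OF that]] unfolding nx_def by blast+
  define s where "s n = (nx ^^ n) e0" for n
  have s0: "s 0 = e0" and sSuc: "s (Suc n) = nx (s n)" for n
    by (simp_all add: s_def)
  have nonloop: "t (s n) \<noteq> h (s n)" if "\<And>m. m < n \<Longrightarrow> h (s m) \<in> I" for n
    using that
  proof (induction n)
    case 0
    then show ?case using start by (simp add: s0)
  next
    case (Suc n)
    then have "t (s n) \<noteq> h (s n)" "h (s n) \<in> I" by auto
    then show ?case
      using nx(1,2)[of "s n"] by (simp add: sSuc)
  qed
  have step: "t (s (Suc m)) = h (s m)" if "\<And>m. m < n \<Longrightarrow> h (s m) \<in> I" "m < n" for n m
    using nx(1)[of "s m"] nonloop[of m] that by (simp add: sSuc)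
  have simple: "inj_on (\<lambda>m. t (s m)) {..n}" if I: "\<And>m. m < n \<Longrightarrow> h (s m) \<in> I"
    for n
  proof (rule ccontr)
    assume "\<not> ?thesis"
    then have ex: "\<exists>j. j \<le> n \<and> (\<exists>i<j. t (s i) = t (s j))"
      unfolding inj_on_def by (metis atMost_iff linorder_neqE_nat)
    \<comment> \<open>At the earliest repetition the edges from \<open>s i\<close> to
      \<open>s (j - 1)\<close> have distinct tails and close up.\<close>
    define j where "j = (LEAST j. j \<le> n \<and> (\<exists>i<j. t (s i) = t (s j)))"
    have j: "j \<le> n" "\<exists>i<j. t (s i) = t (s j)"
      using LeastI_ex[OF ex] unfolding j_def by blast+
    have min: "\<not> (j' \<le> n \<and> (\<exists>i<j'. t (s i) = t (s j')))" if "j' < j" for j'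
      using that unfolding j_def by (rule not_less_Least)
    obtain i where i: "i < j" "t (s i) = t (s j)" using j(2) by blast
    have distinct: "t (s l) \<noteq> t (s l')" if "l < l'" "l' < j" for l l'
      using min[OF that(2)] that j(1) by auto
    have inj: "l = l'" if "l < j" "l' < j" "t (s l) = t (s l')" for l l'
      using distinct[of l l'] distinct[of l' l] that by (cases l l' rule: linorder_cases) auto
    have head: "h (s l) = t (s (Suc l))" if "l < j" for l
      using step[OF I, of n l] that j(1) by simp
    have loopfree: "t (s l) \<noteq> h (s l)" if "l < j" for l
      using nonloop[of l] I that j(1) by simp
    define X where "X = s ` {i..<j}"
    have "t ` X = h ` X"
    proof -
      have "h ` X = (\<lambda>l. t (s (Suc l))) ` {i..<j}"
        unfolding X_def image_image using head by (intro image_cong) auto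
      also have "\<dots> = (\<lambda>l. t (s l)) ` {Suc i..<Suc j}"
        by (simp add: image_Suc_atLeastLessThan[symmetric] image_image del: image_Suc_atLeastLessThan)
      also have "{Suc i..<Suc j} = insert j {Suc i..<j}"
        using i(1) by auto
      also have "(\<lambda>l. t (s l)) ` insert j {Suc i..<j} = (\<lambda>l. t (s l)) ` insert i {Suc i..<j}"
        using i(2) by simp
      also have "insert i {Suc i..<j} = {i..<j}"
        using i(1) by auto
      finally show ?thesis
        by (simp add: X_def image_image)
    qed
    moreover have "inj_on t X"
    proof (rule inj_onI)
      fix x y assume xy: "x \<in> X" "y \<in> X" "t x = t y"
      then obtain l l' where "x = s l" "y = s l'" "l < j" "l' < j"
        by (auto simp: X_def)
      then show "x = y"
        using inj[of l l'] xy(3) by simp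
    qed
    moreover have "inj_on h X"
      by (rule eq_card_imp_inj_on) (use \<open>t ` X = h ` X\<close> card_image[OF \<open>inj_on t X\<close>] in simp_all)
    moreover have "X \<noteq> {}"
      using i(1) by (simp add: X_def)
    ultimately have "\<exists>C\<subseteq>X. C \<noteq> {} \<and> t ` C = h ` C \<and> (\<forall>e\<in>C. \<forall>e'\<in>C. col e = col e') \<and>
        (\<forall>l. t l = h l \<and> t l \<in> t ` C \<longrightarrow> card C = 1)"
      by (intro cyc)
    then obtain C where C: "C \<subseteq> X" "C \<noteq> {}" "t ` C = h ` C" "\<forall>e\<in>C. \<forall>e'\<in>C. col e = col e'"
      "\<forall>l. t l = h l \<and> t l \<in> t ` C \<longrightarrow> card C = 1"
      by (elim exE conjE)
    \<comment> \<open>If \<open>C\<close> contained an earlier \<open>s l\<close>, it would contain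
      the next edge too, in the same colour. The walk keeps its colour only at a vertex with a loop,
      so \<open>C\<close> would be a single edge and \<open>s l\<close> a loop.\<close>
    have last: "l = j - 1" if l: "i \<le> l" "l < j" "s l \<in> C" for l
    proof (rule ccontr)
      assume "l \<noteq> j - 1"
      then have lj: "Suc l < j" using l(2) by simp
      have "t (s (Suc l)) \<in> t ` C"
        using C(3) l(3) head[OF l(2)] by (metis imageI)
      then obtain e where "e \<in> C" "t e = t (s (Suc l))" by auto
      moreover obtain l' where "e = s l'" "l' < j"
        using C(1) \<open>e \<in> C\<close> by (auto simp: X_def)
      ultimately have mem: "s (Suc l) \<in> C"
        using inj[of l' "Suc l"] lj by auto
      then have "col (nx (s l)) = col (s l)"
        using C(4)[rule_format, OF mem l(3)] by (simp add: sSuc)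
      then obtain z where "t z = h (s l)" "h z = h (s l)"
        using nx(3)[of "s l"] loopfree[OF l(2)] I[of l] l(2) j(1) by auto
      then have "card C = 1"
        using C(5)[rule_format, of z] \<open>t (s (Suc l)) \<in> t ` C\<close> head[OF l(2)] by simp
      then have "s (Suc l) = s l"
        using mem l(3) by (metis card_1_singletonE singletonD)
      then show False
        using head[OF l(2)] loopfree[OF l(2)] by simp
    qed
    \<comment> \<open>So the only edge of \<open>C\<close> is \<open>s (j - 1)\<close>. It ends at
      the tail of \<open>s i\<close>, which puts \<open>s i\<close> into \<open>C\<close>; then
      \<open>i = j - 1\<close> and \<open>s i\<close> is a loop, a contradiction.\<close>
    obtain x where x: "x \<in> C" using C(2) by blast
    then have "x \<in> s ` {i..<j}"
      using C(1) by (auto simp: X_def)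
    then obtain l where l: "i \<le> l" "l < j" "s l \<in> C"
      using x by auto
    have "h (s l) = t (s i)"
      using head[OF l(2)] last[OF l] l(2) i(2) by simp
    then have "t (s i) \<in> t ` C"
      using C(3) l(3) by (metis imageI)
    then obtain e where e: "e \<in> C" "t e = t (s i)" by auto
    then obtain l' where l': "e = s l'" "i \<le> l'" "l' < j"
      using C(1) by (auto simp: X_def)
    then have "i = j - 1"
      using inj[of l' i] e i(1) last[of l'] by auto
    then show False
      using loopfree[of i] head[of i] i by simp
  qed
  have ex: "\<exists>n. h (s n) \<notin> I"
  proof (rule ccontr)
    assume I: "\<nexists>n. h (s n) \<notin> I"
    have "inj s"
    proof (rule injI)
      fix m n assume "s m = s n"
      then show "m = n"
        using simple[of "max m n"] I by (auto simp: inj_on_def)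
    qed
    then show False
      using finite_imageD[of s UNIV] by auto
  qed
  define n where "n = (LEAST n. h (s n) \<notin> I)"
  have n: "h (s n) \<notin> I" "\<And>m. m < n \<Longrightarrow> h (s m) \<in> I"
    using LeastI_ex[OF ex] not_less_Least[of _ "\<lambda>n. h (s n) \<notin> I"] unfolding n_def by blast+
  have inj: "m = m'" if "m \<le> n" "m' \<le> n" "t (s m) = t (s m')" for m m'
    using simple[OF n(2)] that by (auto simp: inj_on_def)
  have head: "h (s m) = t (s (Suc m))" if "m < n" for m
    using step[OF n(2) that] by simp
  let ?P = "s ` {..n}"
  have only: "e = e0" if "e \<in> ?P" "t e = t e0" for e
  proof -
    obtain m where m: "e = s m" "m \<le> n" using \<open>e \<in> ?P\<close> by auto
    then have "m = 0"
      using inj[of m 0] that(2) by (simp add: s0)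
    then show ?thesis using m by (simp add: s0)
  qed
  have no_return: "h e \<noteq> t e0" if "e \<in> ?P" for e
  proof -
    obtain m where m: "e = s m" "m \<le> n" using \<open>e \<in> ?P\<close> by auto
    show ?thesis
    proof (cases "m = n")
      case True
      then show ?thesis using m n(1) start(1) by auto
    next
      case False
      then show ?thesis
        using m inj[of "Suc m" 0] head[of m] by (auto simp: s0)
    qed
  qed
  have balanced: "card {e \<in> ?P. t e = v} = card {e \<in> ?P. h e = v}" if v: "v \<in> I" "v \<noteq> t e0"
    for v
  proof -
    \<comment> \<open>Each path edge entering \<open>v\<close> is paired with its successor; the
      path neither starts nor ends at \<open>v\<close>.\<close>
    have "bij_betw nx {e \<in> ?P. h e = v} {e \<in> ?P. t e = v}"
      unfolding bij_betw_def
    proof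
      have lt: "m < n" if "m \<le> n" "h (s m) = v" for m
        using that n(1) v(1) by (metis le_neq_implies_less)
      show "inj_on nx {e \<in> ?P. h e = v}"
      proof (rule inj_onI)
        fix e e' assume e: "e \<in> {e \<in> ?P. h e = v}" "e' \<in> {e \<in> ?P. h e = v}" "nx e = nx e'"
        then obtain m m' where m: "e = s m" "m < n" "e' = s m'" "m' < n"
          using lt by blast
        then have "t (s (Suc m)) = t (s (Suc m'))"
          using e(3) by (simp add: sSuc)
        then show "e = e'"
          using inj[of "Suc m" "Suc m'"] m by simp
      qed
      show "nx ` {e \<in> ?P. h e = v} = {e \<in> ?P. t e = v}"
      proof (intro equalityI subsetI)
        fix e' assume "e' \<in> nx ` {e \<in> ?P. h e = v}"
        then obtain m where "e' = nx (s m)" "m \<le> n" "h (s m) = v" by blast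
        then show "e' \<in> {e \<in> ?P. t e = v}"
          using lt[of m] head[of m] sSuc[of m] by (auto intro!: image_eqI[of _ s "Suc m"])
      next
        fix e' assume "e' \<in> {e \<in> ?P. t e = v}"
        then obtain m where m: "e' = s m" "m \<le> n" "t (s m) = v" by blast
        then obtain m' where "m = Suc m'"
          using v(2) by (cases m) (auto simp: s0)
        then show "e' \<in> nx ` {e \<in> ?P. h e = v}"
          using m head[of m'] by (auto simp: sSuc intro!: image_eqI[of _ nx "s m'"])
      qed
    qed
    then show ?thesis
      by (simp add: bij_betw_same_card)
  qed
  have "e0 \<in> ?P"
    using s0 by force
  show ?thesis
    by (intro exI[of _ ?P] conjI ballI impI) (fact, erule (1) only, erule no_return, erule (1) balanced)
qed


section \<open>Minimal cycles of a framed graph\<close>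

locale framed_digraph =
  fixes H :: "('v, 'e::finite) pre_digraph" and col :: "'e \<Rightarrow> colour"
  assumes arcs: "arcs H = UNIV" and full: "full_digraph H"
    and framing: "cyclic_ample_framing H col" and loops: "loops_avoid_longer_cycles H"
begin

abbreviation "t \<equiv> tail H"
abbreviation "h \<equiv> head H"
abbreviation "I \<equiv> internal_verts H"
abbreviation "Cycles \<equiv> minimal_cycles H"

lemma fin: "fin_digraph H"
  using full by (simp add: full_digraph_def)

lemma verts: "t e \<in> verts H" "h e \<in> verts H" "finite (verts H)"
proof -
  interpret fin_digraph H by (rule fin)
  show "t e \<in> verts H" "h e \<in> verts H" "finite (verts H)"
    using arcs by (auto intro: wellformed)
qed

lemma out_arcs_eq: "out_arcs H v = {e. t e = v}" and in_arcs_eq: "in_arcs H v = {e. h e = v}"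
  using arcs by (auto simp: out_arcs_def in_arcs_def)

lemma sources_iff: "v \<in> sources H \<longleftrightarrow> v \<in> verts H \<and> (\<forall>e. h e \<noteq> v)"
  by (auto simp: sources_def in_degree_def in_arcs_eq)

lemma sinks_iff: "v \<in> sinks H \<longleftrightarrow> v \<in> verts H \<and> (\<forall>e. t e \<noteq> v)"
  by (auto simp: sinks_def out_degree_def out_arcs_eq)

lemma internal_iff: "v \<in> I \<longleftrightarrow> (\<exists>e. h e = v) \<and> (\<exists>e. t e = v)"
  using verts by (auto simp: internal_verts_def sources_iff sinks_iff)

lemma tail_internal: "t e \<in> I \<longleftrightarrow> t e \<notin> sources H"
  using verts by (auto simp: internal_iff sources_iff)

lemma card_out: "v \<in> I \<Longrightarrow> card {e. t e = v} = 2" and card_in: "v \<in> I \<Longrightarrow> card {e. h e = v} = 2"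
  using full by (auto simp: full_digraph_def in_degree_def out_degree_def out_arcs_eq in_arcs_eq)

lemma inj_col_out: "v \<in> I \<Longrightarrow> inj_on col {e. t e = v}" and inj_col_in: "v \<in> I \<Longrightarrow> inj_on col {e. h e = v}"
  using framing by (auto simp: cyclic_ample_framing_def out_arcs_eq in_arcs_eq)

lemma finite_I: "finite I"
  using verts(3) by (simp add: internal_verts_def)

section \<open>Closed walks and directed cycles as edge sets\<close>

lemma cas_ends_in:
  "pre_digraph.cas H u p w \<Longrightarrow> p \<noteq> [] \<Longrightarrow> (\<exists>e\<in>set p. t e = u) \<and> (\<exists>e\<in>set p. h e = w)"
proof (induction p arbitrary: u)
  case Nil
  then show ?case by simp
next
  case (Cons e p)
  then show ?case
    by (cases "p = []") (auto simp: pre_digraph.cas.simps)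
qed

lemma cas_next:
  "pre_digraph.cas H u p w \<Longrightarrow> e \<in> set p \<Longrightarrow>
    (h e = w \<or> (\<exists>e'\<in>set p. t e' = h e)) \<and> (t e = u \<or> (\<exists>e'\<in>set p. h e' = t e))"
proof (induction p arbitrary: u)
  case Nil
  then show ?case by simp
next
  case (Cons x p)
  have cas: "t x = u" "pre_digraph.cas H (h x) p w"
    using Cons.prems(1) by (simp_all add: pre_digraph.cas.simps)
  show ?case
  proof (cases "e = x")
    case True
    show ?thesis
    proof (cases "p = []")
      case True
      then show ?thesis
        using cas \<open>e = x\<close> by (simp add: pre_digraph.cas.simps)
    next
      case False
      then show ?thesis
        using cas \<open>e = x\<close> cas_ends_in[OF cas(2) False] by auto
    qed
  next
    case False
    then have "e \<in> set p" using Cons.prems(2) by simp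
    from Cons.IH[OF cas(2) this] show ?thesis by auto
  qed
qed

lemma cycle_next:
  assumes C: "C \<in> directed_cycles H" and e: "e \<in> C"
  shows "\<exists>e'\<in>C. t e' = h e" "\<exists>e'\<in>C. h e' = t e"
proof -
  obtain p u where p: "C = set p" "p \<noteq> []" "pre_digraph.awalk H u p u"
    using C by (auto simp: directed_cycles_def)
  then have cas: "pre_digraph.cas H u p u"
    by (simp add: pre_digraph.awalk_def)
  show "\<exists>e'\<in>C. t e' = h e" "\<exists>e'\<in>C. h e' = t e"
    using cas_next[OF cas, of e] cas_ends_in[OF cas p(2)] e p(1) by auto
qed

lemma trancl_walk:
  assumes "(u, w) \<in> {(t e, h e) | e. e \<in> X}\<^sup>+"
  shows "\<exists>p. p \<noteq> [] \<and> pre_digraph.cas H u p w \<and> set p \<subseteq> X \<and> u \<in> verts H"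
  using assms
proof (induction rule: converse_trancl_induct)
  case (base u)
  then obtain e where "e \<in> X" "u = t e" "w = h e" by auto
  then show ?case
    using verts by (intro exI[of _ "[e]"]) (simp add: pre_digraph.cas.simps)
next
  case (step u v)
  obtain e where "e \<in> X" "u = t e" "v = h e" using step.hyps(1) by auto
  moreover obtain p where "p \<noteq> []" "pre_digraph.cas H v p w" "set p \<subseteq> X"
    using step.IH by auto
  ultimately show ?case
    using verts by (intro exI[of _ "e # p"]) (simp add: pre_digraph.cas.simps)
qed

lemma directed_cycle_contains_minimal:
  "D \<in> directed_cycles H \<Longrightarrow> \<exists>C\<in>Cycles. C \<subseteq> D"
proof (induction "card D" arbitrary: D rule: less_induct)
  case less
  show ?case
  proof (cases "D \<in> Cycles")
    case False
    then obtain D' where D': "D' \<in> directed_cycles H" "D' \<subset> D"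
      using less.prems by (auto simp: minimal_cycles_def)
    then have "card D' < card D"
      by (simp add: psubset_card_mono)
    then obtain C where "C \<in> Cycles" "C \<subseteq> D'"
      using less.hyps[OF _ D'(1)] by blast
    then show ?thesis using D'(2) by blast
  qed blast
qed

lemma cycle_in_cyclic_set:
  assumes "\<not> acyclic {(t e, h e) | e. e \<in> X}"
  shows "\<exists>C\<in>Cycles. C \<subseteq> X"
proof -
  obtain u where "(u, u) \<in> {(t e, h e) | e. e \<in> X}\<^sup>+"
    using assms by (auto simp: acyclic_def)
  then obtain p where p: "p \<noteq> []" "pre_digraph.cas H u p u" "set p \<subseteq> X" "u \<in> verts H"
    using trancl_walk by blast
  then have "pre_digraph.awalk H u p u"
    using arcs by (simp add: pre_digraph.awalk_def)
  then have "set p \<in> directed_cycles H"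
    using p(1) by (auto simp: directed_cycles_def)
  from directed_cycle_contains_minimal[OF this] show ?thesis
    using p(3) by (meson subset_trans)
qed

text \<open>If \<open>X\<close> were acyclic, some head of an edge in \<open>X\<close> would have no
  successor along \<open>X\<close>.\<close>

lemma cycle_in_closed_set:
  assumes "X \<noteq> {}" "\<And>e. e \<in> X \<Longrightarrow> \<exists>e'\<in>X. t e' = h e"
  shows "\<exists>C\<in>Cycles. C \<subseteq> X"
proof (rule cycle_in_cyclic_set, rule notI)
  let ?R = "{(t e, h e) | e. e \<in> X}"
  assume "acyclic ?R"
  moreover have "finite ?R"
    by (rule finite_subset[of _ "(\<lambda>e. (t e, h e)) ` UNIV"]) auto
  ultimately have "wf (?R\<inverse>)"
    by (rule finite_acyclic_wf_converse[rotated])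
  obtain x where "x \<in> X" using assms(1) by blast
  then have "h x \<in> h ` X" by blast
  then have "\<exists>z\<in>h ` X. \<forall>y. (y, z) \<in> ?R\<inverse> \<longrightarrow> y \<notin> h ` X"
    using \<open>wf (?R\<inverse>)\<close> unfolding wf_eq_minimal by (elim allE impE)
  then obtain z where z: "z \<in> h ` X" "\<And>y. (y, z) \<in> ?R\<inverse> \<Longrightarrow> y \<notin> h ` X"
    by blast
  then obtain e where e: "e \<in> X" "z = h e" by blast
  obtain e' where e': "e' \<in> X" "t e' = h e" using assms(2)[OF e(1)] by blast
  then have "(h e', z) \<in> ?R\<inverse>"
    using e(2) by (auto intro!: exI[of _ e'])
  then show False
    using z(2) e'(1) by blast
qed

section \<open>Structure of the minimal cycles\<close>

lemma Cycles_directed: "C \<in> Cycles \<Longrightarrow> C \<in> directed_cycles H"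
  by (simp add: minimal_cycles_def)

lemma cycle_nonempty: "C \<in> Cycles \<Longrightarrow> C \<noteq> {}"
  by (auto simp: minimal_cycles_def directed_cycles_def)

lemma cycle_col: "C \<in> Cycles \<Longrightarrow> e \<in> C \<Longrightarrow> e' \<in> C \<Longrightarrow> col e = col e'"
  using framing unfolding cyclic_ample_framing_def by blast

lemma cycle_internal: "C \<in> Cycles \<Longrightarrow> e \<in> C \<Longrightarrow> t e \<in> I" "C \<in> Cycles \<Longrightarrow> e \<in> C \<Longrightarrow> h e \<in> I"
  using cycle_next[OF Cycles_directed, of C e] by (auto simp: internal_iff)

text \<open>A minimal cycle has one colour, and the framing separates edges with the same tail by
  colour.\<close>

lemma cycle_inj_tail: "C \<in> Cycles \<Longrightarrow> e \<in> C \<Longrightarrow> e' \<in> C \<Longrightarrow> t e = t e' \<Longrightarrow> e = e'"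
  using inj_onD[OF inj_col_out[OF cycle_internal(1)[of C e]], of e e'] cycle_col[of C e e'] by simp

lemma cycle_inj_head: "C \<in> Cycles \<Longrightarrow> e \<in> C \<Longrightarrow> e' \<in> C \<Longrightarrow> h e = h e' \<Longrightarrow> e = e'"
  using inj_onD[OF inj_col_in[OF cycle_internal(2)[of C e]], of e e'] cycle_col[of C e e'] by simp

lemma cycle_tails_heads: "C \<in> Cycles \<Longrightarrow> t ` C = h ` C"
proof -
  assume C: "C \<in> Cycles"
  have "t e \<in> h ` C" "h e \<in> t ` C" if "e \<in> C" for e
    using cycle_next[OF Cycles_directed[OF C] that] by force+
  then show ?thesis by auto
qed

lemma cycle_subset_eq:
  assumes "B \<in> Cycles" "C \<in> Cycles" "B \<subseteq> C"
  shows "B = C"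
proof (rule ccontr)
  assume "B \<noteq> C"
  then have "B \<subset> C" using assms(3) by (rule psubsetI[rotated])
  moreover have "\<forall>D\<in>directed_cycles H. \<not> D \<subset> C"
    using assms(2) by (simp add: minimal_cycles_def)
  ultimately show False
    using Cycles_directed[OF assms(1)] by simp
qed

text \<open>The successors of a shared edge in both cycles have its colour and the same tail, so
  they coincide. The intersection is thus closed under successors and contains a minimal cycle,
  which equals both.\<close>

lemma cycles_disjoint:
  assumes C: "C \<in> Cycles" and D: "D \<in> Cycles" and e: "e \<in> C" "e \<in> D"
  shows "C = D"
proof -
  have "\<exists>e'\<in>C \<inter> D. t e' = h e" if e: "e \<in> C \<inter> D" for e
  proof -
    obtain c where c: "c \<in> C" "t c = h e"
      using cycle_next(1)[OF Cycles_directed[OF C], of e] e by blast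
    obtain d where d: "d \<in> D" "t d = h e"
      using cycle_next(1)[OF Cycles_directed[OF D], of e] e by blast
    have "col c = col d"
      using cycle_col[OF C c(1), of e] cycle_col[OF D d(1), of e] e by simp
    then have "c = d"
      using inj_onD[OF inj_col_out[OF cycle_internal(1)[OF C c(1)]], of c d] c d by simp
    then show ?thesis using c d by blast
  qed
  then obtain B where "B \<in> Cycles" "B \<subseteq> C \<inter> D"
    using cycle_in_closed_set[of "C \<inter> D"] e by blast
  then have "B = C" "B = D"
    using cycle_subset_eq C D by simp_all
  then show ?thesis by simp
qed

lemma loop_on_cycle: "t l = h l \<Longrightarrow> C \<in> Cycles \<Longrightarrow> t l \<in> t ` C \<Longrightarrow> card C = 1"
  using loops arcs unfolding loops_avoid_longer_cycles_def by blast

lemma card_cycle_1: "C \<in> Cycles \<Longrightarrow> card C = 1 \<Longrightarrow> e \<in> C \<Longrightarrow> C = {e} \<and> t e = h e"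
proof -
  assume C: "C \<in> Cycles" "card C = 1" "e \<in> C"
  then have "C = {e}" by (metis card_1_singletonE singletonD)
  then show ?thesis
    using cycle_next(1)[OF Cycles_directed[OF C(1)] C(3)] by auto
qed

text \<open>Supplies the cycle hypothesis of \<open>exists_simple_path_out\<close>. It is phrased
  through \<open>t\<close> and \<open>h\<close> alone so that it also serves the reversed
  graph.\<close>

lemma cycle_in_balanced_set:
  assumes "X \<noteq> {}" "t ` X = h ` X"
  shows "\<exists>C\<subseteq>X. C \<noteq> {} \<and> t ` C = h ` C \<and> (\<forall>e\<in>C. \<forall>e'\<in>C. col e = col e') \<and>
        (\<forall>l. t l = h l \<and> t l \<in> t ` C \<longrightarrow> card C = 1)"
proof -
  have "\<exists>e'\<in>X. t e' = h e" if "e \<in> X" for e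
  proof -
    have "h e \<in> t ` X" using that assms(2) by blast
    then show ?thesis by auto
  qed
  then obtain C where C: "C \<in> Cycles" "C \<subseteq> X"
    using cycle_in_closed_set[OF assms(1)] by blast
  have "\<forall>e\<in>C. \<forall>e'\<in>C. col e = col e'"
    by (intro ballI cycle_col[OF C(1)])
  moreover have "\<forall>l. t l = h l \<and> t l \<in> t ` C \<longrightarrow> card C = 1"
    by (intro allI impI, elim conjE, rule loop_on_cycle[OF _ C(1)])
  ultimately show ?thesis
    by (intro exI[of _ C] conjI C(2) cycle_nonempty[OF C(1)] cycle_tails_heads[OF C(1)])
qed

definition flow_space :: "(real ^ 'e) set" where
  "flow_space = {f. \<forall>v\<in>I. netflow H (($) f) v = 0}"

lemma netflow_eq: "netflow H f v = (\<Sum>e | t e = v. f e) - (\<Sum>e | h e = v. f e)"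
  by (simp add: netflow_def out_arcs_eq in_arcs_eq)

text \<open>The flow runs from a source along a simple path ending with \<open>x\<close>, leaves the cycle, and runs
  along a simple path to a sink; neither path returns to the vertex, so \<open>y\<close> carries no flow.\<close>

lemma consecutive_edges_independent:
  assumes C: "C \<in> Cycles" and xy: "x \<in> C" "y \<in> C" "h x = t y" "x \<noteq> y"
  shows "\<exists>f\<in>flow_space. f $ x \<noteq> f $ y"
proof -
  define v where "v = t y"
  have v: "v \<in> I" "h x = v" "t y = v"
    using cycle_internal(1)[OF C xy(2)] xy(3) by (auto simp: v_def)
  have "card C \<noteq> 1"
    using xy by (metis card_1_singletonE singletonD)
  then have noloop: "t l \<noteq> h l" if "t l = v" for l
    using loop_on_cycle[OF _ C, of l] that xy(2) v(3) by (metis imageI)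
  have tx: "t x \<noteq> v"
  proof
    assume "t x = v"
    then show False
      using cycle_inj_tail[OF C xy(1,2)] xy(4) v(3) by simp
  qed
  obtain z where z: "t z = v" "z \<noteq> y"
  proof -
    have "card ({e. t e = v} - {y}) = 1"
      using card_out[OF v(1)] v(3) by simp
    then obtain z where "{e. t e = v} - {y} = {z}"
      by (meson card_1_singletonE)
    then have "z \<in> {e. t e = v} - {y}" by simp
    then show ?thesis by (intro that[of z]) simp_all
  qed
  have "\<exists>P. z \<in> P \<and> (\<forall>e\<in>P. t e = t z \<longrightarrow> e = z) \<and> (\<forall>e\<in>P. h e \<noteq> t z) \<and>
    (\<forall>u\<in>I. u \<noteq> t z \<longrightarrow> card {e \<in> P. t e = u} = card {e \<in> P. h e = u})"
    by (rule exists_simple_path_out[where col = col, OF card_out card_in inj_col_out cycle_in_balanced_set])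
      (use z v noloop[of z] in auto)
  then obtain P where P: "z \<in> P" "\<And>e. e \<in> P \<Longrightarrow> t e = v \<Longrightarrow> e = z" "\<And>e. e \<in> P \<Longrightarrow> h e \<noteq> v"
    "\<And>u. u \<in> I \<Longrightarrow> u \<noteq> v \<Longrightarrow> card {e \<in> P. t e = u} = card {e \<in> P. h e = u}"
    unfolding z(1) by blast
  have bal: "\<exists>C\<subseteq>X. C \<noteq> {} \<and> h ` C = t ` C \<and> (\<forall>e\<in>C. \<forall>e'\<in>C. col e = col e') \<and>
        (\<forall>l. h l = t l \<and> h l \<in> h ` C \<longrightarrow> card C = 1)" if X: "X \<noteq> {}" "h ` X = t ` X" for X
  proof -
    obtain C where C: "C \<subseteq> X" "C \<noteq> {}" "t ` C = h ` C" "\<forall>e\<in>C. \<forall>e'\<in>C. col e = col e'"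
      "\<forall>l. t l = h l \<and> t l \<in> t ` C \<longrightarrow> card C = 1"
      using cycle_in_balanced_set[OF X(1) X(2)[symmetric]] by (elim exE conjE)
    have "\<forall>l. h l = t l \<and> h l \<in> h ` C \<longrightarrow> card C = 1"
      using C(5) unfolding C(3) by (metis (no_types))
    then show ?thesis
      by (intro exI[of _ C] conjI C(1,2,4) C(3)[symmetric])
  qed
  \<comment> \<open>The path lemma in the reversed graph gives a path that ends with
    \<open>x\<close>.\<close>
  have "\<exists>Q. x \<in> Q \<and> (\<forall>e\<in>Q. h e = h x \<longrightarrow> e = x) \<and> (\<forall>e\<in>Q. t e \<noteq> h x) \<and>
    (\<forall>u\<in>I. u \<noteq> h x \<longrightarrow> card {e \<in> Q. h e = u} = card {e \<in> Q. t e = u})"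
    by (rule exists_simple_path_out[where col = col and t = h and h = t, OF card_in card_out inj_col_in bal])
      (use v tx in auto)
  then obtain Q where Q: "x \<in> Q" "\<And>e. e \<in> Q \<Longrightarrow> h e = v \<Longrightarrow> e = x" "\<And>e. e \<in> Q \<Longrightarrow> t e \<noteq> v"
    "\<And>u. u \<in> I \<Longrightarrow> u \<noteq> v \<Longrightarrow> card {e \<in> Q. h e = u} = card {e \<in> Q. t e = u}"
    unfolding v(2) by blast
  \<comment> \<open>A sum of two indicator functions, because \<open>P\<close> and \<open>Q\<close>
    may share edges.\<close>
  define f :: "real ^ 'e" where "f = (\<chi> e. of_bool (e \<in> P) + of_bool (e \<in> Q))"
  have sum_f: "(\<Sum>e\<in>A. f $ e) = real (card (P \<inter> A)) + real (card (Q \<inter> A))" for A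
    by (simp add: f_def sum.distrib of_bool_def sum.If_cases Int_commute)
  have Int: "P \<inter> {e. g e = u} = {e \<in> P. g e = u}" for P :: "'e set" and g and u :: 'v
    by auto
  have "netflow H (($) f) u = 0" if u: "u \<in> I" for u
  proof (cases "u = v")
    case True
    \<comment> \<open>At \<open>v\<close> one unit enters along \<open>x\<close> and one leaves
      along \<open>z\<close>, and nothing else.\<close>
    have eqs: "{e \<in> P. t e = v} = {z}" "{e \<in> Q. t e = v} = {}" "{e \<in> P. h e = v} = {}" "{e \<in> Q. h e = v} = {x}"
      using P(1-3) Q(1-3) z(1) v(2) by blast+
    show ?thesis
      by (simp only: netflow_eq sum_f Int True eqs) simp
  next
    case False
    then show ?thesis
      using P(4)[OF u] Q(4)[OF u] by (simp add: netflow_eq sum_f Int)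
  qed
  then have "f \<in> flow_space"
    by (simp add: flow_space_def)
  moreover have "f $ y = 0"
    using P(2)[of y] Q(3)[of y] v(3) z(2) by (auto simp: f_def)
  moreover have "f $ x \<noteq> 0"
    using Q(1) by (auto simp: f_def)
  ultimately show ?thesis by (intro bexI[of _ f]) simp_all
qed

end


section \<open>Cutting one edge of every cycle\<close>

context framed_digraph
begin

abbreviation "U \<equiv> \<Union>Cycles"

definition cyc :: "'e \<Rightarrow> 'e set" where
  "cyc e = (THE C. C \<in> Cycles \<and> e \<in> C)"

lemma cyc_eq: "C \<in> Cycles \<Longrightarrow> e \<in> C \<Longrightarrow> cyc e = C"
  unfolding cyc_def using cycles_disjoint by (intro the_equality conjI) blast+

lemma cyc_U: "e \<in> U \<Longrightarrow> cyc e \<in> Cycles" "e \<in> U \<Longrightarrow> e \<in> cyc e"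
  using cyc_eq by auto

text \<open>The transversals of the minimal cycles.\<close>

definition choice :: "'e set \<Rightarrow> bool" where
  "choice Z \<longleftrightarrow> Z \<subseteq> U \<and> (\<forall>C\<in>Cycles. \<exists>!z. z \<in> Z \<and> z \<in> C)"

definition rep :: "'e set \<Rightarrow> 'e \<Rightarrow> 'e" where
  "rep Z e = (THE z. z \<in> Z \<and> z \<in> cyc e)"

lemma choice_U: "choice Z \<Longrightarrow> z \<in> Z \<Longrightarrow> z \<in> U"
  by (auto simp: choice_def)

lemma rep:
  assumes Z: "choice Z" and C: "C \<in> Cycles" "e \<in> C"
  shows "rep Z e \<in> Z" "rep Z e \<in> C"
proof -
  have "\<exists>!z. z \<in> Z \<and> z \<in> C"
    using Z C(1) by (simp add: choice_def)
  from theI'[OF this] show "rep Z e \<in> Z" "rep Z e \<in> C"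
    by (simp_all add: rep_def cyc_eq[OF C])
qed

lemma choice_unique:
  assumes Z: "choice Z" and C: "C \<in> Cycles" "z \<in> C" "z' \<in> C" "z \<in> Z" "z' \<in> Z"
  shows "z = z'"
proof -
  have "\<exists>!z. z \<in> Z \<and> z \<in> C"
    using Z C(1) by (simp add: choice_def)
  then show ?thesis using C by (elim ex1E) metis
qed

lemma rep_eq: "choice Z \<Longrightarrow> C \<in> Cycles \<Longrightarrow> e \<in> C \<Longrightarrow> z \<in> C \<Longrightarrow> z \<in> Z \<Longrightarrow> rep Z e = z"
  by (rule choice_unique[of Z C]) (simp_all add: rep)

lemma rep_Z: "choice Z \<Longrightarrow> z \<in> Z \<Longrightarrow> rep Z z = z"
  using rep_eq[of Z "cyc z" z z] cyc_U choice_U by simp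

lemma rep_U: "choice Z \<Longrightarrow> e \<in> U \<Longrightarrow> rep Z e \<in> Z" "choice Z \<Longrightarrow> e \<in> U \<Longrightarrow> rep Z e \<in> cyc e"
  using rep[of Z "cyc e" e] cyc_U by simp_all

text \<open>Undoes the subtraction of the cycle minima: the coordinate of a cut edge becomes a
  circulation around its cycle, and the other coordinates are the excess over it.\<close>

definition lift :: "'e set \<Rightarrow> real ^ 'e \<Rightarrow> real ^ 'e" where
  "lift Z f = (\<chi> e. (if e \<in> Z then 0 else f $ e) + (if e \<in> U then f $ rep Z e else 0))"

lemma lift_nth: "lift Z f $ e = (if e \<in> Z then 0 else f $ e) + (if e \<in> U then f $ rep Z e else 0)"
  by (simp add: lift_def)

lemma lift_Z: "choice Z \<Longrightarrow> z \<in> Z \<Longrightarrow> lift Z f $ z = f $ z"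
  using rep_Z choice_U by (simp add: lift_nth)

text \<open>Only coordinates of cut edges are added, and only to uncut edges, so the same amounts
  can be subtracted again.\<close>

lemma unimodular_lift:
  assumes Z: "choice Z"
  shows "unimodular (lift Z)"
proof (rule unimodularI)
  show "linear (lift Z)"
    by (rule linearI) (auto simp: vec_eq_iff lift_nth algebra_simps)
  let ?L = "\<lambda>f :: real ^ 'e. \<chi> e. if e \<in> Z then f $ e else f $ e - (if e \<in> U then f $ rep Z e else 0)"
  show "lift Z (?L f) = f" for f
  proof (rule iffD2[OF vec_eq_iff], rule allI)
    fix e
    show "lift Z (?L f) $ e = f $ e"
      using rep_U(1)[OF Z, of e] rep_Z[OF Z, of e] choice_U[OF Z, of e]
      by (cases "e \<in> U") (auto simp add: lift_nth simp del: Union_iff)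
  qed
  show "?L (lift Z f) = f" for f
  proof (rule iffD2[OF vec_eq_iff], rule allI)
    fix e
    show "?L (lift Z f) $ e = f $ e"
      using lift_Z[OF Z, of e f] lift_Z[OF Z rep_U(1)[OF Z, of e], of f]
      by (cases "e \<in> Z") (auto simp add: lift_nth simp del: Union_iff)
  qed
qed (auto simp: integer_lattice_def lift_nth)

text \<open>Predecessor and successor along the cycles are inverse bijections between the cycle
  edges leaving and entering \<open>v\<close>. The generality serves both real flows and edge
  counts.\<close>

lemma circulation:
  fixes \<phi> :: "'e \<Rightarrow> 'a::comm_monoid_add"
  assumes \<phi>: "\<And>C e e'. C \<in> Cycles \<Longrightarrow> e \<in> C \<Longrightarrow> e' \<in> C \<Longrightarrow> \<phi> e = \<phi> e'"
  shows "(\<Sum>e | e \<in> U \<and> t e = v. \<phi> e) = (\<Sum>e | e \<in> U \<and> h e = v. \<phi> e)"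
proof -
  define pre where "pre e = (SOME e'. e' \<in> cyc e \<and> h e' = t e)" for e
  define suc where "suc e = (SOME e'. e' \<in> cyc e \<and> t e' = h e)" for e
  have pre: "pre e \<in> cyc e" "h (pre e) = t e" if "e \<in> U" for e
  proof -
    have "\<exists>e'. e' \<in> cyc e \<and> h e' = t e"
      using cycle_next(2)[OF Cycles_directed[OF cyc_U(1)[OF that]] cyc_U(2)[OF that]] by blast
    from someI_ex[OF this] show "pre e \<in> cyc e" "h (pre e) = t e"
      unfolding pre_def by simp_all
  qed
  have suc: "suc e \<in> cyc e" "t (suc e) = h e" if "e \<in> U" for e
  proof -
    have "\<exists>e'. e' \<in> cyc e \<and> t e' = h e"
      using cycle_next(1)[OF Cycles_directed[OF cyc_U(1)[OF that]] cyc_U(2)[OF that]] by blast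
    from someI_ex[OF this] show "suc e \<in> cyc e" "t (suc e) = h e"
      unfolding suc_def by simp_all
  qed
  have U: "e' \<in> U" "cyc e' = cyc e" if "e \<in> U" "e' \<in> cyc e" for e e'
    using cyc_U(1)[OF that(1)] that(2) cyc_eq by auto
  show ?thesis
  proof (rule sum.reindex_bij_witness[where i = suc and j = pre])
    fix e assume e: "e \<in> {e \<in> U. t e = v}"
    then have *: "e \<in> U" "t e = v" by auto
    note ** = U[OF *(1) pre(1)[OF *(1)]]
    show "pre e \<in> {e \<in> U. h e = v}"
      using ** pre(2)[OF *(1)] *(2) by blast
    show "suc (pre e) = e"
      by (rule cycle_inj_tail[OF cyc_U(1)[OF *(1)]])
        (use suc[OF **(1)] **(2) cyc_U(2)[OF *(1)] pre(2)[OF *(1)] in auto)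
    show "\<phi> (pre e) = \<phi> e"
      by (rule \<phi>[OF cyc_U(1)[OF *(1)] pre(1)[OF *(1)] cyc_U(2)[OF *(1)]])
  next
    fix e assume e: "e \<in> {e \<in> U. h e = v}"
    then have *: "e \<in> U" "h e = v" by auto
    note ** = U[OF *(1) suc(1)[OF *(1)]]
    show "suc e \<in> {e \<in> U. t e = v}"
      using ** suc(2)[OF *(1)] *(2) by blast
    show "pre (suc e) = e"
      by (rule cycle_inj_head[OF cyc_U(1)[OF *(1)]])
        (use pre[OF **(1)] **(2) cyc_U(2)[OF *(1)] suc(2)[OF *(1)] in auto)
  qed
qed

text \<open>The circulations added around the cycles cancel; the uncut edges remain.\<close>

lemma netflow_lift:
  assumes Z: "choice Z"
  shows "netflow H (($) (lift Z f)) v = (\<Sum>e | e \<notin> Z \<and> t e = v. f $ e) - (\<Sum>e | e \<notin> Z \<and> h e = v. f $ e)"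
proof -
  have split: "(\<Sum>e | g e = v. lift Z f $ e) = (\<Sum>e | e \<notin> Z \<and> g e = v. f $ e) + (\<Sum>e | e \<in> U \<and> g e = v. f $ rep Z e)"
    for g :: "'e \<Rightarrow> 'v"
  proof -
    have "(\<Sum>e | g e = v. lift Z f $ e) = (\<Sum>e | g e = v. (if e \<in> Z then 0 else f $ e)) +
        (\<Sum>e | g e = v. (if e \<in> U then f $ rep Z e else 0))"
      by (simp only: lift_nth sum.distrib)
    also have "(\<Sum>e | g e = v. (if e \<in> Z then 0 else f $ e)) = (\<Sum>e | e \<notin> Z \<and> g e = v. f $ e)"
      by (intro sum.mono_neutral_cong_right) auto
    also have "(\<Sum>e | g e = v. (if e \<in> U then f $ rep Z e else 0)) = (\<Sum>e | e \<in> U \<and> g e = v. f $ rep Z e)"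
      by (intro sum.mono_neutral_cong_right) auto
    finally show ?thesis .
  qed
  have "(\<Sum>e | e \<in> U \<and> t e = v. f $ rep Z e) = (\<Sum>e | e \<in> U \<and> h e = v. f $ rep Z e)"
  proof (rule circulation)
    fix C e e' assume C: "C \<in> Cycles" "e \<in> C" "e' \<in> C"
    have "rep Z e = rep Z e'"
      using rep_eq[OF Z C(1,2) rep(2)[OF Z C(1,3)] rep(1)[OF Z C(1,3)]] .
    then show "f $ rep Z e = f $ rep Z e'" by simp
  qed
  then show ?thesis
    unfolding netflow_eq split by simp
qed

text \<open>For a nondegenerate choice, the internal vertices left out are those whose edges are all
  cut.\<close>

definition cut_verts :: "'e set \<Rightarrow> 'v set" where
  "cut_verts Z = {v \<in> I. \<exists>e. e \<notin> Z \<and> t e = v}"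

definition cut_tail :: "'e set \<Rightarrow> 'e \<Rightarrow> 'v option" where
  "cut_tail Z e = (if e \<in> Z \<or> t e \<notin> cut_verts Z then None else Some (t e))"

definition cut_head :: "'e set \<Rightarrow> 'e \<Rightarrow> 'v option" where
  "cut_head Z e = (if e \<in> Z \<or> h e \<notin> cut_verts Z then None else Some (h e))"

text \<open>No vertex loses all its edges on one side only, as the degree condition of
  \<open>dag\<close> requires.\<close>

definition nondegenerate :: "'e set \<Rightarrow> bool" where
  "nondegenerate Z \<longleftrightarrow> (\<forall>v\<in>I. (\<exists>e. e \<notin> Z \<and> t e = v) \<longleftrightarrow> (\<exists>e. e \<notin> Z \<and> h e = v))"

lemma cut_tail_Some: "v \<in> cut_verts Z \<Longrightarrow> {e. cut_tail Z e = Some v} = {e. e \<notin> Z \<and> t e = v}"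
  by (auto simp: cut_tail_def)

lemma cut_head_Some: "v \<in> cut_verts Z \<Longrightarrow> {e. cut_head Z e = Some v} = {e. e \<notin> Z \<and> h e = v}"
  by (auto simp: cut_head_def)

lemma cut_tail_None: "{e. cut_tail Z e = None} = Z \<union> {e. t e \<in> sources H}"
  using tail_internal by (auto simp: cut_tail_def cut_verts_def)

text \<open>Every minimal cycle contains a cut edge, so the uncut edges are acyclic.\<close>

lemma dag_cut:
  assumes Z: "choice Z" "nondegenerate Z"
  shows "dag UNIV (cut_verts Z) (cut_tail Z) (cut_head Z)"
  unfolding dag_def
proof (intro conjI)
  show "finite (cut_verts Z)"
    using finite_I by (simp add: cut_verts_def)
  show "\<forall>e v. cut_tail Z e = Some v \<or> cut_head Z e = Some v \<longrightarrow> v \<in> cut_verts Z \<and> e \<in> UNIV"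
    by (auto simp: cut_tail_def cut_head_def split: if_splits)
  show "\<forall>v\<in>cut_verts Z. (\<exists>e. cut_tail Z e = Some v) \<and> (\<exists>e. cut_head Z e = Some v)"
  proof
    fix v assume v: "v \<in> cut_verts Z"
    then have I: "v \<in> I" and ex: "\<exists>e. e \<notin> Z \<and> t e = v"
      by (auto simp: cut_verts_def)
    then have ex': "\<exists>e. e \<notin> Z \<and> h e = v"
      using Z(2) by (simp add: nondegenerate_def)
    from ex obtain e where "e \<in> {e. cut_tail Z e = Some v}"
      unfolding cut_tail_Some[OF v] by auto
    moreover from ex' obtain e' where "e' \<in> {e. cut_head Z e = Some v}"
      unfolding cut_head_Some[OF v] by auto
    ultimately show "(\<exists>e. cut_tail Z e = Some v) \<and> (\<exists>e. cut_head Z e = Some v)"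
      by blast
  qed
  let ?R = "{(t e, h e) | e. e \<in> - Z}"
  have "acyclic ?R"
  proof (rule ccontr)
    assume "\<not> acyclic ?R"
    then obtain C where C: "C \<in> Cycles" "C \<subseteq> - Z"
      using cycle_in_cyclic_set by blast
    obtain e where "e \<in> C" using cycle_nonempty[OF C(1)] by blast
    from rep[OF Z(1) C(1) this] show False using C(2) by blast
  qed
  \<comment> \<open>The rank of a vertex will be the number of vertices from which it can be reached
    along uncut edges.\<close>
  have fin: "finite {u. (u, w) \<in> ?R\<^sup>+}" for w
  proof -
    have "{u. (u, w) \<in> ?R\<^sup>+} \<subseteq> range t"
      by (auto dest: tranclD)
    then show ?thesis by (rule finite_subset) simp
  qed
  show "\<exists>r :: 'v \<Rightarrow> nat. \<forall>e u w. cut_tail Z e = Some u \<and> cut_head Z e = Some w \<longrightarrow> r u < r w"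
  proof (intro exI allI impI)
    fix e u w assume *: "cut_tail Z e = Some u \<and> cut_head Z e = Some w"
    then have "(u, w) \<in> ?R"
      by (auto simp: cut_tail_def cut_head_def split: if_splits)
    then have "{x. (x, u) \<in> ?R\<^sup>+} \<subseteq> {x. (x, w) \<in> ?R\<^sup>+}" "u \<in> {x. (x, w) \<in> ?R\<^sup>+}"
      by (auto intro: trancl_into_trancl)
    moreover have "u \<notin> {x. (x, u) \<in> ?R\<^sup>+}"
      using \<open>acyclic ?R\<close> by (auto simp: acyclic_def)
    ultimately have "{x. (x, u) \<in> ?R\<^sup>+} \<subset> {x. (x, w) \<in> ?R\<^sup>+}"
      by blast
    then show "card {x. (x, u) \<in> ?R\<^sup>+} < card {x. (x, w) \<in> ?R\<^sup>+}"
      by (rule psubset_card_mono[OF fin])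
  qed
qed

lemma lift_space:
  assumes Z: "choice Z" "nondegenerate Z"
  shows "lift Z f \<in> flow_space \<longleftrightarrow> f \<in> dag_space UNIV (cut_verts Z) (cut_tail Z) (cut_head Z)"
proof -
  have "netflow H (($) (lift Z f)) v = 0" if v: "v \<in> I" "v \<notin> cut_verts Z" for v
  proof -
    have "{e. e \<notin> Z \<and> t e = v} = {}"
      using v by (auto simp: cut_verts_def)
    moreover have "{e. e \<notin> Z \<and> h e = v} = {}"
      using Z(2) v by (auto simp: cut_verts_def nondegenerate_def)
    ultimately show ?thesis
      unfolding netflow_lift[OF Z(1)] by (simp only: sum.empty)
  qed
  then have "lift Z f \<in> flow_space \<longleftrightarrow> (\<forall>v\<in>cut_verts Z. netflow H (($) (lift Z f)) v = 0)"
    unfolding flow_space_def by (auto simp: cut_verts_def)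
  also have "\<dots> \<longleftrightarrow> f \<in> dag_space UNIV (cut_verts Z) (cut_tail Z) (cut_head Z)"
    unfolding dag_space_def netflow_lift[OF Z(1)] by (simp add: cut_tail_Some cut_head_Some)
  finally show ?thesis .
qed

section \<open>Regions on which the flow value is linear\<close>

definition flow_value :: "real ^ 'e \<Rightarrow> real" where
  "flow_value f = (\<Sum>s\<in>sources H. \<Sum>e\<in>out_arcs H s. f $ e) + (\<Sum>C\<in>Cycles. Min (($) f ` C))"

text \<open>The linear function that agrees with \<open>flow_value\<close> where the chosen edges
  are minimal on their cycles.\<close>

definition cut_value :: "'e set \<Rightarrow> real ^ 'e \<Rightarrow> real" where
  "cut_value Z f = (\<Sum>e | t e \<in> sources H. f $ e) + (\<Sum>e\<in>Z. f $ e)"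

lemma not_U_source: "t e \<in> sources H \<Longrightarrow> e \<notin> U"
  using cycle_internal(1) tail_internal by blast

lemma flow_value_cut:
  assumes Z: "choice Z" and f: "\<And>e. e \<in> U \<Longrightarrow> f $ rep Z e \<le> f $ e"
  shows "flow_value f = cut_value Z f"
proof -
  have "finite (sources H)"
    using verts(3) by (simp add: sources_def)
  have "(\<Sum>s\<in>sources H. \<Sum>e\<in>out_arcs H s. f $ e) =
      (\<Sum>s\<in>sources H. \<Sum>e\<in>{e \<in> {e. t e \<in> sources H}. t e = s}. f $ e)"
    by (intro sum.cong) (auto simp: out_arcs_eq)
  also have "\<dots> = (\<Sum>e | t e \<in> sources H. f $ e)"
    by (rule sum.group) (use \<open>finite (sources H)\<close> in auto)
  finally have 1: "(\<Sum>s\<in>sources H. \<Sum>e\<in>out_arcs H s. f $ e) = (\<Sum>e | t e \<in> sources H. f $ e)" .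
  have "(\<Sum>C\<in>Cycles. Min (($) f ` C)) = (\<Sum>e\<in>Z. f $ e)"
  proof (rule sum.reindex_bij_witness[where i = cyc and j = "\<lambda>C. THE z. z \<in> Z \<and> z \<in> C"])
    fix C assume C: "C \<in> Cycles"
    obtain e where e: "e \<in> C" using cycle_nonempty[OF C] by blast
    have the: "(THE z. z \<in> Z \<and> z \<in> C) = rep Z e"
      by (simp add: rep_def cyc_eq[OF C e])
    show "(THE z. z \<in> Z \<and> z \<in> C) \<in> Z"
      unfolding the by (rule rep(1)[OF Z C e])
    show "cyc (THE z. z \<in> Z \<and> z \<in> C) = C"
      unfolding the by (rule cyc_eq[OF C rep(2)[OF Z C e]])
    show "f $ (THE z. z \<in> Z \<and> z \<in> C) = Min (($) f ` C)"
      unfolding the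
    proof (rule Min_eqI[symmetric])
      show "f $ rep Z e \<in> ($) f ` C"
        using rep(2)[OF Z C e] by blast
      fix y assume "y \<in> ($) f ` C"
      then obtain x where x: "x \<in> C" "y = f $ x" by blast
      have "rep Z x = rep Z e"
        by (rule rep_eq[OF Z C x(1) rep(2)[OF Z C e] rep(1)[OF Z C e]])
      then show "f $ rep Z e \<le> y"
        using f[of x] C x by auto
    qed simp
  next
    fix z assume z: "z \<in> Z"
    then have U: "z \<in> U" by (rule choice_U[OF Z])
    show "cyc z \<in> Cycles" by (rule cyc_U(1)[OF U])
    show "(THE z'. z' \<in> Z \<and> z' \<in> cyc z) = z"
      unfolding rep_def[symmetric] by (rule rep_Z[OF Z z])
  qed
  then show ?thesis
    by (simp add: flow_value_def cut_value_def 1)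
qed

definition region :: "'e set \<Rightarrow> (real ^ 'e) set" where
  "region Z = {f \<in> flow_space. (\<forall>e. 0 \<le> f $ e) \<and> (\<forall>e\<in>U. f $ rep Z e \<le> f $ e)}"

definition open_region :: "'e set \<Rightarrow> (real ^ 'e) set" where
  "open_region Z = {f. \<forall>e\<in>U - Z. f $ rep Z e < f $ e}"

text \<open>On an uncut cycle edge, the excess of \<open>lift Z f\<close> over its value on the cut
  edge of that cycle is the coordinate of \<open>f\<close>.\<close>

lemma lift_nonneg:
  assumes Z: "choice Z"
  shows "(\<forall>e. 0 \<le> lift Z f $ e) \<and> (\<forall>e\<in>U. lift Z f $ rep Z e \<le> lift Z f $ e) \<longleftrightarrow> (\<forall>e. 0 \<le> f $ e)"
proof -
  have rep: "lift Z f $ rep Z e = f $ rep Z e" if "e \<in> U" for e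
    by (rule lift_Z[OF Z rep_U(1)[OF Z that]])
  have outside: "lift Z f $ e = f $ e" if "e \<notin> U" for e
    using that choice_U[OF Z, of e] by (auto simp: lift_nth)
  have inside: "lift Z f $ e = f $ e + f $ rep Z e" if "e \<in> U" "e \<notin> Z" for e
    using that by (simp add: lift_nth)
  show ?thesis
  proof (intro iffI conjI allI ballI)
    fix e assume *: "(\<forall>e. 0 \<le> lift Z f $ e) \<and> (\<forall>e\<in>U. lift Z f $ rep Z e \<le> lift Z f $ e)"
    then have e: "0 \<le> lift Z f $ e" "e \<in> U \<Longrightarrow> lift Z f $ rep Z e \<le> lift Z f $ e" by blast+
    consider "e \<notin> U" | "e \<in> Z" | "e \<in> U" "e \<notin> Z" by blast
    then show "0 \<le> f $ e"
      using e outside[of e] inside[of e] rep[of e] lift_Z[OF Z, of e f] by cases simp_all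
  next
    fix e assume *: "\<forall>e. 0 \<le> f $ e"
    then show "0 \<le> lift Z f $ e"
      by (simp add: lift_nth)
  next
    fix e assume *: "\<forall>e. 0 \<le> f $ e" and e: "e \<in> U"
    show "lift Z f $ rep Z e \<le> lift Z f $ e"
    proof (cases "e \<in> Z")
      case True
      then show ?thesis using rep_Z[OF Z] by simp
    next
      case False
      then show ?thesis using rep[OF e] inside[OF e] * by simp
    qed
  qed
qed

lemma lift_region:
  assumes Z: "choice Z" "nondegenerate Z"
  shows "lift Z f \<in> region Z \<longleftrightarrow> f \<in> dag_cone UNIV (cut_verts Z) (cut_tail Z) (cut_head Z)"
  unfolding region_def dag_cone_def mem_Collect_eq lift_space[OF Z] lift_nonneg[OF Z(1)] ..

lemma lift_open_region:
  assumes Z: "choice Z" and f: "\<forall>e. 0 < f $ e"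
  shows "lift Z f \<in> open_region Z"
  unfolding open_region_def
proof (intro CollectI ballI)
  fix e assume e: "e \<in> U - Z"
  then have "lift Z f $ e = f $ e + f $ rep Z e" "lift Z f $ rep Z e = f $ rep Z e"
    using lift_Z[OF Z rep_U(1)[OF Z]] by (simp_all add: lift_nth)
  then show "lift Z f $ rep Z e < lift Z f $ e"
    using f by simp
qed

text \<open>The source edges of the cut graph are the original ones, which lie on no cycle, and the
  cut edges, whose lifted values are the cycle minima.\<close>

lemma flow_value_lift:
  assumes Z: "choice Z" and f: "\<forall>e. 0 \<le> f $ e"
  shows "flow_value (lift Z f) = source_value (cut_tail Z) f"
proof -
  have "flow_value (lift Z f) = cut_value Z (lift Z f)"
    using lift_nonneg[OF Z, of f] f by (intro flow_value_cut[OF Z]) blast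
  also have "\<dots> = (\<Sum>e | t e \<in> sources H. f $ e) + (\<Sum>e\<in>Z. f $ e)"
  proof -
    have "lift Z f $ e = f $ e" if "t e \<in> sources H" for e
      using not_U_source[OF that] choice_U[OF Z, of e] by (auto simp: lift_nth)
    then show ?thesis
      by (simp add: cut_value_def lift_Z[OF Z])
  qed
  also have "\<dots> = source_value (cut_tail Z) f"
  proof -
    have "Z \<inter> {e. t e \<in> sources H} = {}"
      using not_U_source choice_U[OF Z] by blast
    then show ?thesis
      unfolding source_value_def cut_tail_None by (simp add: sum.union_disjoint)
  qed
  finally show ?thesis .
qed

text \<open>On a cycle where the choices differ, each chosen edge would carry strictly less than the
  other.\<close>

lemma open_region_disjoint:
  assumes Z: "choice Z" "choice Z'" "Z \<noteq> Z'"
  shows "open_region Z \<inter> open_region Z' = {}"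
proof -
  have *: False if Z: "choice Z" "choice Z'" and f: "f \<in> open_region Z" "f \<in> open_region Z'" and z: "z \<in> Z" "z \<notin> Z'" for Z Z' f z
  proof -
    have U: "z \<in> U" by (rule choice_U[OF Z(1) z(1)])
    let ?z' = "rep Z' z"
    have z': "?z' \<in> Z'" "?z' \<in> cyc z"
      using rep_U[OF Z(2) U] by simp_all
    have "?z' \<notin> Z"
    proof
      assume "?z' \<in> Z"
      then have "?z' = z"
        using choice_unique[OF Z(1) cyc_U(1)[OF U] z'(2) cyc_U(2)[OF U]] z(1) by simp
      then show False using z'(1) z(2) by simp
    qed
    moreover have "?z' \<in> U" by (rule choice_U[OF Z(2) z'(1)])
    moreover have "rep Z ?z' = z"
      by (rule rep_eq[OF Z(1) cyc_U(1)[OF U] z'(2) cyc_U(2)[OF U] z(1)])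
    ultimately have "f $ z < f $ ?z'"
      using f(1)[unfolded open_region_def mem_Collect_eq, THEN bspec, of ?z'] by simp
    moreover have "f $ ?z' < f $ z"
      using f(2)[unfolded open_region_def mem_Collect_eq, THEN bspec, of z] U z(2) by simp
    ultimately show False by simp
  qed
  obtain z where "z \<in> Z \<and> z \<notin> Z' \<or> z \<in> Z' \<and> z \<notin> Z"
    using Z(3) by blast
  then show ?thesis
    using *[of Z Z'] *[of Z' Z] Z(1,2) by blast
qed

end


section \<open>Cyclic integer flows\<close>

context framed_digraph
begin

abbreviation "Flows \<equiv> cyclic_volume_integer_flows H"

definition zeros :: "('e \<Rightarrow> nat) \<Rightarrow> 'e set" where
  "zeros g = {e \<in> U. g e = 0}"

lemma zeros_iff: "e \<in> U \<Longrightarrow> e \<in> zeros g \<longleftrightarrow> g e = 0"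
  by (simp add: zeros_def)

lemma choice_zeros:
  assumes "g \<in> Flows"
  shows "choice (zeros g)"
proof -
  have "\<exists>!z. z \<in> zeros g \<and> z \<in> C" if C: "C \<in> Cycles" for C
  proof -
    have "\<exists>!e. e \<in> C \<and> g e = 0"
      using assms C by (simp add: cyclic_volume_integer_flows_def cyclic_integer_flow_def)
    moreover have "z \<in> zeros g \<and> z \<in> C \<longleftrightarrow> z \<in> C \<and> g z = 0" for z
      using C by (auto simp: zeros_def)
    ultimately show ?thesis by simp
  qed
  then show ?thesis
    by (auto simp: choice_def zeros_def)
qed

text \<open>Nothing enters a source, so netflow 0 there means that its outgoing edges carry 0. The
  other conditions only depend on the zeros once these are fixed to be \<open>Z\<close>, and on the
  netflow.\<close>

lemma flow_iff:
  assumes Z: "choice Z"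
  shows "g \<in> Flows \<and> zeros g = Z \<longleftrightarrow> zeros g = Z \<and> (\<forall>e. t e \<in> sources H \<longrightarrow> g e = 0) \<and>
    (\<forall>v\<in>I. netflow H (\<lambda>e. int (g e)) v = (if \<exists>z\<in>Z. t z = v then 0 else 1))"
proof -
  have 1: "\<forall>C\<in>Cycles. \<exists>!e. e \<in> C \<and> g e = 0" if "zeros g = Z"
  proof
    fix C assume C: "C \<in> Cycles"
    then have "\<exists>!z. z \<in> Z \<and> z \<in> C"
      using Z by (simp add: choice_def)
    moreover have "z \<in> Z \<and> z \<in> C \<longleftrightarrow> z \<in> C \<and> g z = 0" for z
      unfolding that[symmetric] using C by (auto simp: zeros_def)
    ultimately show "\<exists>!e. e \<in> C \<and> g e = 0" by simp
  qed
  have 2: "(\<exists>C\<in>Cycles. \<exists>e\<in>C. g e = 0 \<and> t e = v) \<longleftrightarrow> (\<exists>z\<in>Z. t z = v)" if "zeros g = Z" for v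
    unfolding that[symmetric] by (auto simp: zeros_def)
  have 3: "(\<forall>s\<in>sources H. netflow H (\<lambda>e. int (g e)) s = 0) \<longleftrightarrow> (\<forall>e. t e \<in> sources H \<longrightarrow> g e = 0)"
  proof -
    have "netflow H (\<lambda>e. int (g e)) s = 0 \<longleftrightarrow> (\<forall>e. t e = s \<longrightarrow> g e = 0)" if "s \<in> sources H" for s
    proof -
      have "{e. h e = s} = {}" using that by (auto simp: sources_iff)
      then have "netflow H (\<lambda>e. int (g e)) s = (\<Sum>e | t e = s. int (g e))"
        by (simp only: netflow_eq sum.empty diff_0_right)
      also have "\<dots> = 0 \<longleftrightarrow> (\<forall>e\<in>{e. t e = s}. int (g e) = 0)"
        by (rule sum_nonneg_eq_0_iff) simp_all
      finally show ?thesis by simp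
    qed
    then show ?thesis by auto
  qed
  show ?thesis
    unfolding cyclic_volume_integer_flows_def cyclic_integer_flow_def mem_Collect_eq 3
    using 1 2 by (cases "zeros g = Z") (simp_all add: conj_commute)
qed

lemma sum_cycle_ones: "card {e. e \<in> U \<and> t e = v} = card {e. e \<in> U \<and> h e = v}"
  using circulation[of "\<lambda>_. 1 :: nat" v] by simp

text \<open>Ones on all cycle edges form a circulation; what remains is to take them back on the cut
  edges.\<close>

lemma netflow_add:
  assumes Z: "choice Z" and g: "\<And>e. e \<in> Z \<Longrightarrow> g e = 0"
  shows "netflow H (\<lambda>e. int (g e + of_bool (e \<in> U - Z))) v =
    int (\<Sum>e | e \<notin> Z \<and> t e = v. g e) - int (\<Sum>e | e \<notin> Z \<and> h e = v. g e) -
    int (card {e \<in> Z. t e = v}) + int (card {e \<in> Z. h e = v})"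
proof -
  have split: "(\<Sum>e | k e = v. int (g e + of_bool (e \<in> U - Z))) =
    int (\<Sum>e | e \<notin> Z \<and> k e = v. g e) + (int (card {e. e \<in> U \<and> k e = v}) - int (card {e \<in> Z. k e = v}))"
    for k :: "'e \<Rightarrow> 'v"
  proof -
    have "(\<Sum>e | k e = v. int (g e + of_bool (e \<in> U - Z))) =
        int (\<Sum>e | k e = v. g e) + int (\<Sum>e | k e = v. of_bool (e \<in> U - Z))"
      by (simp only: of_nat_sum[symmetric] of_nat_add[symmetric] sum.distrib)
    also have "(\<Sum>e | k e = v. g e) = (\<Sum>e | e \<notin> Z \<and> k e = v. g e)"
      using g by (intro sum.mono_neutral_right) auto
    also have "(\<Sum>e | k e = v. of_bool (e \<in> U - Z)) = card ({e. e \<in> U \<and> k e = v} - {e \<in> Z. k e = v})"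
      by (subst sum_of_bool_eq) (auto intro: arg_cong[where f = card])
    also have "\<dots> = card {e. e \<in> U \<and> k e = v} - card {e \<in> Z. k e = v}"
      using choice_U[OF Z] by (intro card_Diff_subset) auto
    also have "int \<dots> = int (card {e. e \<in> U \<and> k e = v}) - int (card {e \<in> Z. k e = v})"
      by (rule of_nat_diff, rule card_mono) (use choice_U[OF Z] in auto)
    finally show ?thesis .
  qed
  show ?thesis
    unfolding netflow_eq split sum_cycle_ones by simp
qed

lemma card_uncut: 
  assumes "v \<in> I"
  shows "card {e. e \<notin> Z \<and> t e = v} + card {e \<in> Z. t e = v} = 2"
    "card {e. e \<notin> Z \<and> h e = v} + card {e \<in> Z. h e = v} = 2"
proof -
  have "card {e. e \<notin> Z \<and> k e = v} + card {e \<in> Z. k e = v} = card {e. k e = v}"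
    for k :: "'e \<Rightarrow> 'v"
    by (subst card_Un_disjoint[symmetric]) (auto intro: arg_cong[where f = card])
  then show "card {e. e \<notin> Z \<and> t e = v} + card {e \<in> Z. t e = v} = 2"
    "card {e. e \<notin> Z \<and> h e = v} + card {e \<in> Z. h e = v} = 2"
    using card_out[OF assms] card_in[OF assms] by simp_all
qed

text \<open>At a vertex with an uncut outgoing edge, at most one outgoing edge is cut, so the
  prescribed netflow is 1 minus the number of cut outgoing edges. By \<open>netflow_add\<close> the
  uncut edges then have netflow 1 minus the number of cut incoming edges, which is the uncut
  indegree minus one. At any other internal vertex all edges are cut and both conditions
  hold.\<close>

lemma shifted_flow_iff:
  assumes Z: "choice Z" "nondegenerate Z"
  shows "(\<lambda>e. g e + of_bool (e \<in> U - Z)) \<in> Flows \<and> zeros (\<lambda>e. g e + of_bool (e \<in> U - Z)) = Z \<longleftrightarrow>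
    g \<in> dag_flows (cut_verts Z) (cut_tail Z) (cut_head Z)"
proof -
  let ?g = "\<lambda>e. g e + of_bool (e \<in> U - Z)"
  have zeros: "zeros ?g = Z \<longleftrightarrow> (\<forall>e\<in>Z. g e = 0)"
    using choice_U[OF Z(1)] unfolding zeros_def by (auto split: if_splits)
  have sources: "(\<forall>e. t e \<in> sources H \<longrightarrow> ?g e = 0) \<longleftrightarrow> (\<forall>e. t e \<in> sources H \<longrightarrow> g e = 0)"
    using not_U_source by auto
  have none: "(\<forall>e. cut_tail Z e = None \<longrightarrow> g e = 0) \<longleftrightarrow> (\<forall>e\<in>Z. g e = 0) \<and> (\<forall>e. t e \<in> sources H \<longrightarrow> g e = 0)"
    using cut_tail_None[of Z] by blast
  have vertex: "netflow H (\<lambda>e. int (?g e)) v = (if \<exists>z\<in>Z. t z = v then 0 else 1) \<longleftrightarrow>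
      (v \<in> cut_verts Z \<longrightarrow> (\<Sum>e | cut_tail Z e = Some v. g e) + 1 =
        (\<Sum>e | cut_head Z e = Some v. g e) + card {e. cut_head Z e = Some v})"
    if v: "v \<in> I" and g: "\<forall>e\<in>Z. g e = 0" for v
  proof (cases "v \<in> cut_verts Z")
    case True
    then have "{e. e \<notin> Z \<and> t e = v} \<noteq> {}"
      by (auto simp: cut_verts_def)
    then have "card {e. e \<notin> Z \<and> t e = v} \<noteq> 0"
      by simp
    obtain n where n: "card {e \<in> Z. t e = v} = n" by simp
    have "(\<exists>z\<in>Z. t z = v) \<longleftrightarrow> n \<noteq> 0"
      unfolding n[symmetric] by auto
    moreover have "n \<le> 1"
      using card_uncut(1)[OF v, of Z] \<open>card {e. e \<notin> Z \<and> t e = v} \<noteq> 0\<close>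
        unfolding n by linarith
    ultimately have rule: "(if \<exists>z\<in>Z. t z = v then 0 else 1) = 1 - int (card {e \<in> Z. t e = v})"
      unfolding n by auto
    have net: "netflow H (\<lambda>e. int (?g e)) v =
      int (\<Sum>e | e \<notin> Z \<and> t e = v. g e) - int (\<Sum>e | e \<notin> Z \<and> h e = v. g e) -
      int (card {e \<in> Z. t e = v}) + int (card {e \<in> Z. h e = v})"
      by (rule netflow_add[OF Z(1)]) (use g in simp)
    show ?thesis
      unfolding rule net cut_tail_Some[OF True] cut_head_Some[OF True]
      using card_uncut(2)[OF v, of Z] True by (simp only: simp_thms) (rule iffI; linarith)
  next
    case False
    then have empty: "{e. e \<notin> Z \<and> t e = v} = {}"
      using v by (auto simp: cut_verts_def)
    then have empty': "{e. e \<notin> Z \<and> h e = v} = {}"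
      using Z(2) v by (auto simp: nondegenerate_def)
    have cards: "card {e \<in> Z. t e = v} = 2" "card {e \<in> Z. h e = v} = 2"
      using card_uncut[OF v, of Z] unfolding empty empty' by simp_all
    then have "{e \<in> Z. t e = v} \<noteq> {}" by (metis card.empty zero_neq_numeral)
    then have "\<exists>z\<in>Z. t z = v" by blast
    moreover have "netflow H (\<lambda>e. int (?g e)) v = 0"
      using netflow_add[OF Z(1), of g v] g by (simp only: empty empty' cards sum.empty)
    ultimately show ?thesis using False by simp
  qed
  have verts: "(\<forall>v\<in>cut_verts Z. P v) \<longleftrightarrow> (\<forall>v\<in>I. v \<in> cut_verts Z \<longrightarrow> P v)" for P
    by (auto simp: cut_verts_def)
  have balls: "(\<forall>v\<in>I. netflow H (\<lambda>e. int (?g e)) v = (if \<exists>z\<in>Z. t z = v then 0 else 1)) \<longleftrightarrow>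
      (\<forall>v\<in>I. v \<in> cut_verts Z \<longrightarrow> (\<Sum>e | cut_tail Z e = Some v. g e) + 1 =
        (\<Sum>e | cut_head Z e = Some v. g e) + card {e. cut_head Z e = Some v})"
    if "\<forall>e\<in>Z. g e = 0"
    using vertex[OF _ that] by (intro ball_cong refl)
  show ?thesis
    unfolding flow_iff[OF Z(1)]
    unfolding dag_flows_def mem_Collect_eq zeros sources none verts conj_assoc
    using balls by (intro conj_cong refl)
qed

lemma shift_bij:
  assumes Z: "choice Z" "nondegenerate Z"
  shows "bij_betw (\<lambda>g e. g e - of_bool (e \<in> U - Z)) {g \<in> Flows. zeros g = Z}
    (dag_flows (cut_verts Z) (cut_tail Z) (cut_head Z))"
proof (rule bij_betw_byWitness[where f' = "\<lambda>g e. g e + of_bool (e \<in> U - Z)"])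
  have inv: "(\<lambda>e. (g e - of_bool (e \<in> U - Z)) + of_bool (e \<in> U - Z)) = g" if g: "zeros g = Z"
    for g
  proof
    fix e
    have "g e \<noteq> 0" if "e \<in> U - Z"
      using that g by (auto simp: zeros_def)
    then show "(g e - of_bool (e \<in> U - Z)) + of_bool (e \<in> U - Z) = g e"
      by (cases "e \<in> U - Z") simp_all
  qed
  then show "\<forall>g\<in>{g \<in> Flows. zeros g = Z}. (\<lambda>e. (g e - of_bool (e \<in> U - Z)) + of_bool (e \<in> U - Z)) = g"
    by simp
  show "\<forall>g\<in>dag_flows (cut_verts Z) (cut_tail Z) (cut_head Z). (\<lambda>e. (g e + of_bool (e \<in> U - Z)) - of_bool (e \<in> U - Z)) = g"
    by simp
  show "(\<lambda>g e. g e - of_bool (e \<in> U - Z)) ` {g \<in> Flows. zeros g = Z} \<subseteq> dag_flows (cut_verts Z) (cut_tail Z) (cut_head Z)"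
  proof
    fix g' assume "g' \<in> (\<lambda>g e. g e - of_bool (e \<in> U - Z)) ` {g \<in> Flows. zeros g = Z}"
    then obtain g where g: "g \<in> Flows" "zeros g = Z" "g' = (\<lambda>e. g e - of_bool (e \<in> U - Z))" by blast
    have "(\<lambda>e. g' e + of_bool (e \<in> U - Z)) = g"
      unfolding g(3) by (rule inv[OF g(2)])
    then show "g' \<in> dag_flows (cut_verts Z) (cut_tail Z) (cut_head Z)"
      unfolding shifted_flow_iff[OF Z, symmetric] using g(1,2) by simp
  qed
  show "(\<lambda>g e. g e + of_bool (e \<in> U - Z)) ` dag_flows (cut_verts Z) (cut_tail Z) (cut_head Z) \<subseteq> {g \<in> Flows. zeros g = Z}"
    by (rule image_subsetI) (simp only: shifted_flow_iff[OF Z, symmetric] mem_Collect_eq simp_thms)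
qed

lemma region_fan:
  assumes Z: "choice Z" "nondegenerate Z"
  shows "has_unimodular_fan flow_space flow_value (region Z) (open_region Z) {g \<in> Flows. zeros g = Z}"
proof (rule has_unimodular_fan_reindex[OF _ shift_bij[OF Z]])
  show "has_unimodular_fan flow_space flow_value (region Z) (open_region Z)
      (dag_flows (cut_verts Z) (cut_tail Z) (cut_head Z))"
    by (rule has_unimodular_fan_image[OF dag_fan[OF dag_cut[OF Z]] unimodular_lift[OF Z(1)]])
      (use lift_space[OF Z] lift_region[OF Z] flow_value_lift[OF Z(1)] lift_open_region[OF Z(1)] in
        \<open>simp_all add: dag_cone_def\<close>)
qed

text \<open>If all edges on one side of \<open>v\<close> are cut, they lie on two different cycles
  through \<open>v\<close>, since each cycle holds one chosen edge. If one cycle were a loop at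
  \<open>v\<close>, the hypothesis on loops would make the other a loop too; both sides would then
  consist of the same edges, cut alike.\<close>

lemma degenerate_vertex:
  assumes Z: "choice Z" "\<not> nondegenerate Z"
  obtains v C D a b c d where "v \<in> I" "C \<in> Cycles" "D \<in> Cycles" "a \<in> C" "b \<in> C" "c \<in> D" "d \<in> D"
    "{e. h e = v} = {a, c}" "{e. t e = v} = {b, d}" "a \<noteq> b" "c \<noteq> d" "a \<noteq> c" "b \<noteq> d"
    "a \<in> Z \<and> c \<in> Z \<or> b \<in> Z \<and> d \<in> Z"
proof -
  obtain v where v: "v \<in> I" "\<not> ((\<exists>e. e \<notin> Z \<and> t e = v) \<longleftrightarrow> (\<exists>e. e \<notin> Z \<and> h e = v))"
    using Z(2) by (auto simp: nondegenerate_def)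
  obtain a c where ac: "{e. h e = v} = {a, c}" "a \<noteq> c"
    using card_in[OF v(1)] by (meson card_2_iff)
  obtain b' d' where bd': "{e. t e = v} = {b', d'}" "b' \<noteq> d'"
    using card_out[OF v(1)] by (meson card_2_iff)
  have "\<exists>C D b d. C \<in> Cycles \<and> D \<in> Cycles \<and> a \<in> C \<and> c \<in> D \<and> b \<in> C \<and> d \<in> D \<and> t b = v \<and> t d = v"
  proof (cases "\<exists>e. e \<notin> Z \<and> t e = v")
    case True
    then have "a \<in> Z" "c \<in> Z"
      using v(2) ac(1) by auto
    then have U: "a \<in> U" "c \<in> U"
      using choice_U[OF Z(1)] by simp_all
    have "h a = v" "h c = v"
      using ac(1) by auto
    then show ?thesis
      using cycle_next(1)[OF Cycles_directed[OF cyc_U(1)[OF U(1)]] cyc_U(2)[OF U(1)]]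
        cycle_next(1)[OF Cycles_directed[OF cyc_U(1)[OF U(2)]] cyc_U(2)[OF U(2)]] cyc_U[OF U(1)] cyc_U[OF U(2)]
      by (metis (no_types, lifting))
  next
    case False
    then have "b' \<in> Z" "d' \<in> Z"
      using bd'(1) by blast+
    then have U: "b' \<in> U" "d' \<in> U"
      using choice_U[OF Z(1)] by simp_all
    have td: "t b' = v" "t d' = v"
      using bd'(1) by auto
    obtain a' where a': "a' \<in> cyc b'" "h a' = v"
      using cycle_next(2)[OF Cycles_directed[OF cyc_U(1)[OF U(1)]] cyc_U(2)[OF U(1)]] td by auto
    obtain c' where c': "c' \<in> cyc d'" "h c' = v"
      using cycle_next(2)[OF Cycles_directed[OF cyc_U(1)[OF U(2)]] cyc_U(2)[OF U(2)]] td by auto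
    have "cyc b' \<noteq> cyc d'"
      using cycle_inj_tail[OF cyc_U(1)[OF U(1)] cyc_U(2)[OF U(1)], of d'] cyc_U(2)[OF U(2)] td bd'(2) by auto
    then have "a' \<noteq> c'"
      using cycles_disjoint[OF cyc_U(1)[OF U(1)] cyc_U(1)[OF U(2)], of a'] a'(1) c'(1) by auto
    moreover have "a' \<in> {a, c}" "c' \<in> {a, c}"
      unfolding ac(1)[symmetric] using a' c' by simp_all
    ultimately consider "a' = a" "c' = c" | "a' = c" "c' = a" by auto
    then show ?thesis
      using a' c' cyc_U[OF U(1)] cyc_U[OF U(2)] td by cases (metis (no_types, lifting))+
  qed
  then obtain C D b d where CD: "C \<in> Cycles" "D \<in> Cycles" "a \<in> C" "c \<in> D" "b \<in> C" "d \<in> D" "t b = v" "t d = v"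
    by (elim exE conjE)
  have hv: "h a = v" "h c = v"
    using ac(1) by auto
  have "C \<noteq> D"
    using cycle_inj_head[OF CD(1,3), of c] CD(4) hv ac(2) by auto
  then have "b \<noteq> d"
    using cycles_disjoint[OF CD(1,2,5)] CD(6) by auto
  have bd: "{e. t e = v} = {b, d}"
  proof -
    have "b \<in> {b', d'}" "d \<in> {b', d'}"
      unfolding bd'(1)[symmetric] using CD by simp_all
    then show ?thesis
      unfolding bd'(1) using \<open>b \<noteq> d\<close> by auto
  qed
  have not_both: "\<not> (a = b \<and> c = d)"
  proof
    assume "a = b \<and> c = d"
    then have "{e. h e = v} = {e. t e = v}"
      using ac(1) bd by simp
    then show False
      using v(2) by blast
  qed
  have loop: "c = d" if "a = b"
  proof -
    have "t a = v" "t d = v" "h a = v" using that CD hv by simp_all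
    then have "card D = 1"
      using loop_on_cycle[OF _ CD(2), of a] CD(6) by (metis imageI)
    then show ?thesis
      using card_cycle_1[OF CD(2) _ CD(4)] CD(6) by auto
  qed
  have loop': "a = b" if "c = d"
  proof -
    have "t c = v" "t b = v" "h c = v" using that CD hv by simp_all
    then have "card C = 1"
      using loop_on_cycle[OF _ CD(1), of c] CD(5) by (metis imageI)
    then show ?thesis
      using card_cycle_1[OF CD(1) _ CD(3)] CD(5) by auto
  qed
  have "a \<noteq> b" "c \<noteq> d"
    using loop loop' not_both by blast+
  moreover have "a \<in> Z \<and> c \<in> Z \<or> b \<in> Z \<and> d \<in> Z"
  proof (rule ccontr)
    assume "\<not> ?thesis"
    then have "(a \<notin> Z \<or> c \<notin> Z) \<and> (b \<notin> Z \<or> d \<notin> Z)" by blast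
    then have "(\<exists>e. e \<notin> Z \<and> h e = v) \<and> (\<exists>e. e \<notin> Z \<and> t e = v)"
      using hv CD(7,8) by blast
    then show False using v(2) by blast
  qed
  ultimately show ?thesis
    using that[OF v(1) CD(1,2,3,5,4,6) ac(1) bd] ac(2) \<open>b \<noteq> d\<close> by simp
qed

text \<open>Two zeros entering and two positive values leaving give netflow at least 2. Two zeros
  leaving and positive values entering give a negative netflow where 0 is prescribed.\<close>

lemma nondegenerate_zeros:
  assumes g: "g \<in> Flows"
  shows "nondegenerate (zeros g)"
proof (rule ccontr)
  let ?Z = "zeros g"
  have Z: "choice ?Z" by (rule choice_zeros[OF g])
  assume "\<not> nondegenerate ?Z"
  then obtain v C D a b c d where *: "v \<in> I" "C \<in> Cycles" "D \<in> Cycles" "a \<in> C" "b \<in> C" "c \<in> D" "d \<in> D"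
    "{e. h e = v} = {a, c}" "{e. t e = v} = {b, d}" "a \<noteq> b" "c \<noteq> d" "a \<noteq> c" "b \<noteq> d"
    "a \<in> ?Z \<and> c \<in> ?Z \<or> b \<in> ?Z \<and> d \<in> ?Z"
    by (rule degenerate_vertex[OF Z])
  have net: "netflow H (\<lambda>e. int (g e)) v = int (g b) + int (g d) - int (g a) - int (g c)"
    unfolding netflow_eq *(8,9) using *(12,13) by simp
  have rule: "netflow H (\<lambda>e. int (g e)) v = (if \<exists>z\<in>?Z. t z = v then 0 else 1)"
    using flow_iff[OF Z, of g] g *(1) by simp
  have U: "a \<in> U" "b \<in> U" "c \<in> U" "d \<in> U"
    using * by auto
  have tv: "t b = v" "t d = v"
    using *(9) by auto
  from *(14) show False
  proof
    assume Z': "a \<in> ?Z \<and> c \<in> ?Z"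
    then have "b \<notin> ?Z" "d \<notin> ?Z"
      using choice_unique[OF Z *(2,4,5)] choice_unique[OF Z *(3,6,7)] *(10,11) by blast+
    then have "g b \<noteq> 0" "g d \<noteq> 0" "g a = 0" "g c = 0"
      using Z' unfolding zeros_iff[OF U(1)] zeros_iff[OF U(2)] zeros_iff[OF U(3)] zeros_iff[OF U(4)] by blast+
    then show False
      using net rule by (auto split: if_splits)
  next
    assume Z': "b \<in> ?Z \<and> d \<in> ?Z"
    then have "a \<notin> ?Z" "c \<notin> ?Z"
      using choice_unique[OF Z *(2,4,5)] choice_unique[OF Z *(3,6,7)] *(10,11) by blast+
    then have "g a \<noteq> 0" "g b = 0" "g d = 0"
      using Z' unfolding zeros_iff[OF U(1)] zeros_iff[OF U(2)] zeros_iff[OF U(3)] zeros_iff[OF U(4)] by blast+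
    moreover have "\<exists>z\<in>?Z. t z = v"
      using Z' tv by blast
    ultimately show False
      using net rule by auto
  qed
qed

text \<open>Minimality compares both incoming edges with the outgoing edges of their cycles in the
  same direction, and balance at the vertex forces equality.\<close>

lemma degenerate_edges:
  assumes Z: "choice Z" "\<not> nondegenerate Z"
  obtains C x y where "C \<in> Cycles" "x \<in> C" "y \<in> C" "h x = t y" "x \<noteq> y"
    "\<forall>f\<in>flow_space. (\<forall>e\<in>U. f $ rep Z e \<le> f $ e) \<longrightarrow> f $ x = f $ y"
proof -
  obtain v C D a b c d where *: "v \<in> I" "C \<in> Cycles" "D \<in> Cycles" "a \<in> C" "b \<in> C" "c \<in> D" "d \<in> D"
    "{e. h e = v} = {a, c}" "{e. t e = v} = {b, d}" "a \<noteq> b" "c \<noteq> d" "a \<noteq> c" "b \<noteq> d"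
    "a \<in> Z \<and> c \<in> Z \<or> b \<in> Z \<and> d \<in> Z"
    by (rule degenerate_vertex[OF Z])
  have hv: "h a = t b"
    using *(8,9) by (metis insertI1 mem_Collect_eq)
  have eq: "f $ a = f $ b" if f: "f \<in> flow_space" "\<And>e. e \<in> U \<Longrightarrow> f $ rep Z e \<le> f $ e" for f
  proof -
    have net: "netflow H (($) f) v = f $ b + f $ d - f $ a - f $ c"
      unfolding netflow_eq *(8,9) using *(12,13) by simp
    then have bal: "f $ b + f $ d = f $ a + f $ c"
      using f(1) *(1) by (simp add: flow_space_def)
    have le: "f $ z \<le> f $ e" if "B \<in> Cycles" "z \<in> B" "e \<in> B" "z \<in> Z" for B z e
      using f(2)[of e] rep_eq[OF Z(1) that(1,3,2,4)] that(1,3) by auto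
    from *(14) show ?thesis
    proof
      assume "a \<in> Z \<and> c \<in> Z"
      then show ?thesis
        using le[OF *(2,4,5)] le[OF *(3,6,7)] bal by simp
    next
      assume "b \<in> Z \<and> d \<in> Z"
      then show ?thesis
        using le[OF *(2,5,4)] le[OF *(3,7,6)] bal by simp
    qed
  qed
  show ?thesis
    by (rule that[OF *(2,4,5) hv *(10)]) (intro ballI impI, rule eq, assumption, erule bspec)
qed

end


section \<open>The flow complex\<close>

context framed_digraph
begin

lemma subspace_flow_space: "subspace flow_space"
  by (auto simp: subspace_def flow_space_def netflow_eq sum.distrib sum_distrib_left[symmetric]
      right_diff_distrib[symmetric] algebra_simps)

lemma ones_flow: "(\<chi> e. 1) \<in> flow_space"
  by (simp add: flow_space_def netflow_eq card_out card_in)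

lemma flow_cone_eq: "flow_cone H = {f \<in> flow_space. \<forall>e. 0 \<le> f $ e}"
  by (auto simp: flow_cone_def flow_space_def)

lemma flow_complex_eq: "flow_complex H = {f \<in> flow_cone H. flow_value f = 1}"
  by (simp add: flow_complex_def flow_value_def)

definition equal_flows :: "'e \<Rightarrow> 'e \<Rightarrow> (real ^ 'e) set" where
  "equal_flows x y = {f \<in> flow_space. f $ x = f $ y}"

definition consecutive :: "'e \<Rightarrow> 'e \<Rightarrow> bool" where
  "consecutive x y \<longleftrightarrow> (\<exists>C\<in>Cycles. x \<in> C \<and> y \<in> C) \<and> h x = t y \<and> x \<noteq> y"

text \<open>A flat containing what a degenerate choice contributes to the complex;
  \<open>cut_value\<close>, being linear, stands in for \<open>flow_value\<close>.\<close>

definition degenerate_part :: "'e set \<Rightarrow> 'e \<Rightarrow> 'e \<Rightarrow> (real ^ 'e) set" where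
  "degenerate_part Z x y = {f \<in> equal_flows x y. cut_value Z f = 1}"

lemma subspace_equal_flows: "subspace (equal_flows x y)"
proof -
  have "equal_flows x y = flow_space \<inter> {f. f $ x = f $ y}"
    by (auto simp: equal_flows_def)
  moreover have "subspace {f :: real ^ 'e. f $ x = f $ y}"
    by (auto simp: subspace_def)
  ultimately show ?thesis
    using subspace_flow_space subspace_inter by metis
qed

lemma equal_flows_proper: "consecutive x y \<Longrightarrow> \<not> flow_space \<subseteq> equal_flows x y"
  unfolding consecutive_def equal_flows_def using consecutive_edges_independent by blast

lemma dim_equal_flows: "consecutive x y \<Longrightarrow> dim (equal_flows x y) < dim flow_space"
proof -
  assume "consecutive x y"
  then have "equal_flows x y \<subset> flow_space"
    using equal_flows_proper by (auto simp: equal_flows_def)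
  then have "span (equal_flows x y) \<subset> span flow_space"
    using span_eq_iff subspace_equal_flows subspace_flow_space by metis
  then show ?thesis
    by (rule dim_psubset)
qed

lemma affine_degenerate_part: "affine (degenerate_part Z x y)"
  unfolding affine_def
proof (intro ballI allI impI)
  fix f g and u v :: real
  assume *: "f \<in> degenerate_part Z x y" "g \<in> degenerate_part Z x y" "u + v = 1"
  have "cut_value Z (u *\<^sub>R f + v *\<^sub>R g) = u * cut_value Z f + v * cut_value Z g"
    by (simp add: cut_value_def sum.distrib sum_distrib_left algebra_simps)
  then show "u *\<^sub>R f + v *\<^sub>R g \<in> degenerate_part Z x y"
    using * subspace_equal_flows[of x y] by (simp add: degenerate_part_def subspace_add subspace_scale)
qed

text \<open>The flat misses 0, so adjoining 0 raises its affine dimension by one and still stays in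
  \<open>equal_flows x y\<close>, a proper subspace of \<open>flow_space\<close>.\<close>

lemma aff_dim_degenerate_part:
  assumes "consecutive x y"
  shows "aff_dim (degenerate_part Z x y) + 1 < int (dim flow_space)"
proof -
  let ?T = "degenerate_part Z x y"
  have "0 \<notin> ?T"
    by (simp add: degenerate_part_def cut_value_def)
  then have "0 \<notin> affine hull ?T"
    using affine_degenerate_part by (simp add: affine_hull_eq[THEN iffD2])
  then have "aff_dim ?T + 1 = aff_dim (insert 0 ?T)"
    by (simp add: aff_dim_insert)
  also have "\<dots> = int (dim (insert 0 ?T))"
    by (rule aff_dim_zero) (simp add: hull_inc)
  also have "dim (insert 0 ?T) \<le> dim (equal_flows x y)"
    using subspace_0[OF subspace_equal_flows[of x y]]
    by (intro dim_subset) (auto simp: degenerate_part_def)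
  also have "dim (equal_flows x y) < dim flow_space"
    by (rule dim_equal_flows[OF assms])
  finally show ?thesis by simp
qed

text \<open>Choosing an edge of minimal flow on each cycle gives a choice adapted to
  \<open>f\<close>; if it is degenerate, two consecutive edges of a cycle agree on
  \<open>f\<close>.\<close>

lemma cone_cases:
  assumes f: "f \<in> flow_cone H"
  shows "(\<exists>Z. choice Z \<and> nondegenerate Z \<and> f \<in> region Z) \<or>
    (\<exists>Z x y. consecutive x y \<and> f \<in> equal_flows x y \<and> flow_value f = cut_value Z f)"
proof -
  have "\<exists>z. z \<in> C \<and> (\<forall>e\<in>C. f $ z \<le> f $ e)" if "C \<in> Cycles" for C
  proof -
    have "Min (($) f ` C) \<in> ($) f ` C"
      using cycle_nonempty[OF that] by (intro Min_in) auto
    then obtain z where "z \<in> C" "f $ z = Min (($) f ` C)" by auto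
    then show ?thesis by (intro exI[of _ z]) simp
  qed
  then obtain m where m: "\<And>C. C \<in> Cycles \<Longrightarrow> m C \<in> C" "\<And>C e. C \<in> Cycles \<Longrightarrow> e \<in> C \<Longrightarrow> f $ m C \<le> f $ e"
    by metis
  define Z where "Z = m ` Cycles"
  have Z: "choice Z"
    unfolding choice_def
  proof (intro conjI ballI)
    show "Z \<subseteq> U" using m(1) by (auto simp: Z_def)
    fix C assume C: "C \<in> Cycles"
    show "\<exists>!z. z \<in> Z \<and> z \<in> C"
    proof (rule ex1I[of _ "m C"])
      show "m C \<in> Z \<and> m C \<in> C" using C m(1) by (simp add: Z_def)
      fix z assume z: "z \<in> Z \<and> z \<in> C"
      then obtain D where D: "D \<in> Cycles" "z = m D" by (auto simp: Z_def)
      then have "D = C"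
        using cycles_disjoint[OF D(1) C, of z] m(1)[OF D(1)] z by simp
      then show "z = m C" using D by simp
    qed
  qed
  have le: "f $ rep Z e \<le> f $ e" if "e \<in> U" for e
  proof -
    note C = cyc_U[OF that]
    have "rep Z e = m (cyc e)"
      by (rule rep_eq[OF Z C m(1)[OF C(1)]]) (simp add: Z_def C(1))
    then show ?thesis using m(2)[OF C] by simp
  qed
  have space: "f \<in> flow_space" and nonneg: "\<forall>e. 0 \<le> f $ e"
    using f by (simp_all add: flow_cone_eq)
  show ?thesis
  proof (cases "nondegenerate Z")
    case True
    have "f \<in> region Z"
      unfolding region_def mem_Collect_eq using space nonneg le by (intro conjI ballI)
    then show ?thesis
      using Z True by blast
  next
    case False
    obtain C x y where xy: "C \<in> Cycles" "x \<in> C" "y \<in> C" "h x = t y" "x \<noteq> y"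
      "\<forall>f\<in>flow_space. (\<forall>e\<in>U. f $ rep Z e \<le> f $ e) \<longrightarrow> f $ x = f $ y"
      by (rule degenerate_edges[OF Z False])
    have "consecutive x y"
      using xy(1-5) by (auto simp: consecutive_def)
    moreover have "f \<in> equal_flows x y"
      using space bspec[OF xy(6) space] le unfolding equal_flows_def by blast
    moreover have "flow_value f = cut_value Z f"
      by (rule flow_value_cut[OF Z le])
    ultimately show ?thesis by blast
  qed
qed

definition choices :: "'e set set" where
  "choices = {Z. choice Z \<and> nondegenerate Z}"

lemma Flows_eq: "Flows = (\<Union>Z\<in>choices. {g \<in> Flows. zeros g = Z})"
  using choice_zeros nondegenerate_zeros by (auto simp: choices_def)

lemma total_fan:
  "has_unimodular_fan flow_space flow_value (\<Union>Z\<in>choices. region Z) (\<Union>Z\<in>choices. open_region Z) Flows"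
  by (subst Flows_eq, rule has_unimodular_fan_UNION)
    (use region_fan open_region_disjoint in \<open>auto simp: choices_def\<close>)

text \<open>Otherwise finitely many proper subspaces \<open>equal_flows x y\<close> would cover the
  flow cone and thereby, after shifting by constant flows, the whole flow space.\<close>

lemma choices_nonempty: "choices \<noteq> {}"
proof
  assume empty: "choices = {}"
  let ?F = "{equal_flows x y | x y. consecutive x y}"
  have fin: "finite ?F"
    by (rule finite_subset[of _ "(\<lambda>(x, y). equal_flows x y) ` UNIV"]) auto
  have "flow_space \<subseteq> \<Union>?F"
  proof
    fix w assume w: "w \<in> flow_space"
    define c where "c = (\<Sum>e\<in>UNIV. \<bar>w $ e\<bar>)"
    \<comment> \<open>Adding a large constant flow makes \<open>w\<close> nonnegative and changes no
      difference of two coordinates.\<close>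
    define f where "f = w + c *\<^sub>R (\<chi> e. 1)"
    have "0 \<le> f $ e" for e
    proof -
      have "\<bar>w $ e\<bar> \<le> c"
        unfolding c_def by (rule member_le_sum) simp_all
      then show ?thesis by (simp add: f_def)
    qed
    moreover have "f \<in> flow_space"
      unfolding f_def using w ones_flow subspace_flow_space by (simp add: subspace_add subspace_scale)
    ultimately have "f \<in> flow_cone H"
      by (simp add: flow_cone_eq)
    from cone_cases[OF this] obtain x y where xy: "consecutive x y" "f \<in> equal_flows x y"
      using empty by (auto simp: choices_def)
    then have "w \<in> equal_flows x y"
      using w by (simp add: equal_flows_def f_def)
    then show "w \<in> \<Union>?F" using xy(1) by blast
  qed
  then have "\<exists>T\<in>?F. flow_space \<subseteq> T"
    by (rule convex_subset_Union_affine[OF fin subspace_imp_convex[OF subspace_flow_space]])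
      (use ones_flow subspace_imp_affine[OF subspace_equal_flows] in auto)
  then show False
    using equal_flows_proper by auto
qed

text \<open>A fan without cells covers nothing, yet 0 lies in every region.\<close>

lemma Flows_nonempty: "Flows \<noteq> {}"
proof
  assume "Flows = {}"
  obtain M J where "unimodular_fan flow_space flow_value (\<Union>Z\<in>choices. region Z) (\<Union>Z\<in>choices. open_region Z) Flows M J"
    using total_fan by (auto simp: has_unimodular_fan_def)
  then have "(\<Union>Z\<in>choices. region Z) = {}"
    using \<open>Flows = {}\<close> by (simp add: unimodular_fan_def)
  moreover obtain Z where "Z \<in> choices"
    using choices_nonempty by blast
  moreover have "0 \<in> region Z"
    using subspace_0[OF subspace_flow_space] by (simp add: region_def)
  ultimately show False by blast
qed

lemma flow_complex_borel: "flow_complex H \<in> sets borel"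
proof -
  have "flow_complex H = {f. \<forall>e. 0 \<le> f $ e} \<inter> flow_space \<inter> flow_value -` {1}"
    by (auto simp: flow_complex_eq flow_cone_eq)
  moreover have "{f :: real ^ 'e. \<forall>e. 0 \<le> f $ e} \<in> sets borel"
    by (intro borel_closed closed_Collect_all closed_Collect_le continuous_intros)
  moreover have "flow_space \<in> sets borel"
    by (intro borel_closed closed_subspace subspace_flow_space)
  moreover have "flow_value \<in> borel_measurable borel"
    unfolding flow_value_def
    by (intro borel_measurable_add borel_measurable_sum borel_measurable_Min
        borel_measurable_continuous_onI continuous_intros) simp
  then have "flow_value -` {1} \<in> sets borel"
    using measurable_sets[of flow_value borel borel "{1}"] by simp
  ultimately show ?thesis by simp
qed

lemma volume_flow_complex:
  "finite Flows \<and> normalized_volume (flow_complex H) = card Flows"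
proof -
  obtain M J where fan: "unimodular_fan flow_space flow_value (\<Union>Z\<in>choices. region Z) (\<Union>Z\<in>choices. open_region Z) Flows M J"
    using total_fan by (auto simp: has_unimodular_fan_def)
  \<comment> \<open>The flats that absorb the flows whose minimizing choice is degenerate.\<close>
  let ?F = "{degenerate_part Z x y | Z x y. consecutive x y}"
  interpret fan_complex flow_space flow_value "\<Union>Z\<in>choices. region Z" "\<Union>Z\<in>choices. open_region Z" Flows M J
    "flow_complex H" ?F
  proof
    show "unimodular_fan flow_space flow_value (\<Union>Z\<in>choices. region Z) (\<Union>Z\<in>choices. open_region Z) Flows M J"
      by (rule fan)
    show "Flows \<noteq> {}" by (rule Flows_nonempty)
    have "\<not> flow_space \<subseteq> {0}"
    proof
      assume "flow_space \<subseteq> {0}"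
      then have "((\<chi> e. 1) :: real ^ 'e) = 0"
        using ones_flow by blast
      then show False
        by (simp add: vec_eq_iff)
    qed
    then show "0 < dim flow_space"
      by (metis dim_eq_0 gr0I)
    have "region Z \<subseteq> flow_cone H" for Z
      by (auto simp: region_def flow_cone_eq)
    then show "{f \<in> \<Union>Z\<in>choices. region Z. flow_value f = 1} \<subseteq> flow_complex H"
      by (auto simp: flow_complex_eq)
    show "flow_complex H \<subseteq> {f \<in> \<Union>Z\<in>choices. region Z. flow_value f = 1} \<union> \<Union>?F"
    proof
      fix f assume "f \<in> flow_complex H"
      then have f: "f \<in> flow_cone H" "flow_value f = 1"
        by (simp_all add: flow_complex_eq)
      from cone_cases[OF f(1)] show "f \<in> {f \<in> \<Union>Z\<in>choices. region Z. flow_value f = 1} \<union> \<Union>?F"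
      proof
        assume "\<exists>Z. choice Z \<and> nondegenerate Z \<and> f \<in> region Z"
        then show ?thesis
          using f(2) by (auto simp: choices_def)
      next
        assume "\<exists>Z x y. consecutive x y \<and> f \<in> equal_flows x y \<and> flow_value f = cut_value Z f"
        then obtain Z x y where "consecutive x y" "f \<in> equal_flows x y" "flow_value f = cut_value Z f"
          by (elim exE conjE)
        then have "f \<in> degenerate_part Z x y" "degenerate_part Z x y \<in> ?F"
          using f(2) by (auto simp: degenerate_part_def)
        then show ?thesis by blast
      qed
    qed
    show "finite ?F"
      by (rule finite_subset[of _ "(\<lambda>(Z, x, y). degenerate_part Z x y) ` UNIV"]) auto
    show "affine T" if "T \<in> ?F" for T
      using that affine_degenerate_part by auto
    show "aff_dim T + 1 < int (dim flow_space)" if "T \<in> ?F" for T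
      using that aff_dim_degenerate_part by auto
    show "flow_complex H \<in> sets borel"
      by (rule flow_complex_borel)
  qed
  show ?thesis
    using finite_K normalized_volume_S by simp
qed

end

theorem theorem6p30:
  fixes H :: "('v, 'e::finite) pre_digraph" and col :: "'e \<Rightarrow> colour"
  assumes "arcs H = UNIV"
    and "full_digraph H"
    and "cyclic_ample_framing H col"
    and "loops_avoid_longer_cycles H"
  shows "finite (cyclic_volume_integer_flows H) \<and>
         normalized_volume (flow_complex H) = real (card (cyclic_volume_integer_flows H))"
proof -
  interpret framed_digraph H col
    using assms by unfold_locales
  show ?thesis
    by (rule volume_flow_complex)
qed

end
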